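(* Let $\lambda,\beta,\mu>0$, $\delta\in(1,2)$, and let $G\in C^2([0,\infty))$ with $\|G'\|_\infty<\infty$. Let $K_h$ be the clamped ULA kernel defined in the context, $V(x)=1+x^2$ and $\|\nu\|_V=\sup_{|f|\le V}|\nu(f)|=\int V\,d|\nu|$. Then $K_h$ is $V$-uniformly geometrically ergodic, uniformly in $h$, at rate $1-ch$ for some $c>0$: there exist $c>0$, $C<\infty$ and $h_0>0$ such that, for all $h\in(0,h_0]$, $K_h$ has a unique stationary distribution $\pi_h$ and $$\bigl\|K_h^n(x,\cdot)-\pi_h\bigr\|_V\le C\,V(x)\,(1-ch)^n,\qquad x\in[0,\infty),\ n\ge0 .$$
   Context: Zero-potential resolvent kernel. For $h>0$ put $\alpha=1/h$, $a=\alpha/(2\lambda)$, $b=\delta/2$, $z_x=\lambda\beta x^2/2$, $m'(x)=\beta x^{\delta-1}e^{-\lambda\beta x^2/2}$. $M(a,b,z)={}_1F_1(a;b;z)$ and $U(a,b,z)$ are Kummer's confluent hypergeometric functions of the first and second kind. Put $U_0=U(a,b,0)=\Gamma(1-b)/\Gamma(1+a-b)$, $|\mathcal W|=\lambda\beta\,\frac{\Gamma(b)}{\Gamma(a)}(\lambda\beta/2)^{-b}$, $c_\mu=-\alpha/(\mu|\mathcal W|+\alpha U_0)$, $f_0^{\rm sticky}(x)=M(a,b,z_x)+c_\mu U(a,b,z_x)$, $G^{\rm sticky}_\alpha(x,y)=f_0^{\rm sticky}(x\wedge y)\,U(a,b,z_{x\vee y})/|\mathcal W|$. The Markov kernel $$R_h(s,dy)=\alpha\,G^{\rm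 sticky}_\alpha(s,y)\,m'(y)\,dy-c_\mu\,U(a,b,z_s)\,\delta_0(dy),\qquad s\ge0,$$ on $[0,\infty)$ is the law, at an independent $\mathrm{Exp}(\alpha)$ time, of the sticky CIR process with zero potential started at $s$ (the diffusion on $[0,\infty)$ with interior drift $\frac{\delta-1}{\beta x}-\lambda x$, diffusion coefficient $\sqrt{2/\beta}$, and speed measure $m'(x)dx+\mu^{-1}\delta_0(dx)$). Clamped Euler map: with $L_h=h\|G'\|_\infty$, a clamped Euler map is a map $\phi_h:[0,\infty)\to[0,\infty)$ with $\phi_h(x)=x-hG'(x)$ for $x\ge L_h$ and $\phi_h(0)=0$. Here it is fixed to the $C^1$ form $\phi_h(x)=\chi_h(x)\,(x-hG'(x))$, where $\chi_h\in C^1([0,\infty))$ is a cutoff with $\chi_h\equiv1$ on $[L_h,\infty)$ and $\chi_h(0)=0$ (e.g. $\chi_h(x)=\sin^2(\pi x/(2L_h))$ on $[0,L_h]$). Clamped ULA kernel: $K_h=R_h\circ\phi_h$, i.e. $K_h(x,\cdot)=R_h(\phi_h(x),\cdot)$. *)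

theory Defs
  imports "HOL-Probability.Probability"
begin

definition kummer_M :: "real \<Rightarrow> real \<Rightarrow> real \<Rightarrow> real" where
  "kummer_M a b z = eval_fps (fps_hypergeo [a] [b] 1) z"

text \<open>Kummer's function of the second kind through the connection formula, which defines it
  for non-integer \<open>b\<close>; here \<open>b\<close> is always in the open interval from \<open>1/2\<close> to \<open>1\<close>.
  Since \<open>0 powr (1 - b) = 0\<close>, the formula is also correct at \<open>z = 0\<close> when \<open>b < 1\<close>.\<close>

definition kummer_U :: "real \<Rightarrow> real \<Rightarrow> real \<Rightarrow> real" where
  "kummer_U a b z =
     Gamma (1 - b) / Gamma (1 + a - b) * kummer_M a b z
     + Gamma (b - 1) / Gamma a * z powr (1 - b) * kummer_M (1 + a - b) (2 - b) z"

lemma kummer_U_0: "kummer_U a b 0 = Gamma (1 - b) / Gamma (1 + a - b)"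
  by (simp add: kummer_U_def kummer_M_def eval_fps_at_0)

definition cir_z :: "real \<Rightarrow> real \<Rightarrow> real \<Rightarrow> real" where
  "cir_z lam \<beta> x = lam * \<beta> * x\<^sup>2 / 2"

definition cir_speed :: "real \<Rightarrow> real \<Rightarrow> real \<Rightarrow> real \<Rightarrow> real" where
  "cir_speed lam \<beta> \<delta> x = \<beta> * x powr (\<delta> - 1) * exp (- (lam * \<beta> * x\<^sup>2 / 2))"

definition cir_wronskian :: "real \<Rightarrow> real \<Rightarrow> real \<Rightarrow> real \<Rightarrow> real" where
  "cir_wronskian lam \<beta> \<delta> \<alpha> =
     (let a = \<alpha> / (2 * lam); b = \<delta> / 2
      in lam * \<beta> * (Gamma b / Gamma a) * (lam * \<beta> / 2) powr (- b))"

definition sticky_coeff :: "real \<Rightarrow> real \<Rightarrow> real \<Rightarrow> real \<Rightarrow> real \<Rightarrow> real" where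
  "sticky_coeff lam \<beta> \<delta> \<mu> \<alpha> =
     - \<alpha> / (\<mu> * cir_wronskian lam \<beta> \<delta> \<alpha> + \<alpha> * kummer_U (\<alpha> / (2 * lam)) (\<delta> / 2) 0)"

definition sticky_f0 :: "real \<Rightarrow> real \<Rightarrow> real \<Rightarrow> real \<Rightarrow> real \<Rightarrow> real \<Rightarrow> real" where
  "sticky_f0 lam \<beta> \<delta> \<mu> \<alpha> x =
     kummer_M (\<alpha> / (2 * lam)) (\<delta> / 2) (cir_z lam \<beta> x)
     + sticky_coeff lam \<beta> \<delta> \<mu> \<alpha> * kummer_U (\<alpha> / (2 * lam)) (\<delta> / 2) (cir_z lam \<beta> x)"

definition sticky_green :: "real \<Rightarrow> real \<Rightarrow> real \<Rightarrow> real \<Rightarrow> real \<Rightarrow> real \<Rightarrow> real \<Rightarrow> real" where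
  "sticky_green lam \<beta> \<delta> \<mu> \<alpha> x y =
     sticky_f0 lam \<beta> \<delta> \<mu> \<alpha> (min x y)
     * kummer_U (\<alpha> / (2 * lam)) (\<delta> / 2) (cir_z lam \<beta> (max x y))
     / cir_wronskian lam \<beta> \<delta> \<alpha>"

definition halfline :: "real measure" where
  "halfline = restrict_space borel {0..}"

definition sticky_resolvent ::
    "real \<Rightarrow> real \<Rightarrow> real \<Rightarrow> real \<Rightarrow> real \<Rightarrow> real \<Rightarrow> real measure" where
  "sticky_resolvent lam \<beta> \<delta> \<mu> h s =
     (let \<alpha> = 1 / h
      in measure_of (space halfline) (sets halfline)
           (\<lambda>A. (\<integral>\<^sup>+y\<in>A. ennreal (\<alpha> * sticky_green lam \<beta> \<delta> \<mu> \<alpha> s y * cir_speed lam \<beta> \<delta> y) \<partial>lborel)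
              + ennreal (- sticky_coeff lam \<beta> \<delta> \<mu> \<alpha>
                           * kummer_U (\<alpha> / (2 * lam)) (\<delta> / 2) (cir_z lam \<beta> s))
                * indicator A 0))"

definition sup_norm :: "(real \<Rightarrow> real) \<Rightarrow> real" where
  "sup_norm g = (SUP x\<in>{0..}. \<bar>g x\<bar>)"

definition C1_halfline :: "(real \<Rightarrow> real) \<Rightarrow> bool" where
  "C1_halfline f \<longleftrightarrow>
     (\<exists>f'. (\<forall>x\<ge>0. (f has_real_derivative f' x) (at x within {0..})) \<and> continuous_on {0..} f')"

text \<open>If \<open>L = 0\<close>, the conditions \<open>\<eta> = 1\<close> on \<open>{L..}\<close> and \<open>\<eta> 0 = 0\<close> contradict each other,
  hence the guard on the latter; the clamped map \<open>\<eta> x * x\<close> then vanishes at \<open>0\<close> anyway.\<close>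

definition clamp_cutoff :: "real \<Rightarrow> (real \<Rightarrow> real) \<Rightarrow> bool" where
  "clamp_cutoff L \<eta> \<longleftrightarrow>
     C1_halfline \<eta> \<and> (\<forall>x\<ge>0. 0 \<le> \<eta> x \<and> \<eta> x \<le> 1) \<and> (\<forall>x\<ge>L. \<eta> x = 1) \<and> (0 < L \<longrightarrow> \<eta> 0 = 0)"

definition clamped_euler_map :: "(real \<Rightarrow> real) \<Rightarrow> real \<Rightarrow> (real \<Rightarrow> real) \<Rightarrow> bool" where
  "clamped_euler_map G' h \<phi> \<longleftrightarrow>
     (\<forall>x\<ge>0. 0 \<le> \<phi> x) \<and> (\<forall>x\<ge>h * sup_norm G'. \<phi> x = x - h * G' x) \<and> \<phi> 0 = 0"

definition cutoff_euler :: "(real \<Rightarrow> real) \<Rightarrow> (real \<Rightarrow> real) \<Rightarrow> real \<Rightarrow> real \<Rightarrow> real" where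
  "cutoff_euler \<eta> G' h x = \<eta> x * (x - h * G' x)"

definition clamped_ula ::
    "real \<Rightarrow> real \<Rightarrow> real \<Rightarrow> real \<Rightarrow> (real \<Rightarrow> real) \<Rightarrow> real \<Rightarrow> real \<Rightarrow> real measure" where
  "clamped_ula lam \<beta> \<delta> \<mu> \<phi> h x = sticky_resolvent lam \<beta> \<delta> \<mu> h (\<phi> x)"

primrec kernel_pow :: "'a measure \<Rightarrow> ('a \<Rightarrow> 'a measure) \<Rightarrow> nat \<Rightarrow> 'a \<Rightarrow> 'a measure" where
  "kernel_pow S K 0 x = return S x"
| "kernel_pow S K (Suc n) x = kernel_pow S K n x \<bind> K"

definition stationary_distribution :: "'a measure \<Rightarrow> ('a \<Rightarrow> 'a measure) \<Rightarrow> 'a measure \<Rightarrow> bool" where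
  "stationary_distribution S K \<pi> \<longleftrightarrow> prob_space \<pi> \<and> sets \<pi> = sets S \<and> \<pi> \<bind> K = \<pi>"

text \<open>The \<open>V\<close>-norm of the signed measure \<open>P - Q\<close>, for finite \<open>P\<close> and \<open>Q\<close> on the same
  \<open>\<sigma>\<close>-algebra. The Bochner integral of a non-integrable function is \<open>0\<close>, so the supremum is
  meaningful only if \<open>V\<close> is integrable under both measures; otherwise the value is infinite.\<close>

definition V_norm_diff :: "('a \<Rightarrow> real) \<Rightarrow> 'a measure \<Rightarrow> 'a measure \<Rightarrow> ennreal" where
  "V_norm_diff V P Q =
     (if integrable P V \<and> integrable Q V
      then (SUP f\<in>{f \<in> borel_measurable P. \<forall>x\<in>space P. \<bar>f x\<bar> \<le> V x}.
              ennreal \<bar>(\<integral>x. f x \<partial>P) - (\<integral>x. f x \<partial>Q)\<bar>)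
      else \<infinity>)"

end

theory Submission
  imports Defs "HOL-Real_Asymp.Real_Asymp"
begin

text \<open>Write \<open>R\<close> for the resolvent kernel and \<open>\<phi>\<close> for the clamped Euler map, so that
  \<open>\<phi> x \<le> x + h M\<close> with \<open>M = sup_norm G'\<close>. The densities of \<open>R s\<close> and \<open>R s'\<close> cross exactly once, which
  couples them monotonically. Hence if \<open>W\<close> is increasing, vanishes at \<open>0\<close> and dominates \<open>1 + x\<^sup>2\<close> elsewhere,
  then a bound \<open>W (max x y)\<close> on the oscillation \<open>\<bar>f x - f y\<bar>\<close> turns under the chain into the integral of
  \<open>W\<close> under \<open>R (x + h M)\<close>: two copies of the chain have met once the larger one sits at the atom. It
  remains to find \<open>W\<close> whose integral under \<open>R (x + h M)\<close> is at most \<open>(1 - c h) * W x\<close> for \<open>x > 0\<close>.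
  We take \<open>W x = 1 + kap * g x + x\<^sup>2\<close> off \<open>0\<close>, where \<open>g' x = x powr (1 - \<delta>) * exp (- B x)\<close>: for large \<open>B\<close>
  the generator maps \<open>g\<close> to a large negative multiple of \<open>g'\<close>, which beats the drift \<open>M\<close>, while within
  distance of order \<open>sqrt h\<close> of \<open>0\<close> the jump of \<open>W\<close> does, because there the atom carries at least half of
  the mass of \<open>R s\<close>.\<close>

section \<open>Kummer's function of the first kind\<close>

text \<open>\<open>kummer_U\<close> is given by its connection formula, a difference of two
  solutions that both grow exponentially. That it is positive and decreasing is therefore a
  statement about cancellation: the constant in the formula has to be the limit of the quotient of
  the two solutions. This limit is identified through Laplace transforms, whose blow-up at 1 is
  governed by power series with explicit coefficients. The estimates afterwards avoid asymptotics of
  Kummer functions, which would have to be uniform as the parameter 1 / (2 lam h) tends to infinity.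
  One identity replaces them: the resolvent integral of f is expressed through the generator of f
  and its flux at 0. With 1, y^2, y^4 and \<open>scale_fn\<close> as test functions it gives bounds
  whose dependence on \<open>h\<close> is explicit; even the mass of the atom is estimated from
  moments alone. The stationary law is built from excursions, and uniqueness is tested on
  indicators, which covers competitors whose \<open>V\<close>-moment may be infinite.\<close>

definition kummer_coeff :: "real \<Rightarrow> real \<Rightarrow> nat \<Rightarrow> real" where
  "kummer_coeff a b n = pochhammer a n / (pochhammer b n * fact n)"

lemma kummer_coeff_pos: "0 < a \<Longrightarrow> 0 < b \<Longrightarrow> 0 < kummer_coeff a b n"
  by (simp add: kummer_coeff_def pochhammer_pos)

lemma kummer_coeff_Suc:
  assumes "0 < b"
  shows "(real n + 1) * (real n + b) * kummer_coeff a b (Suc n) = (real n + a) * kummer_coeff a b n"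
proof -
  have "pochhammer b n > 0" using assms by (rule pochhammer_pos)
  then show ?thesis using assms
    by (simp add: kummer_coeff_def pochhammer_Suc divide_simps) (simp add: algebra_simps)
qed

lemma kummer_nth: "fps_nth (fps_hypergeo [a] [b] (1::real)) n = kummer_coeff a b n"
  by (simp add: kummer_coeff_def)

lemma kummer_conv_radius:
  assumes "0 < a" "0 < b"
  shows "fps_conv_radius (fps_hypergeo [a] [b] (1::real)) = \<infinity>"
proof -
  have eq: "norm (kummer_coeff a b n) / norm (kummer_coeff a b (Suc n))
      = (real n + 1) * (real n + b) / (real n + a)" for n
    using kummer_coeff_Suc[OF assms(2), of n a] kummer_coeff_pos[OF assms, of n]
      kummer_coeff_pos[OF assms, of "Suc n"] assms
    by (simp add: field_simps)
  have "filterlim (\<lambda>n. (real n + 1) * (real n + b) / (real n + a)) at_top sequentially"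
    by real_asymp
  then have "(\<lambda>n. ereal (norm (kummer_coeff a b n) / norm (kummer_coeff a b (Suc n)))) \<longlonglongrightarrow> \<infinity>"
    unfolding eq by (simp add: tendsto_PInfty_eq_at_top)
  then have "conv_radius (kummer_coeff a b) = \<infinity>"
    by (intro conv_radius_ratio_limit_ereal_nonzero) auto
  then show ?thesis
    by (simp add: fps_conv_radius_def kummer_nth[abs_def] del: fps_hypergeo_nth)
qed

definition kummer_dM :: "real \<Rightarrow> real \<Rightarrow> real \<Rightarrow> real" where
  "kummer_dM a b z = eval_fps (fps_deriv (fps_hypergeo [a] [b] 1)) z"

definition kummer_ddM :: "real \<Rightarrow> real \<Rightarrow> real \<Rightarrow> real" where
  "kummer_ddM a b z = eval_fps (fps_deriv (fps_deriv (fps_hypergeo [a] [b] 1))) z"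

context
  fixes a b :: real
  assumes a: "0 < a" and b: "0 < b"
begin

lemma kummer_M_sums: "(\<lambda>n. kummer_coeff a b n * z ^ n) sums kummer_M a b z"
  unfolding kummer_M_def kummer_nth[symmetric]
  by (rule sums_eval_fps) (simp add: kummer_conv_radius[OF a b])

lemma kummer_conv_radius_deriv: "fps_conv_radius (fps_deriv (fps_hypergeo [a] [b] (1::real))) = \<infinity>"
  using fps_conv_radius_deriv[of "fps_hypergeo [a] [b] (1::real)"] kummer_conv_radius[OF a b] by simp

lemma kummer_conv_radius_deriv2:
  "fps_conv_radius (fps_deriv (fps_deriv (fps_hypergeo [a] [b] (1::real)))) = \<infinity>"
  using fps_conv_radius_deriv[of "fps_deriv (fps_hypergeo [a] [b] (1::real))"]
    kummer_conv_radius_deriv by simp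

lemma kummer_M_deriv [derivative_intros]:
  "(f has_real_derivative f') (at x within S) \<Longrightarrow>
   ((\<lambda>x. kummer_M a b (f x)) has_real_derivative (kummer_dM a b (f x) * f')) (at x within S)"
  unfolding kummer_M_def kummer_dM_def
  by (rule DERIV_chain2[OF has_field_derivative_eval_fps]) (auto simp: kummer_conv_radius[OF a b])

lemma kummer_dM_deriv [derivative_intros]:
  "(f has_real_derivative f') (at x within S) \<Longrightarrow>
   ((\<lambda>x. kummer_dM a b (f x)) has_real_derivative (kummer_ddM a b (f x) * f')) (at x within S)"
  unfolding kummer_dM_def kummer_ddM_def
  by (rule DERIV_chain2[OF has_field_derivative_eval_fps]) (auto simp: kummer_conv_radius_deriv)

lemma kummer_M_cont [continuous_intros]:
  "continuous_on S f \<Longrightarrow> continuous_on S (\<lambda>x. kummer_M a b (f x))"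
proof -
  have "continuous_on UNIV (kummer_M a b)"
    by (rule DERIV_continuous_on) (rule kummer_M_deriv[OF DERIV_ident, simplified])
  then show "continuous_on S f \<Longrightarrow> ?thesis" by (rule continuous_on_compose2) auto
qed

lemma kummer_dM_cont [continuous_intros]:
  "continuous_on S f \<Longrightarrow> continuous_on S (\<lambda>x. kummer_dM a b (f x))"
proof -
  have "continuous_on UNIV (kummer_dM a b)"
    by (rule DERIV_continuous_on) (rule kummer_dM_deriv[OF DERIV_ident, simplified])
  then show "continuous_on S f \<Longrightarrow> ?thesis" by (rule continuous_on_compose2) auto
qed

lemma kummer_dM_sums: "(\<lambda>n. (real n + 1) * kummer_coeff a b (Suc n) * z ^ n) sums kummer_dM a b z"
proof -
  have "(\<lambda>n. fps_nth (fps_deriv (fps_hypergeo [a] [b] (1::real))) n * z ^ n) sums kummer_dM a b z"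
    unfolding kummer_dM_def by (rule sums_eval_fps) (simp add: kummer_conv_radius_deriv)
  then show ?thesis by (simp add: kummer_nth add.commute del: fps_hypergeo_nth)
qed

lemma kummer_ddM_sums:
  "(\<lambda>n. (real n + 1) * (real n + 2) * kummer_coeff a b (Suc (Suc n)) * z ^ n) sums kummer_ddM a b z"
proof -
  have "(\<lambda>n. fps_nth (fps_deriv (fps_deriv (fps_hypergeo [a] [b] (1::real)))) n * z ^ n) sums kummer_ddM a b z"
    unfolding kummer_ddM_def by (rule sums_eval_fps) (simp add: kummer_conv_radius_deriv2)
  then show ?thesis by (simp add: kummer_nth algebra_simps del: fps_hypergeo_nth)
qed

text \<open>Coefficientwise this is the recurrence \<open>kummer_coeff_Suc\<close>. The equation is
  what puts the fluxes \<open>PM\<close> and \<open>PN\<close> below into self-adjoint form.\<close>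

lemma kummer_ode: "z * kummer_ddM a b z + (b - z) * kummer_dM a b z = a * kummer_M a b z"
proof -
  let ?c = "kummer_coeff a b"
  \<comment> \<open>Multiplication by z shifts the series by one; the factor \<open>real n\<close>
    supplies the missing zero term at n = 0.\<close>
  have 1: "(\<lambda>n. real n * (real n + 1) * ?c (Suc n) * z ^ n) sums (z * kummer_ddM a b z)"
  proof -
    have "(\<lambda>n. real (Suc n) * (real (Suc n) + 1) * ?c (Suc (Suc n)) * z ^ Suc n) sums (z * kummer_ddM a b z)"
      using sums_mult[OF kummer_ddM_sums, of z z] by (simp add: algebra_simps)
    from sums_Suc[OF this] show ?thesis by simp
  qed
  have 2: "(\<lambda>n. real n * ?c n * z ^ n) sums (z * kummer_dM a b z)"
  proof -
    have "(\<lambda>n. real (Suc n) * ?c (Suc n) * z ^ Suc n) sums (z * kummer_dM a b z)"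
      using sums_mult[OF kummer_dM_sums, of z z] by (simp add: algebra_simps)
    from sums_Suc[OF this] show ?thesis by simp
  qed
  have "(\<lambda>n. real n * (real n + 1) * ?c (Suc n) * z ^ n + b * ((real n + 1) * ?c (Suc n) * z ^ n)
      - real n * ?c n * z ^ n) sums (z * kummer_ddM a b z + b * kummer_dM a b z - z * kummer_dM a b z)"
    by (intro sums_diff sums_add 1 2 sums_mult kummer_dM_sums)
  moreover have "real n * (real n + 1) * ?c (Suc n) * z ^ n + b * ((real n + 1) * ?c (Suc n) * z ^ n)
      - real n * ?c n * z ^ n = a * (?c n * z ^ n)" for n
  proof -
    have "real n * (real n + 1) * ?c (Suc n) * z ^ n + b * ((real n + 1) * ?c (Suc n) * z ^ n)
      = ((real n + 1) * (real n + b) * ?c (Suc n)) * z ^ n" by (simp add: algebra_simps)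
    then show ?thesis unfolding kummer_coeff_Suc[OF b] by (simp add: algebra_simps)
  qed
  ultimately have "(\<lambda>n. a * (?c n * z ^ n)) sums
      (z * kummer_ddM a b z + b * kummer_dM a b z - z * kummer_dM a b z)" by simp
  with sums_mult[OF kummer_M_sums, of a z] show ?thesis
    using sums_unique2 by (fastforce simp: algebra_simps)
qed

lemma kummer_M_0: "kummer_M a b 0 = 1"
  by (simp add: kummer_M_def eval_fps_at_0)

lemma kummer_M_ge_1: "0 \<le> z \<Longrightarrow> 1 \<le> kummer_M a b z"
proof -
  assume z: "0 \<le> z"
  have "(\<Sum>n<1. kummer_coeff a b n * z ^ n) \<le> kummer_M a b z"
    using kummer_M_sums[of z] z kummer_coeff_pos[OF a b]
    by (intro sum_le_suminf[of "\<lambda>n. kummer_coeff a b n * z ^ n" "{..<1}", THEN order_trans])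
      (auto simp: sums_iff less_imp_le)
  then show ?thesis by (simp add: kummer_coeff_def)
qed

lemma kummer_dM_pos: "0 \<le> z \<Longrightarrow> 0 < kummer_dM a b z"
proof -
  assume z: "0 \<le> z"
  have "(\<Sum>n<1. (real n + 1) * kummer_coeff a b (Suc n) * z ^ n) \<le> kummer_dM a b z"
    using kummer_dM_sums[of z] z kummer_coeff_pos[OF a b]
    by (intro sum_le_suminf[of "\<lambda>n. (real n + 1) * kummer_coeff a b (Suc n) * z ^ n" "{..<1}", THEN order_trans])
      (auto simp: sums_iff less_imp_le)
  moreover have "0 < kummer_coeff a b (Suc 0)" by (rule kummer_coeff_pos[OF a b])
  ultimately show ?thesis by simp
qed

text \<open>Termwise Gamma integrals. In \<open>ennreal\<close> the sum and the integral can be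
  exchanged without a convergence condition. What matters later is the blow-up as t decreases to 1,
  which records the growth of the function at infinity.\<close>

lemma kummer_M_nn_Laplace:
  assumes s: "0 < s" and t: "0 < t"
  shows "(\<integral>\<^sup>+z. ennreal (indicator {0..} z * (z powr (s - 1) * exp (- z * t) * kummer_M a b z)) \<partial>lborel)
     = (\<Sum>n. ennreal (kummer_coeff a b n * Gamma (real n + s) / t powr (real n + s)))"
proof -
  let ?c = "kummer_coeff a b"
  have c: "0 \<le> ?c n" for n using kummer_coeff_pos[OF a b, of n] by simp
  have G: "(\<integral>\<^sup>+z. ennreal (indicator {0..} z * (z powr (r - 1) * exp (- z * t))) \<partial>lborel) = ennreal (Gamma r / t powr r)"
    if r: "0 < r" for r
  proof -
    have "ennreal (Gamma r) = (\<integral>\<^sup>+z. ennreal (indicator {0..} z * z powr (r - 1) / exp z) \<partial>lborel)"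
      by (rule Gamma_conv_nn_integral_real[OF r])
    also have "\<dots> = ennreal \<bar>t\<bar> * (\<integral>\<^sup>+z. ennreal (indicator {0..} (0 + t * z) * (0 + t * z) powr (r - 1) / exp (0 + t * z)) \<partial>lborel)"
      by (rule nn_integral_real_affine) (use t in auto)
    also have "\<dots> = ennreal t * (\<integral>\<^sup>+z. ennreal (t powr (r - 1)) * ennreal (indicator {0..} z * (z powr (r - 1) * exp (- z * t))) \<partial>lborel)"
      using t by (intro arg_cong2[where f = "(*)"] nn_integral_cong)
        (auto simp: indicator_def powr_mult exp_minus divide_simps ennreal_mult'[symmetric] zero_le_mult_iff mult.commute)
    also have "\<dots> = ennreal t * (ennreal (t powr (r - 1)) * (\<integral>\<^sup>+z. ennreal (indicator {0..} z * (z powr (r - 1) * exp (- z * t))) \<partial>lborel))"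
      by (subst nn_integral_cmult) auto
    also have "\<dots> = ennreal (t powr r) * (\<integral>\<^sup>+z. ennreal (indicator {0..} z * (z powr (r - 1) * exp (- z * t))) \<partial>lborel)"
      using t by (simp add: mult.assoc[symmetric] ennreal_mult'[symmetric] powr_diff)
    finally have "ennreal (1 / t powr r) * ennreal (Gamma r) = ennreal (1 / t powr r) * (ennreal (t powr r) * (\<integral>\<^sup>+z. ennreal (indicator {0..} z * (z powr (r - 1) * exp (- z * t))) \<partial>lborel))"
      by simp
    then show ?thesis using t
      by (simp add: mult.assoc[symmetric] ennreal_mult'[symmetric])
  qed
  have "(\<integral>\<^sup>+z. ennreal (indicator {0..} z * (z powr (s - 1) * exp (- z * t) * kummer_M a b z)) \<partial>lborel)
    = (\<integral>\<^sup>+z. (\<Sum>n. ennreal (?c n) * ennreal (indicator {0..} z * (z powr (real n + s - 1) * exp (- z * t)))) \<partial>lborel)"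
  proof (rule nn_integral_cong_AE)
    have "AE z in lborel. z \<noteq> (0::real)" by (rule AE_lborel_singleton)
    then show "AE z in lborel. ennreal (indicator {0..} z * (z powr (s - 1) * exp (- z * t) * kummer_M a b z))
        = (\<Sum>n. ennreal (?c n) * ennreal (indicator {0..} z * (z powr (real n + s - 1) * exp (- z * t))))"
    proof eventually_elim
      case (elim z)
      show ?case
      proof (cases "z > 0")
        case True
        have e: "?c n * (z powr (real n + s - 1) * exp (- z * t)) = z powr (s - 1) * exp (- z * t) * (?c n * z ^ n)" for n
          using True by (simp add: powr_add powr_diff powr_realpow)
        have "(\<lambda>n. ?c n * (z powr (real n + s - 1) * exp (- z * t))) sums (z powr (s - 1) * exp (- z * t) * kummer_M a b z)"
          unfolding e by (intro sums_mult kummer_M_sums)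
        then have "(\<Sum>n. ennreal (?c n * (z powr (real n + s - 1) * exp (- z * t)))) = ennreal (z powr (s - 1) * exp (- z * t) * kummer_M a b z)"
          using c by (intro suminf_ennreal_eq) auto
        then show ?thesis using True c by (simp add: ennreal_mult')
      next
        case False
        with elim show ?thesis by simp
      qed
    qed
  qed
  also have "\<dots> = (\<Sum>n. \<integral>\<^sup>+z. ennreal (?c n) * ennreal (indicator {0..} z * (z powr (real n + s - 1) * exp (- z * t))) \<partial>lborel)"
    by (intro nn_integral_suminf) auto
  also have "\<dots> = (\<Sum>n. ennreal (?c n) * ennreal (Gamma (real n + s) / t powr (real n + s)))"
    using s by (subst nn_integral_cmult) (auto simp: G[simplified])
  also have "\<dots> = (\<Sum>n. ennreal (?c n * Gamma (real n + s) / t powr (real n + s)))"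
    using c by (simp add: ennreal_mult'[symmetric])
  finally show ?thesis .
qed

end

section \<open>The recessive solution\<close>

text \<open>An Abelian argument: beyond a finite index \<open>e n - l * d n\<close> is at most
  \<epsilon> / 2 times \<open>d n\<close>, so the numerator differs from l times the denominator by
  a constant plus \<epsilon> / 2 times the denominator, and the denominator tends to
  infinity.\<close>

lemma power_series_ratio_at_left_1:
  fixes d e :: "nat \<Rightarrow> real"
  assumes d: "\<And>n. 0 < d n" and lim: "(\<lambda>n. e n / d n) \<longlonglongrightarrow> l"
    and sm: "\<And>x. 0 < x \<Longrightarrow> x < 1 \<Longrightarrow> summable (\<lambda>n. d n * x ^ n)"
    and top: "filterlim (\<lambda>x. \<Sum>n. d n * x ^ n) at_top (at_left 1)"
  shows "((\<lambda>x. (\<Sum>n. e n * x ^ n) / (\<Sum>n. d n * x ^ n)) \<longlongrightarrow> l) (at_left 1)"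
proof (rule tendstoI)
  fix \<epsilon> :: real assume \<epsilon>: "0 < \<epsilon>"
  obtain n0 where n0: "\<And>n. n \<ge> n0 \<Longrightarrow> \<bar>e n / d n - l\<bar> < \<epsilon> / 2"
    using LIMSEQ_D[OF lim, of "\<epsilon> / 2"] \<epsilon> by auto
  \<comment> \<open>Total error of the indices below \<open>n0\<close>; for x between 0 and 1 it
    bounds their contribution independently of x.\<close>
  define K where "K = (\<Sum>n<n0. \<bar>e n - l * d n\<bar>)"
  have K0: "0 \<le> K" by (simp add: K_def sum_nonneg)
  have bd: "\<bar>e n - l * d n\<bar> \<le> (if n < n0 then \<bar>e n - l * d n\<bar> else 0) + \<epsilon> / 2 * d n" for n
  proof (cases "n < n0")
    case False
    have "\<bar>e n - l * d n\<bar> = \<bar>e n / d n - l\<bar> * d n"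
      proof -
      have "(e n / d n - l) * d n = e n - l * d n" using d[of n] by (simp add: field_simps)
      then show ?thesis using d[of n] abs_mult[of "e n / d n - l" "d n"] by (simp only: abs_of_pos)
    qed
    also have "\<dots> \<le> \<epsilon> / 2 * d n" using n0[of n] False d[of n] by (intro mult_right_mono) auto
    finally show ?thesis using False by simp
  next
    case True
    have "0 \<le> \<epsilon> / 2 * d n" using d[of n] \<epsilon> by simp
    then show ?thesis using True by simp
  qed
  have "eventually (\<lambda>x. 2 * K / \<epsilon> < (\<Sum>n. d n * x ^ n)) (at_left 1)"
    using top by (simp add: filterlim_at_top_dense)
  moreover have "eventually (\<lambda>x::real. 0 < x \<and> x < 1) (at_left 1)"
    using eventually_at_left_real[of 0 "1::real"] by (auto elim: eventually_mono)
  ultimately show "eventually (\<lambda>x. dist ((\<Sum>n. e n * x ^ n) / (\<Sum>n. d n * x ^ n)) l < \<epsilon>) (at_left 1)"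
  proof eventually_elim
    case (elim x)
    let ?Y = "\<Sum>n. d n * x ^ n"
    have smd: "summable (\<lambda>n. d n * x ^ n)" using sm elim by auto
    have "0 \<le> 2 * K / \<epsilon>" using K0 \<epsilon> by simp
    then have Y0: "0 < ?Y" using elim(1) by linarith
    have b2: "\<bar>(e n - l * d n) * x ^ n\<bar> \<le> (if n < n0 then \<bar>e n - l * d n\<bar> else 0) + \<epsilon> / 2 * (d n * x ^ n)" for n
    proof -
      have x: "0 \<le> x ^ n" "x ^ n \<le> 1" using elim by (auto simp: power_le_one)
      have "\<bar>(e n - l * d n) * x ^ n\<bar> = \<bar>e n - l * d n\<bar> * x ^ n" using x by (simp add: abs_mult)
      also have "\<dots> \<le> ((if n < n0 then \<bar>e n - l * d n\<bar> else 0) + \<epsilon> / 2 * d n) * x ^ n"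
        by (intro mult_right_mono bd x)
      also have "\<dots> \<le> (if n < n0 then \<bar>e n - l * d n\<bar> else 0) * 1 + \<epsilon> / 2 * (d n * x ^ n)"
        unfolding distrib_right using x by (intro add_mono mult_left_mono) (auto simp: mult.assoc)
      finally show ?thesis by simp
    qed
    have fs: "(\<lambda>n. if n < n0 then \<bar>e n - l * d n\<bar> else 0) sums K"
      using sums_If_finite[of "\<lambda>n. n < n0" "\<lambda>n. \<bar>e n - l * d n\<bar>"] by (simp add: K_def lessThan_def)
    have bs: "(\<lambda>n. (if n < n0 then \<bar>e n - l * d n\<bar> else 0) + \<epsilon> / 2 * (d n * x ^ n)) sums (K + \<epsilon> / 2 * ?Y)"
      by (intro sums_add fs sums_mult summable_sums smd)
    have sma: "summable (\<lambda>n. \<bar>(e n - l * d n) * x ^ n\<bar>)"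
      by (rule summable_comparison_test'[OF sums_summable[OF bs], of 0]) (use b2 in auto)
    have "summable (\<lambda>n. (e n - l * d n) * x ^ n + l * (d n * x ^ n))"
      by (rule summable_add[OF summable_rabs_cancel[OF sma] summable_mult[OF smd]])
    moreover have "(\<lambda>n. (e n - l * d n) * x ^ n + l * (d n * x ^ n)) = (\<lambda>n. e n * x ^ n)"
      by (rule ext) (simp add: left_diff_distrib)
    ultimately have sme: "summable (\<lambda>n. e n * x ^ n)" by simp
    have "(\<Sum>n. e n * x ^ n) - l * ?Y = (\<Sum>n. e n * x ^ n - l * (d n * x ^ n))"
      by (simp only: suminf_diff[OF sme summable_mult[OF smd, of l], symmetric] suminf_mult[OF smd, of l])
    also have "\<dots> = (\<Sum>n. (e n - l * d n) * x ^ n)"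
      by (simp only: left_diff_distrib mult.assoc)
    also have "\<bar>\<dots>\<bar> \<le> (\<Sum>n. \<bar>(e n - l * d n) * x ^ n\<bar>)"
      by (rule summable_rabs[OF sma])
    also have "\<dots> \<le> K + \<epsilon> / 2 * ?Y"
      using suminf_le[OF b2 sma sums_summable[OF bs]] sums_unique[OF bs] by simp
    also have "\<dots> < \<epsilon> / 2 * ?Y + \<epsilon> / 2 * ?Y"
      using elim(1) \<epsilon> by (simp add: pos_divide_less_eq mult.commute)
    finally have "\<bar>(\<Sum>n. e n * x ^ n) - l * ?Y\<bar> < \<epsilon> * ?Y" by simp
    moreover have "(\<Sum>n. e n * x ^ n) / ?Y - l = ((\<Sum>n. e n * x ^ n) - l * ?Y) / ?Y"
      using Y0 by (simp add: diff_divide_distrib)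
    ultimately show ?case using Y0
      by (simp add: dist_real_def pos_divide_less_eq)
  qed
qed

text \<open>Each \<open>Gamma_series'\<close> carries a power of n. The exponents satisfy (1 + a -
  b) + 1 = a + (2 - b), so the powers cancel in the quotient and only Pochhammer symbols
  remain.\<close>

lemma pochhammer_fact_ratio_LIMSEQ:
  fixes a b :: real
  assumes a: "0 < a" and b: "0 < b" "b < 1"
  shows "(\<lambda>n. Gamma b * pochhammer a n / fact n / (pochhammer (1 + a - b) n / pochhammer (2 - b) n))
    \<longlonglongrightarrow> Gamma b * Gamma (1 + a - b) / (Gamma a * Gamma (2 - b))"
proof -
  have G: "(\<lambda>n. Gamma b * (Gamma_series' (1 + a - b) n * Gamma_series' 1 n / (Gamma_series' a n * Gamma_series' (2 - b) n)))
    \<longlonglongrightarrow> Gamma b * (Gamma (1 + a - b) * Gamma 1 / (Gamma a * Gamma (2 - b)))"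
    using a b by (intro tendsto_intros Gamma_series'_LIMSEQ) (auto simp: Gamma_eq_zero_iff dest: nonpos_Ints_nonpos)
  have "eventually (\<lambda>n. Gamma b * (Gamma_series' (1 + a - b) n * Gamma_series' 1 n / (Gamma_series' a n * Gamma_series' (2 - b) n))
     = Gamma b * pochhammer a n / fact n / (pochhammer (1 + a - b) n / pochhammer (2 - b) n)) sequentially"
    using eventually_gt_at_top[of 0]
  proof eventually_elim
    case (elim n)
    have p: "pochhammer a n > 0" "pochhammer (1 + a - b) n > 0" "pochhammer (2 - b) n > 0"
      using a b by (auto intro!: pochhammer_pos)
    have E: "exp ((1 + a - b) * ln (real n)) * exp (1 * ln (real n)) = exp (a * ln (real n)) * exp ((2 - b) * ln (real n))"
      by (simp add: exp_add[symmetric] algebra_simps)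
    define F where "F = (fact (n - 1) :: real)"
    define x1 where "x1 = exp ((1 + a - b) * ln (real n))"
    define x2 where "x2 = exp (1 * ln (real n))"
    define x3 where "x3 = exp (a * ln (real n))"
    define x4 where "x4 = exp ((2 - b) * ln (real n))"
    have x: "x1 > 0" "x2 > 0" "x3 > 0" "x4 > 0" "F > 0" by (auto simp: x1_def x2_def x3_def x4_def F_def)
    have E': "x1 * x2 = x3 * x4" using E by (simp add: x1_def x2_def x3_def x4_def)
    have "Gamma_series' (1 + a - b) n * Gamma_series' 1 n / (Gamma_series' a n * Gamma_series' (2 - b) n)
       = (F * x1 / pochhammer (1 + a - b) n) * (F * x2 / fact n) / ((F * x3 / pochhammer a n) * (F * x4 / pochhammer (2 - b) n))"
      unfolding Gamma_series'_def by (simp add: F_def x1_def x2_def x3_def x4_def pochhammer_fact)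
    also have "\<dots> = (x1 * x2) / (x3 * x4) * (pochhammer a n / fact n / (pochhammer (1 + a - b) n / pochhammer (2 - b) n))"
      using x p by (simp add: field_simps)
    also have "\<dots> = pochhammer a n / fact n / (pochhammer (1 + a - b) n / pochhammer (2 - b) n)"
      using x unfolding E' by simp
    finally show ?case by simp
  qed
  from Lim_transform_eventually[OF G this] show ?thesis by simp
qed

section \<open>Two solutions of Kummer's equation and their Wronskian\<close>

locale kummer =
  fixes a b :: real
  assumes a1: "1 \<le> a" and b0: "0 < b" and b1: "b < 1"
begin

lemma pars: "0 < a" "0 < 1 + a - b" "0 < 2 - b" using a1 b0 b1 by auto

definition M where "M = kummer_M a b"
definition M2 where "M2 = kummer_M (1 + a - b) (2 - b)"
definition N where "N z = z powr (1 - b) * M2 z"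
text \<open>\<open>PM\<close> and \<open>PN\<close> are the fluxes z^b e^(-z) f' in the self-adjoint
  form (z^b e^(-z) f')' = a z^(b-1) e^(-z) f. \<open>PN\<close> is written out so that it is also
  continuous at 0, where the derivative of \<open>N\<close> blows up.\<close>

definition PM where "PM z = z powr b * exp (- z) * kummer_dM a b z"
definition PN where "PN z = exp (- z) * ((1 - b) * M2 z + z * kummer_dM (1 + a - b) (2 - b) z)"

lemma M_cont: "continuous_on {0..} M"
  unfolding M_def by (rule kummer_M_cont[OF pars(1) b0 continuous_on_id])

lemma N_cont: "continuous_on {0..} N"
  unfolding N_def M2_def using b1 by (intro continuous_intros continuous_on_powr' kummer_M_cont pars) auto

lemma PM_cont: "continuous_on {0..} PM"
  unfolding PM_def using b0 by (intro continuous_intros continuous_on_powr' kummer_dM_cont pars b0) auto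

lemma PN_cont: "continuous_on {0..} PN"
  unfolding PN_def M2_def by (intro continuous_intros kummer_M_cont kummer_dM_cont pars)

lemma M_deriv: "0 < z \<Longrightarrow> (M has_real_derivative PM z * (z powr (- b) * exp z)) (at z within S)"
proof -
  assume z: "0 < z"
  have "(M has_real_derivative kummer_dM a b z * 1) (at z within S)"
    unfolding M_def by (intro kummer_M_deriv pars b0 DERIV_ident)
  moreover have "PM z * (z powr (- b) * exp z) = kummer_dM a b z"
    using z by (simp add: PM_def powr_minus exp_minus field_simps)
  ultimately show ?thesis by simp
qed

lemma N_deriv: "0 < z \<Longrightarrow> (N has_real_derivative PN z * (z powr (- b) * exp z)) (at z within S)"
proof -
  assume z: "0 < z"
  have "(N has_real_derivative (1 - b) * z powr (1 - b - 1) * M2 z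
      + z powr (1 - b) * (kummer_dM (1 + a - b) (2 - b) z * 1)) (at z within S)"
    unfolding N_def M2_def using z
    by (auto intro!: derivative_eq_intros kummer_M_deriv[THEN DERIV_cong] pars)
  moreover have "PN z * (z powr (- b) * exp z) = (1 - b) * z powr (1 - b - 1) * M2 z
      + z powr (1 - b) * (kummer_dM (1 + a - b) (2 - b) z * 1)"
    using z by (simp add: PN_def exp_minus field_simps powr_diff powr_minus)
  ultimately show ?thesis by simp
qed

lemma PM_deriv: "0 < z \<Longrightarrow> (PM has_real_derivative a * z powr (b - 1) * exp (- z) * M z) (at z within S)"
proof -
  assume z: "0 < z"
  let ?d = "kummer_dM a b z" and ?dd = "kummer_ddM a b z"
  have "(PM has_real_derivative (b * z powr (b - 1) * exp (- z) - z powr b * exp (- z)) * ?d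
      + z powr b * exp (- z) * (?dd * 1)) (at z within S)"
    unfolding PM_def using z
    by (auto intro!: derivative_eq_intros kummer_dM_deriv[THEN DERIV_cong] pars b0 simp: algebra_simps)
  moreover have "(b * z powr (b - 1) * exp (- z) - z powr b * exp (- z)) * ?d + z powr b * exp (- z) * (?dd * 1)
     = z powr (b - 1) * exp (- z) * (z * ?dd + (b - z) * ?d)"
  proof -
    have "z powr b = z powr (b - 1) * z" using z by (simp add: powr_diff)
    then show ?thesis by (simp add: algebra_simps)
  qed
  ultimately show ?thesis unfolding kummer_ode[OF pars(1) b0] by (simp add: M_def algebra_simps)
qed

lemma PN_deriv: "0 < z \<Longrightarrow> (PN has_real_derivative a * z powr (b - 1) * exp (- z) * N z) (at z within S)"
proof -
  assume z: "0 < z"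
  let ?M = "kummer_M (1 + a - b) (2 - b) z" and ?d = "kummer_dM (1 + a - b) (2 - b) z"
    and ?dd = "kummer_ddM (1 + a - b) (2 - b) z"
  have "(PN has_real_derivative - exp (- z) * ((1 - b) * ?M + z * ?d)
      + exp (- z) * ((1 - b) * (?d * 1) + (?d + z * (?dd * 1)))) (at z within S)"
    unfolding PN_def M2_def using z
    by (auto intro!: derivative_eq_intros kummer_M_deriv[THEN DERIV_cong] kummer_dM_deriv[THEN DERIV_cong] pars
        simp: algebra_simps)
  moreover have "- exp (- z) * ((1 - b) * ?M + z * ?d) + exp (- z) * ((1 - b) * (?d * 1) + (?d + z * (?dd * 1)))
     = exp (- z) * ((z * ?dd + (2 - b - z) * ?d) - (1 - b) * ?M)"
    by (simp add: algebra_simps)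
  moreover have "a * z powr (b - 1) * exp (- z) * N z = exp (- z) * (a * ?M)"
    using z by (simp add: N_def M2_def powr_add[symmetric])
  ultimately show ?thesis unfolding kummer_ode[OF pars(2) pars(3)]
    by (metis (no_types, lifting) add_diff_cancel_left' add_diff_eq diff_diff_eq2 left_diff_distrib mult_1)
qed

lemma M_ge_1: "0 \<le> z \<Longrightarrow> 1 \<le> M z" and M2_ge_1: "0 \<le> z \<Longrightarrow> 1 \<le> M2 z"
  unfolding M_def M2_def by (auto intro: kummer_M_ge_1 pars b0)

lemma N_pos: "0 < z \<Longrightarrow> 0 < N z"
  using M2_ge_1[of z] by (simp add: N_def)

lemma PN_pos: "0 \<le> z \<Longrightarrow> 0 < PN z"
proof -
  assume z: "0 \<le> z"
  have "0 < (1 - b) * M2 z" using M2_ge_1[OF z] b1 by simp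
  moreover have "0 \<le> z * kummer_dM (1 + a - b) (2 - b) z"
    using kummer_dM_pos[OF pars(2,3) z] z by simp
  ultimately show ?thesis by (simp add: PN_def)
qed

lemma PM_nonneg: "0 \<le> z \<Longrightarrow> 0 \<le> PM z"
  using kummer_dM_pos[OF pars(1) b0, of z] by (simp add: PM_def)

lemma M_mono: assumes "0 \<le> x" "x \<le> y" shows "M x \<le> M y"
proof (rule DERIV_nonneg_imp_increasing_open[OF assms(2)])
  show "\<exists>D. (M has_real_derivative D) (at z) \<and> 0 \<le> D" if "x < z" "z < y" for z
    using M_deriv[of z UNIV] PM_nonneg[of z] that assms by (intro exI[of _ "PM z * (z powr (- b) * exp z)"]) auto
  show "continuous_on {x..y} M" by (rule continuous_on_subset[OF M_cont]) (use assms in auto)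
qed

text \<open>The self-adjoint form makes the derivative vanish, and the value is read off at 0. Since
  \<open>N\<close> is not differentiable there, constancy comes from the interior derivative
  together with continuity up to 0.\<close>

lemma wronskian_MN:
  assumes "0 \<le> z" shows "M z * PN z - PM z * N z = 1 - b"
proof (cases "z = 0")
  case True
  then show ?thesis using b0 b1 by (simp add: PN_def PM_def N_def M_def M2_def kummer_M_0[OF pars(1) b0] kummer_M_0[OF pars(2,3)])
next
  case False
  let ?W = "\<lambda>z. M z * PN z - PM z * N z"
  have "?W z = ?W 0"
  proof (rule DERIV_isconst2[of 0 z])
    show "continuous_on {0..z} ?W"
      by (intro continuous_intros continuous_on_subset[OF M_cont] continuous_on_subset[OF N_cont]
          continuous_on_subset[OF PM_cont] continuous_on_subset[OF PN_cont]) auto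
    show "(?W has_real_derivative 0) (at x)" if "0 < x" "x < z" for x
      by (rule derivative_eq_intros M_deriv N_deriv PM_deriv PN_deriv that refl)+ (simp add: algebra_simps)
  qed (use False assms in auto)
  then show ?thesis using b0 b1 by (simp add: PN_def PM_def N_def M_def M2_def kummer_M_0[OF pars(1) b0] kummer_M_0[OF pars(2,3)])
qed

lemma ratio_deriv:
  assumes z: "0 < z"
  shows "((\<lambda>z. M z / N z) has_real_derivative - ((1 - b) * (z powr (- b) * exp z) / (N z)\<^sup>2)) (at z)"
proof -
  have "((\<lambda>z. M z / N z) has_real_derivative
     (PM z * (z powr (- b) * exp z) * N z - M z * (PN z * (z powr (- b) * exp z))) / (N z * N z)) (at z)"
    by (rule DERIV_divide[OF M_deriv[OF z] N_deriv[OF z]]) (use N_pos[OF z] in auto)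
  moreover have "PM z * (z powr (- b) * exp z) * N z - M z * (PN z * (z powr (- b) * exp z))
     = - ((M z * PN z - PM z * N z) * (z powr (- b) * exp z))" by (simp add: algebra_simps)
  ultimately show ?thesis using wronskian_MN[of z] z by (simp add: power2_eq_square)
qed

lemma ratio_decreasing:
  assumes "0 < x" "x < y" shows "M y / N y < M x / N x"
proof (rule DERIV_neg_imp_decreasing[OF assms(2)])
  fix z assume "x \<le> z" "z \<le> y"
  then have z: "0 < z" using assms by simp
  show "\<exists>D. ((\<lambda>z. M z / N z) has_real_derivative D) (at z) \<and> D < 0"
    using ratio_deriv[OF z] b1 z N_pos[OF z]
    by (intro exI[of _ "- ((1 - b) * (z powr (- b) * exp z) / (N z)\<^sup>2)"]) auto
qed

section \<open>The limit of \<open>M\<close> / \<open>N\<close> at infinity\<close>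

definition lr where "lr = Gamma b * Gamma (1 + a - b) / (Gamma a * Gamma (2 - b))"

lemma lr_pos: "0 < lr"
  using pars b0 by (simp add: lr_def Gamma_real_pos)

text \<open>Laplace transforms of z^(b-1) M and z^(b-1) N. In the second the powers of z cancel and
  leave \<open>M2\<close>; the exponent 1 - 1 keeps the shape of
  \<open>kummer_M_nn_Laplace\<close>.\<close>

definition LM where "LM t = (\<integral>\<^sup>+z. ennreal (indicator {0..} z * (z powr (b - 1) * exp (- z * t) * M z)) \<partial>lborel)"
definition LN where "LN t = (\<integral>\<^sup>+z. ennreal (indicator {0..} z * (z powr (1 - 1) * exp (- z * t) * M2 z)) \<partial>lborel)"

text \<open>With x = 1 / t, the transforms are elementary factors times the power series in x with
  coefficients \<open>eM\<close> and \<open>dN\<close>; t decreasing to 1 becomes x increasing to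
  1.\<close>

definition eM where "eM n = Gamma b * pochhammer a n / fact n"
definition dN where "dN n = pochhammer (1 + a - b) n / pochhammer (2 - b) n"

text \<open>Factorwise 2 - b is at most 1 + a - b because a is at least 1. The series of
  \<open>dN\<close> thus dominates the geometric series and diverges at 1, as the Abelian argument
  requires.\<close>

lemma dN_ge_1: "1 \<le> dN n"
proof -
  have "pochhammer (2 - b) n \<le> pochhammer (1 + a - b) n"
    unfolding pochhammer_prod using a1 b1 by (intro prod_mono) auto
  then show ?thesis using pochhammer_pos[OF pars(3), of n] by (simp add: dN_def)
qed

lemma eM_pos: "0 < eM n"
  using pochhammer_pos[OF pars(1), of n] b0 by (simp add: eM_def Gamma_real_pos)

lemma conv_dN: "conv_radius dN = 1"
proof (rule conv_radius_ratio_limit_nonzero)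
  have e: "norm (dN n) / norm (dN (Suc n)) = (real n + 2 - b) / (real n + 1 + a - b)" for n
  proof -
    have p: "0 < pochhammer (1 + a - b) n" "0 < pochhammer (2 - b) n" "0 < 1 + a - b + real n" "0 < 2 - b + real n"
      using pochhammer_pos[OF pars(2), of n] pochhammer_pos[OF pars(3), of n] pars by auto
    define P Q x y where d: "P = pochhammer (1 + a - b) n" "Q = pochhammer (2 - b) n" "x = 1 + a - b + real n" "y = 2 - b + real n"
    have "norm (dN n) / norm (dN (Suc n)) = (P / Q) / (P * x / (Q * y))"
      using p by (simp add: dN_def pochhammer_Suc d abs_mult)
    also have "\<dots> = y / x" using p unfolding d[symmetric] by simp
    finally show ?thesis by (simp add: d algebra_simps)
  qed
  show "(\<lambda>n. norm (dN n) / norm (dN (Suc n))) \<longlonglongrightarrow> 1"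
    unfolding e by real_asymp
qed (auto simp: one_ereal_def)

lemma conv_eM: "conv_radius eM = 1"
proof (rule conv_radius_ratio_limit_nonzero)
  have e: "norm (eM n) / norm (eM (Suc n)) = (real n + 1) / (real n + a)" for n
  proof -
    have "0 < Gamma b" "0 < pochhammer a n" "0 < a + real n"
      using pochhammer_pos[OF pars(1), of n] Gamma_real_pos[OF b0] pars by auto
    then show ?thesis by (simp add: eM_def pochhammer_Suc abs_mult divide_simps add.commute)
  qed
  show "(\<lambda>n. norm (eM n) / norm (eM (Suc n))) \<longlonglongrightarrow> 1"
    unfolding e by real_asymp
qed (auto simp: one_ereal_def)

lemma LM_eq: "1 < t \<Longrightarrow> LM t = ennreal (t powr (- b) * (\<Sum>n. eM n * (1 / t) ^ n))"
proof -
  assume t: "1 < t"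
  have sm: "summable (\<lambda>n. eM n * (1 / t) ^ n)"
    by (rule summable_in_conv_radius) (use t in \<open>auto simp: conv_eM\<close>)
  have e: "kummer_coeff a b n * Gamma (real n + b) / t powr (real n + b) = t powr (- b) * (eM n * (1 / t) ^ n)" for n
  proof -
    have "pochhammer b n = Gamma (b + real n) / Gamma b"
      using b0 by (intro pochhammer_Gamma) (auto dest: nonpos_Ints_nonpos)
    moreover have "Gamma (b + real n) > 0" "Gamma b > 0" using b0 by (auto intro!: Gamma_real_pos)
    moreover have "pochhammer b n > 0" by (rule pochhammer_pos[OF b0])
    ultimately have "Gamma (b + real n) / pochhammer b n = Gamma b" by (simp add: field_simps)
    then have "pochhammer a n * Gamma (b + real n) / pochhammer b n = Gamma b * pochhammer a n"
      by (metis mult.commute times_divide_eq_right)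
    with t show ?thesis
      by (simp add: kummer_coeff_def eM_def powr_add powr_minus powr_realpow field_simps add.commute)
  qed
  have "LM t = (\<Sum>n. ennreal (t powr (- b) * (eM n * (1 / t) ^ n)))"
    unfolding LM_def M_def using t kummer_M_nn_Laplace[OF pars(1) b0 b0, of t] by (simp add: e)
  also have "\<dots> = ennreal (t powr (- b) * (\<Sum>n. eM n * (1 / t) ^ n))"
    using t eM_pos by (intro suminf_ennreal_eq sums_mult summable_sums sm) (auto simp: less_imp_le)
  finally show ?thesis .
qed

lemma LN_eq: "1 < t \<Longrightarrow> LN t = ennreal (1 / t * (\<Sum>n. dN n * (1 / t) ^ n))"
proof -
  assume t: "1 < t"
  have sm: "summable (\<lambda>n. dN n * (1 / t) ^ n)"
    by (rule summable_in_conv_radius) (use t in \<open>auto simp: conv_dN\<close>)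
  have e: "kummer_coeff (1 + a - b) (2 - b) n * Gamma (real n + 1) / t powr (real n + 1) = 1 / t * (dN n * (1 / t) ^ n)" for n
    using t Gamma_fact[of n, where 'a = real]
    by (simp add: kummer_coeff_def dN_def powr_add powr_realpow field_simps add.commute)
  have "LN t = (\<Sum>n. ennreal (1 / t * (dN n * (1 / t) ^ n)))"
    unfolding LN_def M2_def using t kummer_M_nn_Laplace[OF pars(2) pars(3), of 1 t] by (simp add: e del: times_divide_eq_left)
  also have "\<dots> = ennreal (1 / t * (\<Sum>n. dN n * (1 / t) ^ n))"
    using t dN_ge_1 by (intro suminf_ennreal_eq sums_mult summable_sums sm)
      (auto intro!: divide_nonneg_pos mult_nonneg_nonneg intro: order_trans[OF zero_le_one dN_ge_1])
  finally show ?thesis .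
qed

lemma dN_sum_top: "filterlim (\<lambda>x. \<Sum>n. dN n * x ^ n) at_top (at_left 1)"
proof (rule filterlim_at_top_mono)
  show "filterlim (\<lambda>x::real. 1 / (1 - x)) at_top (at_left 1)" by real_asymp
  have "eventually (\<lambda>x::real. 0 < x \<and> x < 1) (at_left 1)"
    using eventually_at_left_real[of 0 "1::real"] by (auto elim: eventually_mono)
  then show "eventually (\<lambda>x. 1 / (1 - x) \<le> (\<Sum>n. dN n * x ^ n)) (at_left 1)"
  proof eventually_elim
    case (elim x)
    have "(\<Sum>n. x ^ n) \<le> (\<Sum>n. dN n * x ^ n)"
    proof (rule suminf_le)
      show "x ^ n \<le> dN n * x ^ n" for n using dN_ge_1[of n] elim mult_right_mono[of 1 "dN n" "x ^ n"] by auto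
      show "summable (\<lambda>n. dN n * x ^ n)"
        by (rule summable_in_conv_radius) (use elim in \<open>auto simp: conv_dN\<close>)
    qed (use elim in auto)
    then show ?case using elim by (simp add: suminf_geometric)
  qed
qed

lemma sum_ratio_lim: "((\<lambda>x. (\<Sum>n. eM n * x ^ n) / (\<Sum>n. dN n * x ^ n)) \<longlongrightarrow> lr) (at_left 1)"
proof (rule power_series_ratio_at_left_1)
  show "0 < dN n" for n using dN_ge_1[of n] by simp
  show "(\<lambda>n. eM n / dN n) \<longlonglongrightarrow> lr"
    unfolding eM_def dN_def lr_def by (rule pochhammer_fact_ratio_LIMSEQ) (use pars b0 b1 in auto)
  show "summable (\<lambda>n. dN n * x ^ n)" if "0 < x" "x < 1" for x
    by (rule summable_in_conv_radius) (use that in \<open>auto simp: conv_dN\<close>)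
qed (rule dN_sum_top)

lemma dN_sum_pos: "0 < x \<Longrightarrow> x < 1 \<Longrightarrow> 0 < (\<Sum>n. dN n * x ^ n)"
  by (rule suminf_pos[OF summable_in_conv_radius])
    (auto simp: conv_dN intro!: mult_pos_pos less_le_trans[OF zero_less_one dN_ge_1])

lemma eM_sum_pos: "0 < x \<Longrightarrow> x < 1 \<Longrightarrow> 0 < (\<Sum>n. eM n * x ^ n)"
  by (rule suminf_pos[OF summable_in_conv_radius]) (use eM_pos in \<open>auto simp: conv_eM\<close>)

lemma M2_measurable [measurable]: "M2 \<in> borel_measurable borel"
  unfolding M2_def by (intro borel_measurable_continuous_onI kummer_M_cont pars continuous_on_id)

text \<open>If M were at least c N everywhere, the transforms would satisfy c LN \<le> LM, and t
  decreasing to 1 would force c \<le> lr.\<close>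

lemma ratio_not_above: 
  assumes "lr < c" shows "\<exists>z>0. M z / N z < c"
proof (rule ccontr)
  assume "\<not> (\<exists>z>0. M z / N z < c)"
  then have h: "c * N z \<le> M z" if "0 < z" for z
  proof -
    have "c \<le> M z / N z" using that \<open>\<not> (\<exists>z>0. M z / N z < c)\<close> by (meson not_less)
    then show ?thesis using N_pos[OF that] by (simp add: pos_le_divide_eq)
  qed
  have c0: "0 < c" using assms lr_pos by simp
  have "eventually (\<lambda>x::real. 0 < x \<and> x < 1) (at_left 1)"
    using eventually_at_left_real[of 0 "1::real"] by (auto elim: eventually_mono)
  then have "eventually (\<lambda>x. c * x powr (1 - b) \<le> (\<Sum>n. eM n * x ^ n) / (\<Sum>n. dN n * x ^ n)) (at_left 1)"
  proof eventually_elim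
    case (elim x)
    then have t: "1 < 1 / x" by simp
    have "ennreal c * LN (1 / x) = (\<integral>\<^sup>+z. ennreal c * ennreal (indicator {0..} z * (z powr (1 - 1) * exp (- z * (1 / x)) * M2 z)) \<partial>lborel)"
      unfolding LN_def using M2_measurable by (simp add: nn_integral_cmult)
    also have "\<dots> \<le> LM (1 / x)" unfolding LM_def
    proof (rule nn_integral_mono_AE)
      have "AE z in lborel. z \<noteq> (0::real)" by (rule AE_lborel_singleton)
      then show "AE z in lborel. ennreal c * ennreal (indicator {0..} z * (z powr (1 - 1) * exp (- z * (1 / x)) * M2 z))
          \<le> ennreal (indicator {0..} z * (z powr (b - 1) * exp (- z * (1 / x)) * M z))"
      proof eventually_elim
        case (elim z)
        show ?case
        proof (cases "0 < z")
          case True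
          have "c * M2 z = z powr (b - 1) * (c * N z)"
            using True by (simp add: N_def powr_add[symmetric])
          also have "\<dots> \<le> z powr (b - 1) * M z" using h[OF True] by (intro mult_left_mono) auto
          finally have "c * M2 z * exp (- z * (1 / x)) \<le> z powr (b - 1) * M z * exp (- z * (1 / x))"
            by (rule mult_right_mono) simp
          then show ?thesis using True c0 by (simp add: ennreal_mult'[symmetric] mult_ac ennreal_leI)
        qed (use elim in simp)
      qed
    qed
    finally have "c * (x * (\<Sum>n. dN n * x ^ n)) \<le> x powr b * (\<Sum>n. eM n * x ^ n)"
      using LM_eq[OF t] LN_eq[OF t] c0 elim eM_sum_pos[of x]
      by (simp add: ennreal_mult'[symmetric] powr_divide powr_minus)
    then show ?case using elim dN_sum_pos[of x]
      by (simp add: powr_diff field_simps)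
  qed
  moreover have "((\<lambda>x. c * x powr (1 - b)) \<longlongrightarrow> c * 1 powr (1 - b)) (at_left 1)"
    by (intro tendsto_intros) auto
  ultimately have "c * 1 powr (1 - b) \<le> lr"
    by (intro tendsto_le[OF _ sum_ratio_lim]) auto
  then show False using assms by simp
qed

text \<open>Otherwise M \<le> c N from Z on. The part over [0, Z] contributes a bounded amount,
  negligible against the diverging denominator, so the limit would give lr \<le> c. Arbitrarily
  large z are asked for because \<open>ratio_gt\<close> plays them against monotonicity.\<close>

lemma ratio_not_below:
  assumes "0 \<le> c" "c < lr" "0 < Z" shows "\<exists>z\<ge>Z. c < M z / N z"
proof (rule ccontr)
  assume "\<not> ?thesis"
  then have h: "M z \<le> c * N z" if "Z \<le> z" for z
    using that N_pos[of z] assms by (auto simp: not_less field_simps)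
  \<comment> \<open>On [0, Z] the function M is at most \<open>M Z\<close>, and exp (- z t) \<le>
    exp (- z) for t > 1; what remains is the Gamma integral.\<close>
  define C where "C = M Z * Gamma b"
  have C0: "0 \<le> C" using M_ge_1[of Z] assms b0 Gamma_real_pos[of b] by (simp add: C_def)
  have "eventually (\<lambda>x::real. 0 < x \<and> x < 1) (at_left 1)"
    using eventually_at_left_real[of 0 "1::real"] by (auto elim: eventually_mono)
  then have "eventually (\<lambda>x. (\<Sum>n. eM n * x ^ n) / (\<Sum>n. dN n * x ^ n)
      \<le> C * x powr (- b) * inverse (\<Sum>n. dN n * x ^ n) + c * x powr (1 - b)) (at_left 1)"
  proof eventually_elim
    case (elim x)
    then have t: "1 < 1 / x" by simp
    have "LM (1 / x) \<le> (\<integral>\<^sup>+z. ennreal (M Z) * ennreal (indicator {0..} z * z powr (b - 1) / exp z)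
        + ennreal c * ennreal (indicator {0..} z * (z powr (1 - 1) * exp (- z * (1 / x)) * M2 z)) \<partial>lborel)"
      unfolding LM_def
    proof (rule nn_integral_mono_AE)
      have "AE z in lborel. z \<noteq> (0::real)" by (rule AE_lborel_singleton)
      then show "AE z in lborel. ennreal (indicator {0..} z * (z powr (b - 1) * exp (- z * (1 / x)) * M z))
        \<le> ennreal (M Z) * ennreal (indicator {0..} z * z powr (b - 1) / exp z)
        + ennreal c * ennreal (indicator {0..} z * (z powr (1 - 1) * exp (- z * (1 / x)) * M2 z))"
      proof eventually_elim
        case (elim z)
        show ?case
        proof (cases "0 < z")
          case True
          have MZ: "0 \<le> M Z" using M_ge_1[of Z] assms by simp
          have M20: "0 \<le> M2 z" using M2_ge_1[of z] True by simp
          have "z powr (b - 1) * exp (- z * (1 / x)) * M z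
             \<le> M Z * (z powr (b - 1) / exp z) + c * (exp (- z * (1 / x)) * M2 z)"
          proof (cases "z \<le> Z")
            case z: True
            have "exp (- z * (1 / x)) \<le> 1 / exp z"
              using t True mult_left_mono[of 1 "1 / x" z] by (simp add: exp_minus[symmetric] divide_inverse)
            then have "z powr (b - 1) * exp (- z * (1 / x)) * M z \<le> z powr (b - 1) * (1 / exp z) * M Z"
              using M_mono[of z Z] z True M_ge_1[of z] by (intro mult_mono mult_left_mono) auto
            moreover have "0 \<le> c * (exp (- z * (1 / x)) * M2 z)" using assms M20 by simp
            ultimately show ?thesis by (simp add: mult_ac)
          next
            case z: False
            have "z powr (b - 1) * M z \<le> z powr (b - 1) * (c * N z)" using h[of z] z by (intro mult_left_mono) auto
            also have "\<dots> = c * M2 z" using True by (simp add: N_def powr_add[symmetric])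
            finally have "z powr (b - 1) * M z * exp (- z * (1 / x)) \<le> c * M2 z * exp (- z * (1 / x))"
              by (rule mult_right_mono) simp
            moreover have "0 \<le> M Z * (z powr (b - 1) / exp z)" using MZ by simp
            moreover have "z powr (b - 1) * M z * exp (- z * (1 / x)) = z powr (b - 1) * exp (- z * (1 / x)) * M z"
              "c * M2 z * exp (- z * (1 / x)) = c * (exp (- z * (1 / x)) * M2 z)"
              by (simp_all only: mult_ac)
            ultimately show ?thesis by linarith
          qed
          then show ?thesis using True assms MZ M20
            by (simp add: ennreal_mult'[symmetric] ennreal_plus[symmetric] ennreal_leI mult_ac del: ennreal_plus)
        qed (use elim in simp)
      qed
    qed
    also have "\<dots> = ennreal (M Z) * (\<integral>\<^sup>+z. ennreal (indicator {0..} z * z powr (b - 1) / exp z) \<partial>lborel) + ennreal c * LN (1 / x)"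
      unfolding LN_def using M2_measurable
      by (simp add: nn_integral_add nn_integral_cmult)
    also have "\<dots> = ennreal (C + c * (x * (\<Sum>n. dN n * x ^ n)))"
      using LN_eq[OF t] Gamma_conv_nn_integral_real[OF b0, symmetric] C0 dN_sum_pos[of x] elim assms M_ge_1[of Z] Gamma_real_pos[OF b0]
      by (simp add: ennreal_mult'[symmetric] ennreal_plus[symmetric] C_def del: ennreal_plus)
    finally have "x powr b * (\<Sum>n. eM n * x ^ n) \<le> C + c * (x * (\<Sum>n. dN n * x ^ n))"
      using LM_eq[OF t] C0 elim eM_sum_pos[of x] dN_sum_pos[of x] assms
      by (simp add: powr_divide powr_minus del: ennreal_plus)
    then show ?case using elim dN_sum_pos[of x]
      by (simp add: powr_diff powr_minus field_simps)
  qed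
  moreover have "((\<lambda>x. C * x powr (- b) * inverse (\<Sum>n. dN n * x ^ n) + c * x powr (1 - b))
      \<longlongrightarrow> C * 1 powr (- b) * 0 + c * 1 powr (1 - b)) (at_left 1)"
    by (intro tendsto_intros tendsto_inverse_0_at_top dN_sum_top) auto
  ultimately have "lr \<le> C * 1 powr (- b) * 0 + c * 1 powr (1 - b)"
    by (intro tendsto_le[OF _ _ sum_ratio_lim]) auto
  then show False using assms by simp
qed


text \<open>A strictly decreasing quotient that reached lr at z would stay at or below some c < lr
  from z + 1 on, against \<open>ratio_not_below\<close>.\<close>

lemma ratio_gt: assumes "0 < z" shows "lr < M z / N z"
proof (rule ccontr)
  assume "\<not> ?thesis"
  then have le: "M z / N z \<le> lr" by simp
  define c where "c = M (z + 1) / N (z + 1)"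
  have "c < lr" using ratio_decreasing[of z "z + 1"] assms le by (simp add: c_def)
  moreover have "0 \<le> c" using M_ge_1[of "z + 1"] N_pos[of "z + 1"] assms by (simp add: c_def)
  ultimately obtain y where y: "z + 1 \<le> y" "c < M y / N y"
    using ratio_not_below[of c "z + 1"] assms by auto
  show False
  proof (cases "y = z + 1")
    case False
    then show False using ratio_decreasing[of "z + 1" y] y assms by (simp add: c_def)
  qed (use y in \<open>simp add: c_def\<close>)
qed

section \<open>Sign, monotonicity and decay of the recessive solution\<close>

definition A where "A = Gamma (1 - b) / Gamma (1 + a - b)"
definition U where "U = kummer_U a b"
definition PU where "PU z = A * (PM z - lr * PN z)"

lemma A_pos: "0 < A" using pars b1 by (simp add: A_def Gamma_real_pos)

lemma Gamma_2b: "Gamma (2 - b) = (1 - b) * Gamma (1 - b)"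
proof -
  have "1 - b \<notin> \<int>\<^sub>\<le>\<^sub>0" using b1 nonpos_Ints_nonpos[of "1 - b"] by auto
  from Gamma_plus1[OF this] show ?thesis by (simp add: add.commute)
qed

text \<open>Two instances of the functional equation of Gamma turn the second coefficient of the
  connection formula into \<open>- A * lr\<close>. Positivity of U for z > 0 is then the same as M /
  N > lr.\<close>

lemma U_eq: "U z = A * (M z - lr * N z)"
proof -
  have g1: "Gamma b = (b - 1) * Gamma (b - 1)"
  proof -
    have "b - 1 \<noteq> of_int n" for n :: int
    proof
      assume e: "b - 1 = of_int n"
      then have "real_of_int n < of_int 0" "real_of_int (- 1) < of_int n" using b0 b1 by simp_all
      then show False by (simp only: of_int_less_iff)
    qed
    then have "b - 1 \<notin> \<int>\<^sub>\<le>\<^sub>0" by (auto simp: nonpos_Ints_def)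
    from Gamma_plus1[OF this] show ?thesis by simp
  qed
  have p: "Gamma (1 - b) > 0" "Gamma (1 + a - b) > 0" "Gamma a > 0"
    using pars b1 by (auto intro: Gamma_real_pos)
  have "- A * lr = Gamma (b - 1) / Gamma a"
  proof -
    have aux: "- (x / y) * (((b - 1) * w) * y / (z * ((1 - b) * x))) = w / z"
      if "x > 0" "y > 0" "z > 0" for x y z w :: real
    proof -
      have "- (x / y) * (((b - 1) * w) * y / (z * ((1 - b) * x))) = ((1 - b) / (1 - b)) * (w / z)"
        using that by (simp add: divide_simps) (simp add: algebra_simps)
      then show ?thesis using b1 by simp
    qed
    show ?thesis unfolding A_def lr_def g1 Gamma_2b by (rule aux) (use p in auto)
  qed
  then have e: "Gamma (b - 1) / Gamma a = - A * lr" by simp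
  show ?thesis
    unfolding U_def kummer_U_def A_def[symmetric] e M_def N_def M2_def
    by (simp add: right_diff_distrib)
qed

lemma U_cont: "continuous_on {0..} U"
  unfolding U_eq[abs_def] by (intro continuous_intros M_cont N_cont)

lemma PU_cont: "continuous_on {0..} PU"
  unfolding PU_def by (intro continuous_intros PM_cont PN_cont)

lemma U_deriv: "0 < z \<Longrightarrow> (U has_real_derivative PU z * (z powr (- b) * exp z)) (at z within S)"
  unfolding U_eq[abs_def] PU_def
  by (rule derivative_eq_intros M_deriv N_deriv refl | assumption)+ (simp add: algebra_simps)

lemma PU_deriv: "0 < z \<Longrightarrow> (PU has_real_derivative a * z powr (b - 1) * exp (- z) * U z) (at z within S)"
  unfolding U_eq PU_def
  by (rule derivative_eq_intros PM_deriv PN_deriv refl | assumption)+ (simp add: algebra_simps)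

lemma M_0: "M 0 = 1" and M2_0: "M2 0 = 1" and N_0: "N 0 = 0" and PM_0: "PM 0 = 0"
  using b0 b1 by (simp_all add: M_def M2_def N_def PM_def kummer_M_0[OF pars(1) b0] kummer_M_0[OF pars(2,3)])

lemma PU_0: "PU 0 = - Gamma b / Gamma a"
proof -
  have p: "Gamma (1 - b) > 0" "Gamma (1 + a - b) > 0" "Gamma a > 0"
    using pars b1 by (auto intro: Gamma_real_pos)
  have aux: "x / y * (0 - w * y / (z * ((1 - b) * x)) * (1 - b)) = - w / z"
    if "x > 0" "y > 0" "z > 0" for x y z w :: real
    using that b1 by simp
  have "PU 0 = A * (0 - lr * (1 - b))" by (simp add: PU_def PM_0 PN_def M2_0)
  then show ?thesis
    unfolding A_def lr_def Gamma_2b by (simp only: aux[OF p])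
qed

lemma wronskian_MU: assumes "0 \<le> z" shows "PM z * U z - M z * PU z = Gamma b / Gamma a"
proof -
  have "PM z * U z - M z * PU z = A * lr * (M z * PN z - PM z * N z)"
    by (simp add: U_eq PU_def algebra_simps)
  moreover have "PM 0 * U 0 - M 0 * PU 0 = A * lr * (M 0 * PN 0 - PM 0 * N 0)"
    by (simp add: U_eq PU_def algebra_simps)
  ultimately show ?thesis using wronskian_MN[of z] wronskian_MN[of 0] assms
    by (simp add: M_0 PM_0 PU_0)
qed

lemma U_0: "U 0 = A"
  by (simp add: U_eq M_0 N_0)

lemma U_pos: assumes "0 \<le> z" shows "0 < U z"
proof (cases "z = 0")
  case False
  then have "0 < z" using assms by simp
  then have "lr * N z < M z" using ratio_gt[of z] N_pos[of z] by (simp add: pos_less_divide_eq)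
  then show ?thesis using A_pos by (simp add: U_eq)
qed (simp add: U_0 A_pos)

lemma PU_mono: assumes "0 \<le> x" "x \<le> y" shows "PU x \<le> PU y"
proof (rule DERIV_nonneg_imp_increasing_open[OF assms(2)])
  show "\<exists>D. (PU has_real_derivative D) (at z) \<and> 0 \<le> D" if "x < z" "z < y" for z
    using PU_deriv[of z UNIV] U_pos[of z] that assms a1
    by (intro exI[of _ "a * z powr (b - 1) * exp (- z) * U z"]) auto
  show "continuous_on {x..y} PU" by (rule continuous_on_subset[OF PU_cont]) (use assms in auto)
qed

text \<open>U / N equals A (M / N - lr), and M / N decreases to lr. This is the recessiveness of
  U.\<close>

lemma U_small: assumes "0 < \<epsilon>" shows "\<exists>z0>0. \<forall>z\<ge>z0. U z < \<epsilon> * N z"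
proof -
  have "lr < lr + \<epsilon> / A" using assms A_pos by simp
  then obtain z0 where z0: "0 < z0" "M z0 / N z0 < lr + \<epsilon> / A" using ratio_not_above by blast
  have "U z < \<epsilon> * N z" if "z0 \<le> z" for z
  proof -
    have "M z / N z \<le> M z0 / N z0" using ratio_decreasing[of z0 z] that z0 by (cases "z = z0") auto
    then have "M z < (lr + \<epsilon> / A) * N z" using z0 that N_pos[of z] by (simp add: pos_divide_less_eq[symmetric])
    then have "M z - lr * N z < \<epsilon> / A * N z" by (simp add: algebra_simps)
    then have "A * (M z - lr * N z) < A * (\<epsilon> / A * N z)" using A_pos by (intro mult_strict_left_mono)
    then show ?thesis using A_pos by (simp add: U_eq)
  qed
  with z0 show ?thesis by blast
qed

text \<open>If the flux were positive somewhere, U would grow from there on like the dominant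
  solution, against \<open>U_small\<close>. To see this, a small multiple of N is subtracted: the
  difference \<open>D\<close> solves the same equation, starts positive with nonnegative flux, and
  so cannot vanish later.\<close>

lemma PU_nonpos: assumes "0 \<le> z" shows "PU z \<le> 0"
proof (rule ccontr)
  assume "\<not> ?thesis"
  then have pz: "0 < PU z" by simp
  \<comment> \<open>Moving right makes \<open>N w\<close> positive even if z = 0; the flux stays
    positive by \<open>PU_mono\<close>.\<close>
  define w where "w = z + 1"
  have w: "0 < w" "0 < PU w" using assms PU_mono[of z w] pz by (auto simp: w_def)
  define \<epsilon> where "\<epsilon> = min (U w / N w / 2) (PU w / PN w)"
  have pos: "0 < U w" "0 < N w" "0 < PN w" using w U_pos[of w] N_pos[of w] PN_pos[of w] by auto
  have \<epsilon>: "0 < \<epsilon>" "\<epsilon> * N w < U w" "\<epsilon> * PN w \<le> PU w"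
  proof -
    show "0 < \<epsilon>" using pos w by (simp add: \<epsilon>_def)
    have "\<epsilon> * N w \<le> U w / N w / 2 * N w" using pos by (intro mult_right_mono) (auto simp: \<epsilon>_def)
    then show "\<epsilon> * N w < U w" using pos by simp
    have "\<epsilon> * PN w \<le> PU w / PN w * PN w" using pos by (intro mult_right_mono) (auto simp: \<epsilon>_def)
    then show "\<epsilon> * PN w \<le> PU w" using pos by simp
  qed
  define D where "D z = U z - \<epsilon> * N z" for z
  define P where "P z = PU z - \<epsilon> * PN z" for z
  have D_deriv: "(D has_real_derivative P z * (z powr (- b) * exp z)) (at z)" if "0 < z" for z
    unfolding D_def[abs_def] P_def
    by (rule derivative_eq_intros U_deriv N_deriv refl that)+ (simp add: algebra_simps)
  have P_deriv: "(P has_real_derivative a * z powr (b - 1) * exp (- z) * D z) (at z)" if "0 < z" for z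
    unfolding D_def P_def[abs_def]
    by (rule derivative_eq_intros PU_deriv PN_deriv refl that)+ (simp add: algebra_simps)
  have Dw: "0 < D w" "0 \<le> P w" using \<epsilon> by (auto simp: D_def P_def)
  \<comment> \<open>The derivative of D P is a combination of P^2 and D^2 with nonnegative weights,
    whatever the signs of D and P. Hence D^2 is nondecreasing as well.\<close>
  have DP: "0 \<le> D z * P z" if "w \<le> z" for z
  proof -
    have "D w * P w \<le> D z * P z"
    proof (rule DERIV_nonneg_imp_nondecreasing[OF that])
      fix x assume "w \<le> x" "x \<le> z"
      then have x: "0 < x" using w by simp
      have "((\<lambda>z. D z * P z) has_real_derivative
         P x * (x powr (- b) * exp x) * P x + a * x powr (b - 1) * exp (- x) * D x * D x) (at x)"
        by (rule DERIV_cong[OF DERIV_mult[OF D_deriv[OF x] P_deriv[OF x]]]) (simp add: algebra_simps)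
      moreover have "0 \<le> (x powr (- b) * exp x) * (P x * P x) + (a * x powr (b - 1) * exp (- x)) * (D x * D x)"
        using a1 by (intro add_nonneg_nonneg mult_nonneg_nonneg zero_le_square) auto
      ultimately show "\<exists>y. ((\<lambda>z. D z * P z) has_real_derivative y) (at x) \<and> 0 \<le> y"
        by (intro exI conjI) (auto simp: mult_ac)
    qed
    then show ?thesis using Dw by (smt (verit) mult_nonneg_nonneg)
  qed
  have D2: "(D w)\<^sup>2 \<le> (D z)\<^sup>2" if "w \<le> z" for z
  proof (rule DERIV_nonneg_imp_nondecreasing[OF that])
    fix x assume "w \<le> x" "x \<le> z"
    then have x: "0 < x" "w \<le> x" using w by auto
    have "((\<lambda>z. (D z)\<^sup>2) has_real_derivative 2 * (D x * P x) * (x powr (- b) * exp x)) (at x)"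
      by (rule derivative_eq_intros D_deriv x refl)+ (simp add: power2_eq_square)
    moreover have "0 \<le> 2 * (D x * P x) * (x powr (- b) * exp x)" using DP[OF x(2)] by simp
    ultimately show "\<exists>y. ((\<lambda>z. (D z)\<^sup>2) has_real_derivative y) (at x) \<and> 0 \<le> y" by blast
  qed
  obtain z0 where z0: "0 < z0" "\<And>z. z \<ge> z0 \<Longrightarrow> U z < \<epsilon> * N z" using U_small[OF \<epsilon>(1)] by blast
  define v where "v = max z0 w"
  have v: "w \<le> v" "D v < 0" using z0(2)[of v] by (auto simp: v_def D_def)
  have "\<exists>x\<ge>w. x \<le> v \<and> D x = 0"
  proof (rule IVT2')
    show "continuous_on {w..v} D"
      by (intro continuous_at_imp_continuous_on ballI DERIV_isCont[OF D_deriv]) (use w in auto)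
  qed (use v Dw in auto)
  then obtain x where "w \<le> x" "D x = 0" by blast
  with D2[of x] Dw show False by simp
qed

lemma U_antimono: assumes "0 \<le> x" "x \<le> y" shows "U y \<le> U x"
proof -
  have "- U x \<le> - U y"
  proof (rule DERIV_nonneg_imp_increasing_open[OF assms(2)])
    show "\<exists>D. ((\<lambda>x. - U x) has_real_derivative D) (at z) \<and> 0 \<le> D" if "x < z" "z < y" for z
    proof (intro exI conjI)
      show "((\<lambda>x. - U x) has_real_derivative - (PU z * (z powr (- b) * exp z))) (at z)"
        by (intro DERIV_minus U_deriv) (use that assms in auto)
      show "0 \<le> - (PU z * (z powr (- b) * exp z))"
        using PU_nonpos[of z] that assms by (auto simp: mult_nonpos_nonneg)
    qed
    show "continuous_on {x..y} (\<lambda>x. - U x)"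
      by (intro continuous_intros continuous_on_subset[OF U_cont]) (use assms in auto)
  qed
  then show ?thesis by simp
qed

text \<open>From 1 on the flux increases at a rate of at most a A exp (- z). Once below the stated
  bound it would stay below a negative constant, and U would decrease at least linearly and become
  negative. The bound disposes of the boundary term at infinity in \<open>test_funI\<close>.\<close>

lemma PU_lower: assumes "1 \<le> z" shows "- (a * A * exp (- z)) \<le> PU z"
proof (rule ccontr)
  assume neg: "\<not> - (a * A * exp (- z)) \<le> PU z"
  define F where "F z = - (PU z + a * A * exp (- z))" for z
  define k where "k = F z"
  have k: "0 < k" using neg by (simp add: k_def F_def)
  have F: "k \<le> F y" if "z \<le> y" for y
    unfolding k_def
  proof (rule DERIV_nonneg_imp_nondecreasing[OF that])
    fix x assume "z \<le> x" "x \<le> y"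
    then have x: "0 < x" "1 \<le> x" using assms by auto
    have "(F has_real_derivative - (a * x powr (b - 1) * exp (- x) * U x - a * A * exp (- x))) (at x)"
      unfolding F_def[abs_def] by (rule derivative_eq_intros PU_deriv x refl)+ simp
    moreover have "a * x powr (b - 1) * exp (- x) * U x \<le> a * 1 * exp (- x) * A"
      using U_antimono[of 0 x] U_pos[of x] x a1 b1 powr_mono[of "b - 1" 0 x] A_pos
      by (intro mult_mono mult_nonneg_nonneg mult_right_mono) (auto simp: U_0)
    ultimately show "\<exists>y. (F has_real_derivative y) (at x) \<and> 0 \<le> y"
      by (intro exI conjI) (auto simp: mult_ac)
  qed
  \<comment> \<open>Beyond the zero of the line through U z with slope -k.\<close>
  define y where "y = z + U z / k + 1"
  have y: "z \<le> y" using U_pos[of z] k assms by (simp add: y_def)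
  have "U z + k * z \<ge> U y + k * y"
  proof (rule DERIV_nonpos_imp_nonincreasing[OF y])
    fix x assume "z \<le> x" "x \<le> y"
    then have x: "0 < x" "1 \<le> x" "z \<le> x" using assms by auto
    have 1: "((\<lambda>y. U y + k * y) has_real_derivative PU x * (x powr (- b) * exp x) + k) (at x)"
      by (rule derivative_eq_intros U_deriv x refl)+ simp
    have "0 < a * A * exp (- x)" using a1 A_pos by simp
    then have "PU x \<le> - k" using F[OF x(3)] by (simp add: F_def)
    moreover have e: "1 \<le> x powr (- b) * exp x"
    proof -
      have "x powr b \<le> x powr 1" using x b1 by (intro powr_mono) auto
      also have "x powr 1 \<le> exp x"
      proof -
        have "x powr 1 = x" using x by simp
        then show ?thesis using exp_ge_add_one_self[of x] by linarith
      qed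
      finally show ?thesis using x by (simp add: powr_minus field_simps)
    qed
    ultimately have "PU x * (x powr (- b) * exp x) \<le> - k * (x powr (- b) * exp x)"
      by (intro mult_right_mono) auto
    also have "\<dots> \<le> - k * 1" using k e by (intro mult_left_mono_neg) auto
    finally have "PU x * (x powr (- b) * exp x) \<le> - k * 1" .
    with 1 show "\<exists>d. ((\<lambda>y. U y + k * y) has_real_derivative d) (at x) \<and> d \<le> 0"
      by (intro exI conjI) auto
  qed
  moreover have "k * y = k * z + U z + k" using k by (simp add: y_def field_simps)
  ultimately have "U y < 0" using k by simp
  with U_pos[of y] y assms show False by simp
qed

end

section \<open>The resolvent kernel\<close>

definition sum_measure :: "'a measure \<Rightarrow> (nat \<Rightarrow> 'a measure) \<Rightarrow> 'a measure" where
  "sum_measure M \<nu> = measure_of (space M) (sets M) (\<lambda>A. \<Sum>n. emeasure (\<nu> n) A)"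

lemma suminf_ennreal_swap: "(\<Sum>i. \<Sum>n. f i n :: ennreal) = (\<Sum>n. \<Sum>i. f i n)"
proof -
  have "(\<Sum>i. \<Sum>n. f i n) = (\<Sum>i. \<integral>\<^sup>+n. f i n \<partial>count_space UNIV)"
    by (simp add: nn_integral_count_space_nat)
  also have "\<dots> = (\<integral>\<^sup>+n. (\<Sum>i. f i n) \<partial>count_space UNIV)"
    by (rule nn_integral_suminf[symmetric]) simp
  finally show ?thesis by (simp add: nn_integral_count_space_nat)
qed

lemma sets_sum_measure [simp, measurable_cong]: "sets (sum_measure M \<nu>) = sets M"
  and space_sum_measure [simp]: "space (sum_measure M \<nu>) = space M"
  by (simp_all add: sum_measure_def)

lemma emeasure_sum_measure:
  assumes \<nu>: "\<And>n. sets (\<nu> n) = sets M" and A: "A \<in> sets M"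
  shows "emeasure (sum_measure M \<nu>) A = (\<Sum>n. emeasure (\<nu> n) A)"
  unfolding sum_measure_def
proof (rule emeasure_measure_of_sigma[OF _ _ _ A])
  show "sigma_algebra (space M) (sets M)" ..
  show "positive (sets M) (\<lambda>A. \<Sum>n. emeasure (\<nu> n) A)" by (simp add: positive_def)
  show "countably_additive (sets M) (\<lambda>A. \<Sum>n. emeasure (\<nu> n) A)"
  proof (rule countably_additiveI)
    fix B :: "nat \<Rightarrow> 'a set" assume B: "range B \<subseteq> sets M" "disjoint_family B"
    have "(\<Sum>i. emeasure (\<nu> n) (B i)) = emeasure (\<nu> n) (\<Union>i. B i)" for n
      by (rule suminf_emeasure) (use B \<nu> in auto)
    then show "(\<Sum>i. \<Sum>n. emeasure (\<nu> n) (B i)) = (\<Sum>n. emeasure (\<nu> n) (\<Union>i. B i))"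
      by (subst suminf_ennreal_swap) simp
  qed
qed

lemma nn_integral_sum_measure:
  assumes \<nu>: "\<And>n. sets (\<nu> n) = sets M" and f: "f \<in> borel_measurable M"
  shows "(\<integral>\<^sup>+x. f x \<partial>sum_measure M \<nu>) = (\<Sum>n. \<integral>\<^sup>+x. f x \<partial>\<nu> n)"
  using f
proof (induction rule: borel_measurable_induct)
  case (cong f g)
  have "(\<integral>\<^sup>+x. f x \<partial>\<nu> n) = (\<integral>\<^sup>+x. g x \<partial>\<nu> n)" for n
    by (rule nn_integral_cong) (use cong(3) sets_eq_imp_space_eq[OF \<nu>] in auto)
  moreover have "(\<integral>\<^sup>+x. f x \<partial>sum_measure M \<nu>) = (\<integral>\<^sup>+x. g x \<partial>sum_measure M \<nu>)"
    by (rule nn_integral_cong) (use cong(3) in auto)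
  ultimately show ?case using cong(4) by simp
next
  case (set A)
  then show ?case using \<nu> by (simp add: emeasure_sum_measure[OF \<nu>])
next
  case (mult u c)
  have "u \<in> borel_measurable (\<nu> n)" "u \<in> borel_measurable (sum_measure M \<nu>)" for n
    using mult(2) measurable_cong_sets[OF \<nu> refl] measurable_cong_sets[OF sets_sum_measure refl] by blast+
  then show ?case using mult.IH by (simp add: nn_integral_cmult)
next
  case (add u v)
  have m: "u \<in> borel_measurable (\<nu> n)" "u \<in> borel_measurable (sum_measure M \<nu>)"
    "v \<in> borel_measurable (\<nu> n)" "v \<in> borel_measurable (sum_measure M \<nu>)" for n
    using add measurable_cong_sets[OF \<nu> refl] measurable_cong_sets[OF sets_sum_measure refl] by blast+
  then show ?case using add.IH by (simp add: nn_integral_add suminf_add)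
next
  case (seq u)
  have m: "u i \<in> borel_measurable (\<nu> n)" "u i \<in> borel_measurable (sum_measure M \<nu>)" for n i
    using seq measurable_cong_sets[OF \<nu> refl] measurable_cong_sets[OF sets_sum_measure refl] by blast+
  have "(\<integral>\<^sup>+x. (SUP i. u i x) \<partial>sum_measure M \<nu>) = (SUP i. \<integral>\<^sup>+x. u i x \<partial>sum_measure M \<nu>)"
    by (rule nn_integral_monotone_convergence_SUP) (use seq m in auto)
  also have "\<dots> = (SUP i. \<integral>\<^sup>+n. (\<integral>\<^sup>+x. u i x \<partial>\<nu> n) \<partial>count_space UNIV)"
    by (simp add: seq.IH nn_integral_count_space_nat)
  also have "\<dots> = (\<integral>\<^sup>+n. (SUP i. \<integral>\<^sup>+x. u i x \<partial>\<nu> n) \<partial>count_space UNIV)"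
    by (rule nn_integral_monotone_convergence_SUP[symmetric])
      (use seq in \<open>auto simp: incseq_def le_fun_def intro!: nn_integral_mono\<close>)
  also have "\<dots> = (\<Sum>n. \<integral>\<^sup>+x. (SUP i. u i x) \<partial>\<nu> n)"
    unfolding nn_integral_count_space_nat
    by (intro suminf_cong nn_integral_monotone_convergence_SUP[symmetric]) (use seq m in auto)
  finally show ?case by (simp add: image_comp SUP_apply)
qed

section \<open>Measures on the half-line with a density and an atom at 0\<close>

lemma sets_halfline: "A \<in> sets halfline \<longleftrightarrow> A \<in> sets borel \<and> A \<subseteq> {0..}"
  by (auto simp: halfline_def sets_restrict_space_iff)

lemma space_halfline [simp]: "space halfline = {0..}"
  by (simp add: halfline_def space_restrict_space)

lemma borel_measurable_halfline_iff:
  fixes f :: "real \<Rightarrow> real"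
  shows "f \<in> borel_measurable halfline \<longleftrightarrow> (\<lambda>x. indicator {0..} x * f x) \<in> borel_measurable borel"
  unfolding halfline_def by (subst borel_measurable_restrict_space_iff) auto

lemma borel_measurable_halfline_ennreal_iff:
  fixes f :: "real \<Rightarrow> ennreal"
  shows "f \<in> borel_measurable halfline \<longleftrightarrow> (\<lambda>x. f x * indicator {0..} x) \<in> borel_measurable borel"
  unfolding halfline_def by (subst borel_measurable_restrict_space_iff_ennreal) auto

lemma borel_measurable_halfline_continuous:
  fixes f :: "real \<Rightarrow> real"
  shows "continuous_on {0..} f \<Longrightarrow> f \<in> borel_measurable halfline"
  unfolding halfline_def by (rule borel_measurable_continuous_on_restrict)

definition halfline_mix :: "(real \<Rightarrow> real) \<Rightarrow> real \<Rightarrow> real measure" where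
  "halfline_mix r w = measure_of (space halfline) (sets halfline)
     (\<lambda>A. (\<integral>\<^sup>+y\<in>A. ennreal (r y) \<partial>lborel) + ennreal w * indicator A 0)"

text \<open>\<open>measure_of\<close> returns the given set function only if that is countably
  additive. A sum of two genuine measures, padded with null measures, settles this and brings the
  integral formula with it.\<close>

lemma halfline_mix_eq_sum_measure:
  assumes r: "r \<in> borel_measurable borel"
  shows "halfline_mix r w = sum_measure halfline
     (\<lambda>n. if n = 0 then restrict_space (density lborel (\<lambda>y. ennreal (r y))) {0..}
          else if n = 1 then density (return halfline 0) (\<lambda>_. ennreal w) else null_measure halfline)"
  unfolding halfline_mix_def sum_measure_def
proof (rule measure_of_eq)
  show "sets halfline \<subseteq> Pow (space halfline)" by (rule sets.space_closed)
  fix A assume "A \<in> sigma_sets (space halfline) (sets halfline)"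
  then have A: "A \<in> sets halfline" using sets.sigma_sets_eq[of halfline] by (simp del: space_halfline)
  then have A': "A \<in> sets borel" "A \<subseteq> {0..}" by (auto simp: sets_halfline)
  have "(\<Sum>n. emeasure (if n = 0 then restrict_space (density lborel (\<lambda>y. ennreal (r y))) {0..}
          else if n = 1 then density (return halfline 0) (\<lambda>_. ennreal w) else null_measure halfline) A)
      = (\<Sum>n\<in>{0, 1 :: nat}. emeasure (if n = 0 then restrict_space (density lborel (\<lambda>y. ennreal (r y))) {0..}
          else if n = 1 then density (return halfline 0) (\<lambda>_. ennreal w) else null_measure halfline) A)"
    by (rule suminf_finite) auto
  also have "\<dots> = emeasure (density lborel (\<lambda>y. ennreal (r y))) A + emeasure (density (return halfline 0) (\<lambda>_. ennreal w)) A"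
    using A' by (simp add: emeasure_restrict_space)
  also have "\<dots> = (\<integral>\<^sup>+y\<in>A. ennreal (r y) \<partial>lborel) + ennreal w * indicator A 0"
    using A A' r by (subst (1 2) emeasure_density) (auto simp: nn_integral_cmult_indicator)
  finally show "(\<integral>\<^sup>+y\<in>A. ennreal (r y) \<partial>lborel) + ennreal w * indicator A 0
     = (\<Sum>n. emeasure (if n = 0 then restrict_space (density lborel (\<lambda>y. ennreal (r y))) {0..}
          else if n = 1 then density (return halfline 0) (\<lambda>_. ennreal w) else null_measure halfline) A)" ..
qed

lemma sets_halfline_mix [simp, measurable_cong]: "sets (halfline_mix r w) = sets halfline"
  and space_halfline_mix [simp]: "space (halfline_mix r w) = {0..}"
proof -
  show "sets (halfline_mix r w) = sets halfline"
    unfolding halfline_mix_def by (rule sets.sets_measure_of_eq)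
  have "space (halfline_mix r w) = space halfline"
    unfolding halfline_mix_def by (rule sets.space_measure_of_eq)
  then show "space (halfline_mix r w) = {0..}" by simp
qed

lemma nn_integral_halfline_mix:
  assumes r: "r \<in> borel_measurable borel" and f: "f \<in> borel_measurable halfline"
  shows "(\<integral>\<^sup>+y. f y \<partial>halfline_mix r w)
     = (\<integral>\<^sup>+y. ennreal (r y) * (f y * indicator {0..} y) \<partial>lborel) + ennreal w * f 0"
proof -
  let ?\<nu> = "\<lambda>n::nat. if n = 0 then restrict_space (density lborel (\<lambda>y. ennreal (r y))) {0..}
          else if n = 1 then density (return halfline 0) (\<lambda>_. ennreal w) else null_measure halfline"
  have s: "sets (?\<nu> n) = sets halfline" for n
    by (auto simp: halfline_def sets_restrict_space)
  have f': "(\<lambda>x. f x * indicator {0..} x) \<in> borel_measurable borel"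
    using f by (simp add: borel_measurable_halfline_ennreal_iff)
  have "(\<integral>\<^sup>+y. f y \<partial>halfline_mix r w) = (\<Sum>n. \<integral>\<^sup>+y. f y \<partial>?\<nu> n)"
    unfolding halfline_mix_eq_sum_measure[OF r] by (rule nn_integral_sum_measure[OF s f])
  also have "\<dots> = (\<Sum>n\<in>{0, 1 :: nat}. \<integral>\<^sup>+y. f y \<partial>?\<nu> n)"
    by (rule suminf_finite) auto
  also have "\<dots> = (\<integral>\<^sup>+y. f y \<partial>restrict_space (density lborel (\<lambda>y. ennreal (r y))) {0..})
      + (\<integral>\<^sup>+y. f y \<partial>density (return halfline 0) (\<lambda>_. ennreal w))" by simp
  also have "(\<integral>\<^sup>+y. f y \<partial>restrict_space (density lborel (\<lambda>y. ennreal (r y))) {0..})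
      = (\<integral>\<^sup>+y. ennreal (r y) * (f y * indicator {0..} y) \<partial>lborel)"
    by (subst nn_integral_restrict_space) (use r f' in \<open>auto simp: nn_integral_density\<close>)
  also have "(\<integral>\<^sup>+y. f y \<partial>density (return halfline 0) (\<lambda>_. ennreal w)) = ennreal w * f 0"
    using f by (subst nn_integral_density) (auto simp: nn_integral_return)
  finally show ?thesis .
qed

lemma integral_halfline_mix:
  fixes f :: "real \<Rightarrow> real"
  assumes r: "r \<in> borel_measurable borel" "\<And>y. 0 \<le> y \<Longrightarrow> 0 \<le> r y" and w: "0 \<le> w"
    and f: "f \<in> borel_measurable halfline"
    and i: "set_integrable lborel {0..} (\<lambda>y. r y * f y)"
  shows "integrable (halfline_mix r w) f"
    and "(\<integral>y. f y \<partial>halfline_mix r w) = (LBINT y:{0..}. r y * f y) + w * f 0"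
proof -
  have f': "f \<in> borel_measurable (halfline_mix r w)"
    using f by (subst measurable_cong_sets[OF sets_halfline_mix refl])
  define g where "g y = indicator {0..} y * (r y * f y)" for y
  have g: "integrable lborel g" using i by (simp add: set_integrable_def g_def[abs_def])
  have fin: "(\<integral>\<^sup>+y. ennreal (g y) \<partial>lborel) < \<infinity>" "(\<integral>\<^sup>+y. ennreal (- g y) \<partial>lborel) < \<infinity>"
    using g by (auto simp: real_integrable_def less_top)
  \<comment> \<open>Used with c = 1 and c = -1: \<open>ennreal\<close> truncates at 0, so these are
    the positive and the negative part.\<close>
  have e: "(\<integral>\<^sup>+y. ennreal (c * f y) \<partial>halfline_mix r w) = (\<integral>\<^sup>+y. ennreal (c * g y) \<partial>lborel) + ennreal (w * (c * f 0))" for c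
  proof -
    have "(\<integral>\<^sup>+y. ennreal (c * f y) \<partial>halfline_mix r w)
       = (\<integral>\<^sup>+y. ennreal (r y) * (ennreal (c * f y) * indicator {0..} y) \<partial>lborel) + ennreal w * ennreal (c * f 0)"
      by (rule nn_integral_halfline_mix[OF r(1)]) (use f in auto)
    also have "(\<integral>\<^sup>+y. ennreal (r y) * (ennreal (c * f y) * indicator {0..} y) \<partial>lborel) = (\<integral>\<^sup>+y. ennreal (c * g y) \<partial>lborel)"
      by (rule nn_integral_cong) (auto simp: g_def indicator_def ennreal_mult'[symmetric] r(2) mult_ac)
    finally show ?thesis using w by (simp add: ennreal_mult')
  qed
  have e1: "(\<integral>\<^sup>+y. ennreal (f y) \<partial>halfline_mix r w) = (\<integral>\<^sup>+y. ennreal (g y) \<partial>lborel) + ennreal (w * f 0)"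
    using e[of 1] by simp
  have e2: "(\<integral>\<^sup>+y. ennreal (- f y) \<partial>halfline_mix r w) = (\<integral>\<^sup>+y. ennreal (- g y) \<partial>lborel) + ennreal (- (w * f 0))"
    using e[of "-1"] by simp
  show int: "integrable (halfline_mix r w) f"
    using f' fin by (simp add: real_integrable_def e1 e2 less_top)
  have r1: "enn2real ((\<integral>\<^sup>+y. ennreal (g y) \<partial>lborel) + ennreal (w * f 0))
      = enn2real (\<integral>\<^sup>+y. ennreal (g y) \<partial>lborel) + max 0 (w * f 0)"
    using fin by (subst enn2real_plus) (auto simp: max_def ennreal_neg)
  have r2: "enn2real ((\<integral>\<^sup>+y. ennreal (- g y) \<partial>lborel) + ennreal (- (w * f 0)))
      = enn2real (\<integral>\<^sup>+y. ennreal (- g y) \<partial>lborel) + max 0 (- (w * f 0))"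
    using fin by (subst enn2real_plus) (auto simp: max_def ennreal_neg)
  have "(\<integral>y. f y \<partial>halfline_mix r w) = (\<integral>y. g y \<partial>lborel) + w * f 0"
    unfolding real_lebesgue_integral_def[OF int] real_lebesgue_integral_def[OF g] e1 e2 r1 r2 by (auto simp: max_def)
  then show "(\<integral>y. f y \<partial>halfline_mix r w) = (LBINT y:{0..}. r y * f y) + w * f 0"
    by (simp add: set_lebesgue_integral_def g_def[abs_def])
qed


lemma set_integrable_bounded_mult:
  fixes k \<phi> :: "real \<Rightarrow> real"
  assumes "k \<in> borel_measurable borel" "S \<in> sets borel" "\<And>y. y \<in> S \<Longrightarrow> \<bar>k y\<bar> \<le> B"
    and \<phi>: "set_integrable lborel S \<phi>"
  shows "set_integrable lborel S (\<lambda>y. k y * \<phi> y)"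
proof (rule set_integrable_bound[of _ _ "\<lambda>y. B * \<phi> y"])
  show "set_integrable lborel S (\<lambda>y. B * \<phi> y)" using \<phi> by simp
  have "(\<lambda>y. indicator S y * \<phi> y) \<in> borel_measurable lborel"
    using \<phi> by (auto simp: set_integrable_def)
  then have "(\<lambda>y. k y * (indicator S y * \<phi> y)) \<in> borel_measurable lborel"
    using assms(1) by simp
  then show "set_borel_measurable lborel S (\<lambda>y. k y * \<phi> y)"
    by (simp add: set_borel_measurable_def mult_ac)
  have "\<bar>k y * \<phi> y\<bar> \<le> \<bar>B * \<phi> y\<bar>" if "y \<in> S" for y
  proof -
    have "\<bar>k y\<bar> \<le> \<bar>B\<bar>" using assms(3)[OF that] by linarith
    then show ?thesis by (simp add: abs_mult mult_right_mono)
  qed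
  then show "AE x in lborel. x \<in> S \<longrightarrow> norm (k x * \<phi> x) \<le> norm (B * \<phi> x)" by simp
qed

section \<open>Speed measure, scale and Green function of the sticky process\<close>

locale sticky =
  fixes lam \<beta> \<delta> \<mu> h :: real
  assumes lam: "0 < lam" and beta: "0 < \<beta>" and mu: "0 < \<mu>" and delta: "1 < \<delta>" "\<delta> < 2"
    and h: "0 < h" "2 * lam * h \<le> 1"
begin

definition a where "a = 1 / h / (2 * lam)"

sublocale kummer a "\<delta> / 2"
  by unfold_locales (use lam h delta in \<open>auto simp: a_def field_simps\<close>)

definition z where "z = cir_z lam \<beta>"
text \<open>Reciprocal of the scale density: off 0 the generator maps f to (q f')' / m, so q f' is
  the flux of f.\<close>

definition q where "q x = x powr (\<delta> - 1) * exp (- z x)"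
definition m where "m = cir_speed lam \<beta> \<delta>"
definition Wr where "Wr = cir_wronskian lam \<beta> \<delta> (1 / h)"
definition c where "c = sticky_coeff lam \<beta> \<delta> \<mu> (1 / h)"
definition u1 where "u1 = sticky_f0 lam \<beta> \<delta> \<mu> (1 / h)"
definition u2 where "u2 x = U (z x)"
text \<open>The constant in the change of variable x to \<open>z x\<close>: q times d/dx equals
  \<kappa> times z^b exp (- z) d/dz with b = \<delta> / 2, see \<open>q_z\<close>. Accordingly
  \<open>P1\<close> and \<open>P2\<close> are the fluxes of \<open>u1\<close> and
  \<open>u2\<close>.\<close>

definition \<kappa> where "\<kappa> = lam * \<beta> * (lam * \<beta> / 2) powr (- (\<delta> / 2))"
definition P1 where "P1 x = \<kappa> * (PM (z x) + c * PU (z x))"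
definition P2 where "P2 x = \<kappa> * PU (z x)"
definition \<rho> where "\<rho> s = - c * u2 s"
definition r where "r s y = 1 / h * sticky_green lam \<beta> \<delta> \<mu> (1 / h) s y * m y"
definition R where "R = sticky_resolvent lam \<beta> \<delta> \<mu> h"

lemma z_nonneg: "0 \<le> z x" and z_0: "z 0 = 0" and z_pos: "0 < x \<Longrightarrow> 0 < z x"
  using lam beta by (simp_all add: z_def cir_z_def)

lemma z_mono: "0 \<le> x \<Longrightarrow> x \<le> y \<Longrightarrow> z x \<le> z y"
  using lam beta by (simp add: z_def cir_z_def power_mono mult_left_mono)

lemma z_deriv: "(z has_real_derivative lam * \<beta> * x) (at x within S)"
  unfolding z_def cir_z_def[abs_def] by (auto intro!: derivative_eq_intros)

lemma z_cont [continuous_intros]: "continuous_on S z"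
  unfolding z_def cir_z_def[abs_def] by (intro continuous_intros) auto

lemma m_eq: "m x = \<beta> * q x"
  by (simp add: m_def cir_speed_def q_def z_def cir_z_def)

lemma u1_eq: "u1 x = M (z x) + c * u2 x"
  unfolding u1_def sticky_f0_def M_def u2_def U_def z_def c_def unfolding a_def ..

lemma r_eq: "r s y = 1 / h * (u1 (min s y) * u2 (max s y) / Wr) * m y"
  unfolding r_def sticky_green_def u1_def u2_def U_def z_def Wr_def unfolding a_def ..

lemma kappa_pos: "0 < \<kappa>" using lam beta by (simp add: \<kappa>_def)

lemma Wr_eq: "Wr = \<kappa> * (Gamma (\<delta> / 2) / Gamma a)"
  unfolding Wr_def cir_wronskian_def \<kappa>_def a_def Let_def by (simp only: mult_ac)

lemma Wr_pos: "0 < Wr"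
  unfolding Wr_eq using kappa_pos pars(1) b0 by (simp add: Gamma_real_pos)

lemma c_eq: "c = - (1 / h) / (\<mu> * Wr + 1 / h * u2 0)"
  unfolding c_def sticky_coeff_def Wr_def u2_def U_def z_0 unfolding a_def ..

lemma u2_pos: "0 < u2 x" unfolding u2_def by (rule U_pos[OF z_nonneg])

lemma c_neg: "c < 0"
  unfolding c_eq using Wr_pos mu h u2_pos[of 0] by (simp add: divide_neg_pos add_pos_pos)

lemma \<rho>_pos: "0 < \<rho> s" using c_neg u2_pos[of s] by (simp add: \<rho>_def mult_neg_pos)

lemma u2_antimono: "0 \<le> x \<Longrightarrow> x \<le> y \<Longrightarrow> u2 y \<le> u2 x"
  unfolding u2_def by (intro U_antimono z_nonneg z_mono)

lemma \<rho>_antimono: "0 \<le> x \<Longrightarrow> x \<le> y \<Longrightarrow> \<rho> y \<le> \<rho> x"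
  using u2_antimono[of x y] c_neg by (simp add: \<rho>_def)

lemma u1_mono: "0 \<le> x \<Longrightarrow> x \<le> y \<Longrightarrow> u1 x \<le> u1 y"
  unfolding u1_eq using u2_antimono[of x y] c_neg M_mono[OF z_nonneg z_mono, of x y]
  by (intro add_mono mult_left_mono_neg) auto

text \<open>Together with \<open>P1_0\<close> this reads u1 0 = h \<mu> P1 0, the sticky boundary
  condition; the coefficient c is chosen to achieve it.\<close>

lemma u1_0: "u1 0 = - c * \<mu> * h * Wr"
proof -
  have "0 < \<mu> * Wr + 1 / h * u2 0" using Wr_pos mu h u2_pos[of 0] by (simp add: add_pos_pos)
  then show ?thesis unfolding u1_eq c_eq z_0 M_0 using h by (simp add: field_simps)
qed

lemma u1_pos: "0 \<le> x \<Longrightarrow> 0 < u1 x"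
proof -
  assume "0 \<le> x"
  moreover have "0 < u1 0" unfolding u1_0 using c_neg mu h Wr_pos
    by (intro mult_pos_pos) auto
  ultimately show ?thesis using u1_mono[of 0 x] by linarith
qed

lemma q_pos: "0 < x \<Longrightarrow> 0 < q x" by (simp add: q_def)

lemma m_nonneg: "0 \<le> m x" using beta by (simp add: m_eq q_def)

lemma r_nonneg: "0 \<le> s \<Longrightarrow> 0 \<le> y \<Longrightarrow> 0 \<le> r s y"
  unfolding r_eq using u1_pos[of "min s y"] u2_pos[of "max s y"] Wr_pos h m_nonneg[of y]
  by (auto intro!: mult_nonneg_nonneg divide_nonneg_pos)

lemma on_z_cont: "continuous_on {0..} f \<Longrightarrow> continuous_on S (\<lambda>x. f (z x))"
  by (rule continuous_on_compose2[of "{0..}" f]) (auto intro!: continuous_intros z_nonneg)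

lemma u2_cont: "continuous_on S u2" unfolding u2_def by (rule on_z_cont[OF U_cont])
lemma u1_cont: "continuous_on S u1"
  unfolding u1_eq[abs_def] by (intro continuous_intros u2_cont on_z_cont[OF M_cont])
lemma P2_cont: "continuous_on S P2"
  unfolding P2_def by (intro continuous_intros on_z_cont[OF PU_cont])
lemma P1_cont: "continuous_on S P1"
  unfolding P1_def by (intro continuous_intros on_z_cont[OF PU_cont] on_z_cont[OF PM_cont])

lemma q_z: "0 < x \<Longrightarrow> \<kappa> / q x = (z x powr - (\<delta> / 2) * exp (z x)) * (lam * \<beta> * x)"
proof -
  assume x: "0 < x"
  have "z x powr - (\<delta> / 2) = (lam * \<beta> / 2) powr - (\<delta> / 2) * (x\<^sup>2) powr - (\<delta> / 2)"
    using lam beta x by (simp add: z_def cir_z_def powr_mult[symmetric])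
  also have "(x\<^sup>2) powr - (\<delta> / 2) = x powr - \<delta>"
    using x by (simp add: powr_powr flip: powr_numeral)
  finally have "z x powr - (\<delta> / 2) = (lam * \<beta> / 2) powr - (\<delta> / 2) * x powr - \<delta>" .
  then show ?thesis using x
    by (simp add: \<kappa>_def q_def exp_minus powr_minus powr_diff field_simps)
qed

lemma P_z: "0 < x \<Longrightarrow> \<kappa> * (a * z x powr (\<delta> / 2 - 1) * exp (- z x)) * (lam * \<beta> * x) = 1 / h * m x"
proof -
  assume x: "0 < x"
  have "z x powr (\<delta> / 2 - 1) = (lam * \<beta> / 2) powr (\<delta> / 2 - 1) * (x\<^sup>2) powr (\<delta> / 2 - 1)"
    using lam beta x by (simp add: z_def cir_z_def powr_mult[symmetric])
  also have "(x\<^sup>2) powr (\<delta> / 2 - 1) = x powr (\<delta> - 2)"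
    using x by (simp add: powr_powr algebra_simps flip: powr_numeral)
  also have "(lam * \<beta> / 2) powr (\<delta> / 2 - 1) = (lam * \<beta> / 2) powr (\<delta> / 2) * 2 / (lam * \<beta>)"
    using lam beta by (simp add: powr_diff)
  finally have e: "z x powr (\<delta> / 2 - 1) = (lam * \<beta> / 2) powr (\<delta> / 2) * 2 / (lam * \<beta>) * (x powr (\<delta> - 1) / x)"
    using x by (simp add: powr_diff power2_eq_square)
  show ?thesis unfolding e a_def using x lam beta h
    by (simp add: \<kappa>_def m_eq q_def powr_minus divide_simps)
qed

lemma u2_deriv: "0 < x \<Longrightarrow> (u2 has_real_derivative P2 x / q x) (at x)"
proof -
  assume x: "0 < x"
  have "(u2 has_real_derivative PU (z x) * (z x powr - (\<delta> / 2) * exp (z x)) * (lam * \<beta> * x)) (at x)"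
    unfolding u2_def by (rule DERIV_chain2[OF U_deriv[OF z_pos[OF x]] z_deriv])
  moreover have "PU (z x) * (z x powr - (\<delta> / 2) * exp (z x)) * (lam * \<beta> * x) = P2 x / q x"
  proof -
    have "P2 x / q x = PU (z x) * (\<kappa> / q x)" by (simp add: P2_def)
    then show ?thesis unfolding q_z[OF x] by (simp only: mult_ac)
  qed
  ultimately show ?thesis by simp
qed

lemma u1_deriv: "0 < x \<Longrightarrow> (u1 has_real_derivative P1 x / q x) (at x)"
proof -
  assume x: "0 < x"
  have "((\<lambda>x. M (z x)) has_real_derivative PM (z x) * (z x powr - (\<delta> / 2) * exp (z x)) * (lam * \<beta> * x)) (at x)"
    by (rule DERIV_chain2[OF M_deriv[OF z_pos[OF x]] z_deriv])
  then have 1: "((\<lambda>x. M (z x)) has_real_derivative PM (z x) * (\<kappa> / q x)) (at x)"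
    unfolding q_z[OF x] by (simp add: mult.assoc)
  have "((\<lambda>x. M (z x) + c * u2 x) has_real_derivative PM (z x) * (\<kappa> / q x) + c * (P2 x / q x)) (at x)"
    by (intro DERIV_add DERIV_cmult 1 u2_deriv x)
  then show ?thesis unfolding u1_eq[abs_def]
    by (simp add: P1_def P2_def add_divide_distrib distrib_left mult_ac)
qed

lemma P2_deriv: "0 < x \<Longrightarrow> (P2 has_real_derivative 1 / h * m x * u2 x) (at x)"
proof -
  assume x: "0 < x"
  have "(P2 has_real_derivative \<kappa> * (a * z x powr (\<delta> / 2 - 1) * exp (- z x) * U (z x) * (lam * \<beta> * x))) (at x)"
    unfolding P2_def by (intro DERIV_cmult DERIV_chain2[OF PU_deriv[OF z_pos[OF x]] z_deriv])
  then show ?thesis unfolding P_z[OF x, symmetric] u2_def by (simp add: mult_ac)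
qed

lemma P1_deriv: "0 < x \<Longrightarrow> (P1 has_real_derivative 1 / h * m x * u1 x) (at x)"
proof -
  assume x: "0 < x"
  have 1: "((\<lambda>x. \<kappa> * PM (z x)) has_real_derivative \<kappa> * (a * z x powr (\<delta> / 2 - 1) * exp (- z x) * M (z x) * (lam * \<beta> * x))) (at x)"
    by (intro DERIV_cmult DERIV_chain2[OF PM_deriv[OF z_pos[OF x]] z_deriv])
  have "((\<lambda>x. \<kappa> * PM (z x) + c * P2 x) has_real_derivative
    \<kappa> * (a * z x powr (\<delta> / 2 - 1) * exp (- z x) * M (z x) * (lam * \<beta> * x)) + c * (1 / h * m x * u2 x)) (at x)"
    by (intro DERIV_add DERIV_cmult 1 P2_deriv x)
  moreover have "\<kappa> * (a * z x powr (\<delta> / 2 - 1) * exp (- z x) * M (z x) * (lam * \<beta> * x)) = 1 / h * m x * M (z x)"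
    unfolding P_z[OF x, symmetric] by (simp add: mult_ac)
  ultimately have "((\<lambda>x. \<kappa> * PM (z x) + c * P2 x) has_real_derivative 1 / h * m x * u1 x) (at x)"
    by (simp add: u1_eq distrib_left mult_ac)
  moreover have "P1 = (\<lambda>x. \<kappa> * PM (z x) + c * P2 x)" by (rule ext) (simp add: P1_def P2_def algebra_simps)
  ultimately show ?thesis by simp
qed

lemma wronskian: "P1 x * u2 x - u1 x * P2 x = Wr"
  unfolding Wr_eq wronskian_MU[OF z_nonneg, of x, symmetric]
  by (simp add: P1_def P2_def u1_eq u2_def algebra_simps)

lemma P1_0: "P1 0 = - c * Wr"
  by (simp add: P1_def P2_def z_0 PU_0 PM_0 Wr_eq)

section \<open>Integration against the resolvent kernel\<close>

lemma r_measurable [measurable]: "r s \<in> borel_measurable borel"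
proof -
  have [measurable]: "u1 \<in> borel_measurable borel" "u2 \<in> borel_measurable borel"
    by (intro borel_measurable_continuous_onI u1_cont u2_cont)+
  have [measurable]: "m \<in> borel_measurable borel"
    unfolding m_def cir_speed_def[abs_def] by measurable
  show ?thesis unfolding r_eq[abs_def] by measurable
qed

lemma R_eq: "R s = halfline_mix (r s) (\<rho> s)"
  unfolding R_def sticky_resolvent_def halfline_mix_def r_def m_def \<rho>_def c_def u2_def U_def z_def Let_def unfolding a_def ..

lemma sets_R [simp]: "sets (R s) = sets halfline" and space_R [simp]: "space (R s) = {0..}"
  by (simp_all add: R_eq)

text \<open>Enough for integrability under every \<open>R s\<close> with s \<ge> 0, because as a
  function of y the Green function is bounded by its value on the diagonal
  (\<open>G_bound\<close>).\<close>

definition adm where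
  "adm \<phi> \<longleftrightarrow> \<phi> \<in> borel_measurable halfline \<and> set_integrable lborel {0..} (\<lambda>y. m y * \<phi> y)"

lemma G_bound:
  assumes "0 \<le> s" "0 \<le> y"
  shows "\<bar>u1 (min s y) * u2 (max s y) / Wr\<bar> \<le> u1 s * u2 s / Wr"
proof -
  have "u1 (min s y) * u2 (max s y) \<le> u1 s * u2 s"
    using assms u1_mono[of "min s y" s] u2_antimono[of s "max s y"] u1_pos[of s] u2_pos[of "max s y"]
    by (intro mult_mono) auto
  moreover have "0 \<le> u1 (min s y) * u2 (max s y)"
    using u1_pos[of "min s y"] u2_pos[of "max s y"] assms by simp
  ultimately show ?thesis using Wr_pos by (simp add: divide_right_mono)
qed

lemma r_integrable:
  assumes s: "0 \<le> s" and i: "set_integrable lborel {0..} (\<lambda>y. m y * \<phi> y)"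
  shows "set_integrable lborel {0..} (\<lambda>y. r s y * \<phi> y)"
proof -
  have [measurable]: "u1 \<in> borel_measurable borel" "u2 \<in> borel_measurable borel"
    by (intro borel_measurable_continuous_onI u1_cont u2_cont)+
  have "set_integrable lborel {0..} (\<lambda>y. u1 (min s y) * u2 (max s y) / Wr * (m y * \<phi> y))"
    by (rule set_integrable_bounded_mult[OF _ _ _ i, of _ "u1 s * u2 s / Wr"])
      (use G_bound[OF s] in auto)
  then have "set_integrable lborel {0..} (\<lambda>y. 1 / h * (u1 (min s y) * u2 (max s y) / Wr * (m y * \<phi> y)))"
    by (rule set_integrable_mult_right)
  then show ?thesis by (simp only: r_eq mult.assoc)
qed

lemma integrable_R: "0 \<le> s \<Longrightarrow> adm \<phi> \<Longrightarrow> integrable (R s) \<phi>"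
  and integral_R: "0 \<le> s \<Longrightarrow> adm \<phi> \<Longrightarrow> (\<integral>y. \<phi> y \<partial>R s) = (LBINT y:{0..}. r s y * \<phi> y) + \<rho> s * \<phi> 0"
  unfolding R_eq adm_def using \<rho>_pos[of s]
  by (auto intro!: integral_halfline_mix r_nonneg r_integrable)

text \<open>\<open>F\<close> is the flux of f and \<open>g\<close> its generator off 0. No boundary
  condition ties the two together at 0; the flux at 0 shows up as a separate term in
  \<open>resolvent_identity\<close>.\<close>

definition test_fun where
  "test_fun f F g \<longleftrightarrow> continuous_on {0..} f \<and> continuous_on {0..} F \<and>
     (\<forall>x>0. (f has_real_derivative F x / q x) (at x)) \<and> (\<forall>x>0. (F has_real_derivative m x * g x) (at x)) \<and>
     set_integrable lborel {0..} (\<lambda>y. m y * f y) \<and> set_integrable lborel {0..} (\<lambda>y. m y * g y) \<and>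
     (F \<longlongrightarrow> 0) at_top \<and> ((\<lambda>x. P2 x * f x) \<longlongrightarrow> 0) at_top"

text \<open>Dynkin's formula at an exponential time: off 0 the generator acts as g, at the sticky
  point as \<mu> F 0. The proof is Green's formula. The primitives \<open>H1\<close> on [0, s] and
  \<open>H2\<close> on [s, infinity) combine at s through the Wronskian to f s, \<open>H2\<close>
  vanishes at infinity, and \<open>H1 0\<close> yields the terms of the atom.\<close>

lemma resolvent_identity:
  assumes tf: "test_fun f F g" and s: "0 \<le> s"
  shows "(\<integral>y. f y \<partial>R s) = f s + h * (LBINT y:{0..}. r s y * g y) + h * \<mu> * F 0 * \<rho> s"
proof -
  note T = tf[unfolded test_fun_def]
  define \<phi> where "\<phi> y = m y * f y / h - m y * g y" for y
  have \<phi>: "set_integrable lborel {0..} \<phi>"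
    unfolding \<phi>_def by (intro set_integral_diff(1)) (use T in auto)
  have [measurable]: "u1 \<in> borel_measurable borel" "u2 \<in> borel_measurable borel"
    by (intro borel_measurable_continuous_onI u1_cont u2_cont)+
  define H1 where "H1 y = P1 y * f y - u1 y * F y" for y
  define H2 where "H2 y = P2 y * f y - u2 y * F y" for y
  have H1: "(H1 has_real_derivative u1 y * \<phi> y) (at y)" if "0 < y" for y
  proof -
    have "(H1 has_real_derivative (1 / h * m y * u1 y * f y + P1 y * (F y / q y))
       - (P1 y / q y * F y + u1 y * (m y * g y))) (at y)"
      unfolding H1_def[abs_def]
      by (rule derivative_eq_intros P1_deriv u1_deriv that T[THEN conjunct2, THEN conjunct2, THEN conjunct1, rule_format]
         T[THEN conjunct2, THEN conjunct2, THEN conjunct2, THEN conjunct1, rule_format] refl)+ (simp add: algebra_simps)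
    then show ?thesis by (simp add: \<phi>_def algebra_simps)
  qed
  have H2: "(H2 has_real_derivative u2 y * \<phi> y) (at y)" if "0 < y" for y
  proof -
    have "(H2 has_real_derivative (1 / h * m y * u2 y * f y + P2 y * (F y / q y))
       - (P2 y / q y * F y + u2 y * (m y * g y))) (at y)"
      unfolding H2_def[abs_def]
      by (rule derivative_eq_intros P2_deriv u2_deriv that T[THEN conjunct2, THEN conjunct2, THEN conjunct1, rule_format]
         T[THEN conjunct2, THEN conjunct2, THEN conjunct2, THEN conjunct1, rule_format] refl)+ (simp add: algebra_simps)
    then show ?thesis by (simp add: \<phi>_def algebra_simps)
  qed
  have cont: "continuous_on {x..y} f" "continuous_on {x..y} F" if "0 \<le> x" for x y
    using T that by (auto intro: continuous_on_subset)
  have u1i: "set_integrable lborel {0..s} (\<lambda>y. u1 y * \<phi> y)"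
  proof (rule set_integrable_bounded_mult)
    show "\<bar>u1 y\<bar> \<le> u1 s" if "y \<in> {0..s}" for y using u1_mono[of y s] u1_pos[of y] that by auto
    show "set_integrable lborel {0..s} \<phi>" by (rule set_integrable_subset[OF \<phi>]) auto
  qed auto
  have u2i: "set_integrable lborel {s..} (\<lambda>y. u2 y * \<phi> y)"
  proof (rule set_integrable_bounded_mult)
    show "\<bar>u2 y\<bar> \<le> u2 s" if "y \<in> {s..}" for y using u2_antimono[of s y] u2_pos[of y] that s by auto
    show "set_integrable lborel {s..} \<phi>" by (rule set_integrable_subset[OF \<phi>]) (use s in auto)
  qed auto
  have I1: "(LBINT y:{0..s}. u1 y * \<phi> y) = H1 s - H1 0"
  proof -
    have "((\<lambda>y. u1 y * \<phi> y) has_integral (H1 s - H1 0)) {0..s}"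
      by (rule fundamental_theorem_of_calculus_interior)
        (use s in \<open>auto simp: H1_def[abs_def] has_real_derivative_iff_has_vector_derivative[symmetric]
           intro!: continuous_intros cont u1_cont P1_cont H1[unfolded H1_def[abs_def]]\<close>)
    then show ?thesis using set_borel_integral_eq_integral(2)[OF u1i] by (simp add: integral_unique)
  qed
  have I2b: "(LBINT y:{s..b}. u2 y * \<phi> y) = H2 b - H2 s" if "s \<le> b" for b
  proof -
    have "((\<lambda>y. u2 y * \<phi> y) has_integral (H2 b - H2 s)) {s..b}"
      by (rule fundamental_theorem_of_calculus_interior)
        (use s that in \<open>auto simp: H2_def[abs_def] has_real_derivative_iff_has_vector_derivative[symmetric]
           intro!: continuous_intros cont u2_cont P2_cont H2[unfolded H2_def[abs_def]]\<close>)
    moreover have "set_integrable lborel {s..b} (\<lambda>y. u2 y * \<phi> y)"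
      by (rule set_integrable_subset[OF u2i]) auto
    ultimately show ?thesis by (simp add: set_borel_integral_eq_integral(2) integral_unique)
  qed
  have H2lim: "(H2 \<longlongrightarrow> 0) at_top"
  proof -
    have "((\<lambda>y. u2 y * F y) \<longlongrightarrow> 0) at_top"
    proof (rule Lim_null_comparison)
      show "eventually (\<lambda>y. norm (u2 y * F y) \<le> u2 0 * \<bar>F y\<bar>) at_top"
        using eventually_ge_at_top[of 0]
        by eventually_elim (use u2_antimono[of 0] u2_pos in \<open>auto simp: abs_mult less_imp_le intro!: mult_right_mono\<close>)
      have "((\<lambda>y. u2 0 * \<bar>F y\<bar>) \<longlongrightarrow> u2 0 * \<bar>0\<bar>) at_top" by (intro tendsto_intros) (use T in auto)
      then show "((\<lambda>y. u2 0 * \<bar>F y\<bar>) \<longlongrightarrow> 0) at_top" by simp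
    qed
    then have "((\<lambda>y. P2 y * f y - u2 y * F y) \<longlongrightarrow> 0 - 0) at_top" by (intro tendsto_diff) (use T in auto)
    then show ?thesis by (simp add: H2_def[abs_def])
  qed
  have I2: "(LBINT y:{s..}. u2 y * \<phi> y) = - H2 s"
  proof -
    have "((\<lambda>b. LBINT y:{s..b}. u2 y * \<phi> y) \<longlongrightarrow> (LBINT y:{s..}. u2 y * \<phi> y)) at_top"
      by (rule tendsto_set_lebesgue_integral_at_top) (use u2i in auto)
    moreover have "((\<lambda>b. LBINT y:{s..b}. u2 y * \<phi> y) \<longlongrightarrow> 0 - H2 s) at_top"
    proof (rule Lim_transform_eventually)
      show "((\<lambda>b. H2 b - H2 s) \<longlongrightarrow> 0 - H2 s) at_top" by (intro tendsto_intros H2lim)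
      show "eventually (\<lambda>b. H2 b - H2 s = (LBINT y:{s..b}. u2 y * \<phi> y)) at_top"
        using eventually_ge_at_top[of s] by eventually_elim (simp add: I2b)
    qed
    ultimately have "(LBINT y:{s..}. u2 y * \<phi> y) = 0 - H2 s"
      by (rule tendsto_unique[OF trivial_limit_at_top_linorder])
    then show ?thesis by simp
  qed
  define G where "G y = u1 (min s y) * u2 (max s y) / Wr" for y
  have Gi: "set_integrable lborel {0..} (\<lambda>y. G y * \<phi> y)"
  proof (rule set_integrable_bounded_mult[OF _ _ _ \<phi>])
    show "\<bar>G y\<bar> \<le> u1 s * u2 s / Wr" if "y \<in> {0..}" for y
      using G_bound[OF s, of y] that by (simp add: G_def)
  qed (auto simp: G_def)
  have f_adm: "adm f" using T by (auto simp: adm_def intro: borel_measurable_halfline_continuous)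
  have "(LBINT y:{0..}. r s y * f y) - h * (LBINT y:{0..}. r s y * g y)
     = (LBINT y:{0..}. r s y * f y - h * (r s y * g y))"
    by (subst set_integral_diff) (use T in \<open>auto intro!: r_integrable s\<close>)
  also have "\<dots> = (LBINT y:{0..}. G y * \<phi> y)"
    by (rule set_lebesgue_integral_cong) (use h in \<open>auto simp: r_eq G_def \<phi>_def divide_simps algebra_simps\<close>)
  also have un: "{0..} = {0..s} \<union> {s..}" using s by auto
  also have "(LBINT y:{0..s} \<union> {s..}. G y * \<phi> y) = (LBINT y:{0..s}. G y * \<phi> y) + (LBINT y:{s..}. G y * \<phi> y)"
  proof (rule set_integral_Un_AE)
    have "AE y in lborel. y \<noteq> s" by (rule AE_lborel_singleton)
    then show "AE y in lborel. \<not> (y \<in> {0..s} \<and> y \<in> {s..})" by eventually_elim auto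
  qed (use s in \<open>auto intro!: set_integrable_subset[OF Gi]\<close>)
  also have "(LBINT y:{0..s}. G y * \<phi> y) = (LBINT y:{0..s}. u2 s / Wr * (u1 y * \<phi> y))"
    by (rule set_lebesgue_integral_cong) (auto simp: G_def min_def max_def)
  also have "\<dots> = u2 s / Wr * (H1 s - H1 0)" using I1 by simp
  also have "(LBINT y:{s..}. G y * \<phi> y) = (LBINT y:{s..}. u1 s / Wr * (u2 y * \<phi> y))"
    by (rule set_lebesgue_integral_cong) (auto simp: G_def min_def max_def)
  also have "\<dots> = u1 s / Wr * (- H2 s)" using I2 by simp
  also have "u2 s / Wr * (H1 s - H1 0) + u1 s / Wr * (- H2 s)
     = (P1 s * u2 s - u1 s * P2 s) / Wr * f s - u2 s * H1 0 / Wr"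
    by (simp add: H1_def H2_def diff_divide_distrib algebra_simps)
  also have "\<dots> = f s - u2 s * H1 0 / Wr" using wronskian[of s] Wr_pos by simp
  \<comment> \<open>Stickiness enters here: \<open>H1 0\<close> is P1 0 f 0 - u1 0 F 0 with u1 0 = h
    \<mu> P1 0.\<close>
  also have "u2 s * H1 0 / Wr = \<rho> s * f 0 - h * \<mu> * F 0 * \<rho> s"
    using Wr_pos by (simp add: H1_def P1_0 u1_0 \<rho>_def field_simps)
  finally show ?thesis using integral_R[OF s f_adm] unfolding un[symmetric] by simp
qed

end

section \<open>Moments and test functions\<close>

lemma set_integrable_exp_minus: "set_integrable lborel {0..} (\<lambda>y::real. exp (- y))"
  unfolding set_integrable_def
proof (rule integrableI_nonneg)
  have "(\<integral>\<^sup>+y. ennreal (indicator {0..} y *\<^sub>R exp (- y)) \<partial>lborel)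
      = (\<integral>\<^sup>+y. ennreal (y ^ 0 * exp (- y)) * indicator {0..} y \<partial>lborel)"
    by (rule nn_integral_cong) (auto simp: indicator_def)
  then show "(\<integral>\<^sup>+y. ennreal (indicator {0..} y *\<^sub>R exp (- y :: real)) \<partial>lborel) < \<infinity>"
    unfolding nn_intergal_power_times_exp_Ici by simp
qed auto

text \<open>Degree 6 covers a function of growth 1 + y^4 multiplied by the weight y^(\<delta>-1),
  which is at most 1 + y; see \<open>poly4_6\<close>.\<close>

lemma poly_gauss_le_exp:
  fixes k :: real
  assumes k: "0 < k"
  shows "\<exists>K. \<forall>y\<ge>0. (1 + y ^ 6) * exp (- (k * y\<^sup>2)) \<le> K * exp (- y)"
proof -
  let ?f = "\<lambda>y::real. (1 + y ^ 6) * exp (y - k * y\<^sup>2)"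
  have "(?f \<longlongrightarrow> 0) at_top" using k by real_asymp
  then have "eventually (\<lambda>y. ?f y < 1) at_top" by (rule order_tendstoD) simp
  then obtain Y where Y: "\<And>y. y \<ge> Y \<Longrightarrow> ?f y < 1" by (auto simp: eventually_at_top_linorder)
  have "compact (?f ` {0..max 0 Y})" by (intro compact_continuous_image continuous_intros) auto
  then have "bounded (?f ` {0..max 0 Y})" by (rule compact_imp_bounded)
  then obtain b where "\<forall>x \<in> ?f ` {0..max 0 Y}. norm x \<le> b" unfolding bounded_iff by (elim exE)
  then have b: "norm (?f y) \<le> b" if "y \<in> {0..max 0 Y}" for y using imageI[OF that, of ?f] by (rule bspec)
  have "?f y \<le> max 1 b" if "0 \<le> y" for y
  proof (cases "y \<le> max 0 Y")
    case True
    with that have "y \<in> {0..max 0 Y}" by simp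
    then have "\<bar>?f y\<bar> \<le> b" using b[of y] by (simp only: real_norm_def)
    then show ?thesis by linarith
  next
    case False
    then have "Y \<le> y" by simp
    from Y[OF this] show ?thesis by linarith
  qed
  then have "?f y * exp (- y) \<le> max 1 b * exp (- y)" if "0 \<le> y" for y
    using that by (intro mult_right_mono) auto
  moreover have "?f y * exp (- y) = (1 + y ^ 6) * exp (- (k * y\<^sup>2))" for y
  proof -
    have "exp (y - k * y\<^sup>2) * exp (- y) = exp (- (k * y\<^sup>2))" by (simp add: exp_add[symmetric])
    then show ?thesis by (simp only: mult.assoc)
  qed
  ultimately have "(1 + y ^ 6) * exp (- (k * y\<^sup>2)) \<le> max 1 b * exp (- y)" if "0 \<le> y" for y
    using that by (simp only:)
  then show ?thesis by blast
qed

lemma poly4_6: "0 \<le> (y::real) \<Longrightarrow> (1 + y) * (1 + y ^ 4) \<le> 4 * (1 + y ^ 6)"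
proof -
  assume y: "0 \<le> y"
  have *: "y ^ k \<le> 1 + y ^ 6" if "k \<le> 6" for k
  proof (cases "y \<le> 1")
    case True
    then have "y ^ k \<le> 1" using y by (simp add: power_le_one)
    then show ?thesis using y zero_le_power[OF y, of 6] by linarith
  next
    case False
    then have "y ^ k \<le> y ^ 6" using that by (intro power_increasing) auto
    then show ?thesis by simp
  qed
  have e: "(1 + y) * (1 + y ^ 4) = 1 + y ^ 1 + y ^ 4 + y ^ 5" by (simp add: algebra_simps eval_nat_numeral)
  moreover have "y ^ 1 \<le> 1 + y ^ 6" "y ^ 4 \<le> 1 + y ^ 6" "y ^ 5 \<le> 1 + y ^ 6" by (rule *; simp)+
  ultimately have "1 + y ^ 1 + y ^ 4 + y ^ 5 \<le> 4 + 4 * y ^ 6"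
    using zero_le_power[OF y, of 6] by linarith
  with e show ?thesis by simp
qed

text \<open>The primitive of \<open>dscale_fn\<close> that vanishes at 0, after one integration by
  parts: y^(1-\<delta>) is singular at 0, whereas y^(2-\<delta>) is continuous there, so the
  fundamental theorem applies on closed intervals.\<close>

definition scale_fn :: "real \<Rightarrow> real \<Rightarrow> real \<Rightarrow> real" where
  "scale_fn \<delta> B x = (x powr (2 - \<delta>) * exp (- (B * x))
     + B * integral {0..x} (\<lambda>y. y powr (2 - \<delta>) * exp (- (B * y)))) / (2 - \<delta>)"

definition dscale_fn :: "real \<Rightarrow> real \<Rightarrow> real \<Rightarrow> real" where
  "dscale_fn \<delta> B x = x powr (1 - \<delta>) * exp (- (B * x))"

lemma scale_fn_0: "scale_fn \<delta> B 0 = 0"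
  by (simp add: scale_fn_def)

context
  fixes \<delta> B :: real
  assumes \<delta>: "1 < \<delta>" "\<delta> < 2" and B: "0 \<le> B"
begin

lemma scale_fn_integrand_cont: "continuous_on {0..} (\<lambda>y. y powr (2 - \<delta>) * exp (- (B * y)))"
  using \<delta> by (intro continuous_intros continuous_on_powr') auto

lemma scale_fn_integral_deriv:
  assumes "0 \<le> x" "x \<le> b"
  shows "((\<lambda>x. integral {0..x} (\<lambda>y. y powr (2 - \<delta>) * exp (- (B * y)))) has_real_derivative
    x powr (2 - \<delta>) * exp (- (B * x))) (at x within {0..b})"
  by (rule integral_has_real_derivative) (use assms in \<open>auto intro: continuous_on_subset[OF scale_fn_integrand_cont]\<close>)

lemma scale_fn_cont: "continuous_on {0..} (scale_fn \<delta> B)"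
proof -
  have "continuous_on {0..b} (scale_fn \<delta> B)" for b
    unfolding scale_fn_def[abs_def]
    by (intro continuous_intros continuous_on_divide continuous_on_add continuous_on_mult
        continuous_on_subset[OF scale_fn_integrand_cont] DERIV_continuous_on[OF scale_fn_integral_deriv])
      (use \<delta> in auto)
  note c = this
  show ?thesis
    unfolding continuous_on_eq_continuous_within
  proof
    fix x :: real assume x: "x \<in> {0..}"
    have "continuous (at x within {0..x+1}) (scale_fn \<delta> B)"
      using c[of "x + 1"] x by (auto simp: continuous_on_eq_continuous_within)
    moreover have "at x within {0..x+1} = at x within {0..}"
      by (rule at_within_nhd[of _ "{..<x+1}"]) auto
    ultimately show "continuous (at x within {0..}) (scale_fn \<delta> B)" by simp
  qed
qed

lemma scale_fn_deriv:
  assumes x: "0 < x"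
  shows "(scale_fn \<delta> B has_real_derivative dscale_fn \<delta> B x) (at x)"
proof -
  have "at x within {0..x+1} = at x" using x by (intro at_within_Icc_at) auto
  then have I: "((\<lambda>x. integral {0..x} (\<lambda>y. y powr (2 - \<delta>) * exp (- (B * y)))) has_real_derivative
    x powr (2 - \<delta>) * exp (- (B * x))) (at x)"
    using scale_fn_integral_deriv[of x "x + 1"] x by simp
  have "(scale_fn \<delta> B has_real_derivative
    ((2 - \<delta>) * x powr (2 - \<delta> - 1) * exp (- (B * x)) + x powr (2 - \<delta>) * (exp (- (B * x)) * - B)
     + B * (x powr (2 - \<delta>) * exp (- (B * x)))) / (2 - \<delta>)) (at x)"
    unfolding scale_fn_def[abs_def] using x \<delta>
    by (intro DERIV_cdivide DERIV_add DERIV_cmult I) (auto intro!: derivative_eq_intros)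
  then show ?thesis using \<delta> by (simp add: dscale_fn_def)
qed

lemma dscale_fn_pos: "0 < x \<Longrightarrow> 0 < dscale_fn \<delta> B x"
  by (simp add: dscale_fn_def)

lemma dscale_fn_antimono: "0 < x \<Longrightarrow> x \<le> y \<Longrightarrow> dscale_fn \<delta> B y \<le> dscale_fn \<delta> B x"
  unfolding dscale_fn_def using \<delta> B by (intro mult_mono) (auto intro!: powr_mono2' mult_left_mono)

lemma scale_fn_mono: assumes a: "0 \<le> x" "x \<le> y" shows "scale_fn \<delta> B x \<le> scale_fn \<delta> B y"
proof (rule DERIV_nonneg_imp_increasing_open[OF a(2)])
  show "\<exists>D. (scale_fn \<delta> B has_real_derivative D) (at z) \<and> 0 \<le> D" if "x < z" "z < y" for z
    using scale_fn_deriv[of z] dscale_fn_pos[of z] a that by (intro exI[of _ "dscale_fn \<delta> B z"]) auto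
  show "continuous_on {x..y} (scale_fn \<delta> B)" by (rule continuous_on_subset[OF scale_fn_cont]) (use a in auto)
qed

lemma scale_fn_nonneg: "0 \<le> x \<Longrightarrow> 0 \<le> scale_fn \<delta> B x"
  using scale_fn_mono[of 0 x] by (simp add: scale_fn_0)

text \<open>The derivatives compare because exp (- B x) \<le> 1; the bound is uniform in B.\<close>

lemma scale_fn_le: "0 \<le> x \<Longrightarrow> scale_fn \<delta> B x \<le> x powr (2 - \<delta>) / (2 - \<delta>)"
proof -
  assume x: "0 \<le> x"
  have "(\<lambda>x. x powr (2 - \<delta>) / (2 - \<delta>) - scale_fn \<delta> B x) 0 \<le> (\<lambda>x. x powr (2 - \<delta>) / (2 - \<delta>) - scale_fn \<delta> B x) x"
  proof (rule DERIV_nonneg_imp_increasing_open[OF x])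
    fix y assume y: "0 < y" "y < x"
    have "((\<lambda>x. x powr (2 - \<delta>) / (2 - \<delta>) - scale_fn \<delta> B x) has_real_derivative
       ((2 - \<delta>) * y powr (2 - \<delta> - 1)) / (2 - \<delta>) - dscale_fn \<delta> B y) (at y)"
      using y by (intro DERIV_diff DERIV_cdivide scale_fn_deriv has_real_derivative_powr) auto
    moreover have "dscale_fn \<delta> B y \<le> y powr (1 - \<delta>) * 1"
      unfolding dscale_fn_def using B y by (intro mult_left_mono) auto
    ultimately show "\<exists>D. ((\<lambda>x. x powr (2 - \<delta>) / (2 - \<delta>) - scale_fn \<delta> B x) has_real_derivative D) (at y) \<and> 0 \<le> D"
      using \<delta> by (intro exI conjI) auto
  next
    show "continuous_on {0..x} (\<lambda>x. x powr (2 - \<delta>) / (2 - \<delta>) - scale_fn \<delta> B x)"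
      using \<delta> by (intro continuous_intros continuous_on_powr' continuous_on_subset[OF scale_fn_cont]) auto
  qed
  then show ?thesis by (simp add: scale_fn_0)
qed

text \<open>Concavity: the graph lies below its tangent at the left end point.\<close>

lemma scale_fn_increment: "0 < x \<Longrightarrow> x \<le> y \<Longrightarrow> scale_fn \<delta> B y - scale_fn \<delta> B x \<le> (y - x) * dscale_fn \<delta> B x"
proof -
  assume a: "0 < x" "x \<le> y"
  have "(\<lambda>t. t * dscale_fn \<delta> B x - scale_fn \<delta> B t) x \<le> (\<lambda>t. t * dscale_fn \<delta> B x - scale_fn \<delta> B t) y"
  proof (rule DERIV_nonneg_imp_nondecreasing[OF a(2)])
    fix t assume t: "x \<le> t" "t \<le> y"
    have "((\<lambda>t. t * dscale_fn \<delta> B x - scale_fn \<delta> B t) has_real_derivative (1 * dscale_fn \<delta> B x - dscale_fn \<delta> B t)) (at t)"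
      by (intro DERIV_diff scale_fn_deriv DERIV_cmult_right DERIV_ident) (use t a in auto)
    then show "\<exists>D. ((\<lambda>t. t * dscale_fn \<delta> B x - scale_fn \<delta> B t) has_real_derivative D) (at t) \<and> 0 \<le> D"
      using dscale_fn_antimono[of x t] a t by (intro exI conjI) auto
  qed
  then show ?thesis by (simp add: algebra_simps)
qed

text \<open>In the variable \<open>y\<^sup>2\<close> the function \<open>dscale_fn\<close> is log-convex; this is its tangent line at \<open>t\<^sup>2\<close>.\<close>

lemma dscale_fn_tangent:
  assumes y: "0 < y" and t: "0 < t"
  shows "dscale_fn \<delta> B t * (1 - (\<delta> - 1 + B * t) / 2 * (y\<^sup>2 / t\<^sup>2 - 1)) \<le> dscale_fn \<delta> B y"
proof -
  have l: "ln (y / t) \<le> (y\<^sup>2 / t\<^sup>2 - 1) / 2"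
  proof -
    have "2 * ln (y / t) = ln ((y / t)\<^sup>2)" using y t by (simp add: ln_realpow)
    also have "\<dots> \<le> (y / t)\<^sup>2 - 1" using y t by (intro ln_le_minus_one) auto
    finally show ?thesis by (simp add: power_divide)
  qed
  \<comment> \<open>2 y t \<le> y^2 + t^2 trades the linear exponent for one in y^2.\<close>
  have d: "y - t \<le> t * (y\<^sup>2 / t\<^sup>2 - 1) / 2"
  proof -
    have "2 * y * t \<le> y\<^sup>2 + t\<^sup>2" by (rule sum_squares_bound)
    then have "(2 * y * t) / t \<le> (y\<^sup>2 + t\<^sup>2) / t" using t by (intro divide_right_mono) auto
    then have "2 * y \<le> y\<^sup>2 / t + t" using t by (simp add: add_divide_distrib power2_eq_square)
    moreover have e: "t * (y\<^sup>2 / t\<^sup>2 - 1) = y\<^sup>2 / t - t" using t by (simp add: right_diff_distrib power2_eq_square)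
    moreover have "2 * v \<le> w + u \<Longrightarrow> v - u \<le> (w - u) / 2" for u v w :: real by (simp add: field_simps)
    ultimately show ?thesis unfolding e by blast
  qed
  define e where "e = - (\<delta> - 1) * ln (y / t) - B * (y - t)"
  have "1 - (\<delta> - 1 + B * t) / 2 * (y\<^sup>2 / t\<^sup>2 - 1) \<le> 1 + e"
  proof -
    have "(\<delta> - 1) * ln (y / t) \<le> (\<delta> - 1) * ((y\<^sup>2 / t\<^sup>2 - 1) / 2)" using l \<delta> by (intro mult_left_mono) auto
    moreover have "B * (y - t) \<le> B * (t * (y\<^sup>2 / t\<^sup>2 - 1) / 2)" using d B by (intro mult_left_mono) auto
    moreover have "(\<delta> - 1 + B * t) / 2 * w = (\<delta> - 1) * (w / 2) + B * (t * w / 2)" for w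
      by (simp add: field_simps)
    moreover have "u * l \<le> u * (w / 2) \<Longrightarrow> v \<le> v' \<Longrightarrow> 1 - (u * (w / 2) + v') \<le> 1 + (- u * l - v)" for u l v v' w :: real
      by simp
    ultimately show ?thesis unfolding e_def by presburger
  qed
  also have "\<dots> \<le> exp e" by (rule exp_ge_add_one_self)
  finally have "dscale_fn \<delta> B t * (1 - (\<delta> - 1 + B * t) / 2 * (y\<^sup>2 / t\<^sup>2 - 1)) \<le> dscale_fn \<delta> B t * exp e"
    using dscale_fn_pos[OF t] by (intro mult_left_mono) auto
  also have "\<dots> = dscale_fn \<delta> B y"
  proof -
    have "exp e = exp ((1 - \<delta>) * ln y) / exp ((1 - \<delta>) * ln t) * (exp (- (B * y)) / exp (- (B * t)))"
      using y t by (simp add: e_def ln_div exp_add[symmetric] exp_diff[symmetric] algebra_simps)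
    then show ?thesis using y t by (simp add: dscale_fn_def powr_def)
  qed
  finally show ?thesis .
qed

end

section \<open>Test functions for the resolvent identity\<close>

context sticky
begin

lemma powr_delta_le: "0 \<le> y \<Longrightarrow> y powr (\<delta> - 1) \<le> 1 + y"
proof (cases "y \<le> 1")
  case True
  assume "0 \<le> y"
  then have "y powr (\<delta> - 1) \<le> 1 powr (\<delta> - 1)" using True delta by (intro powr_mono2) auto
  then show ?thesis using \<open>0 \<le> y\<close> by simp
next
  case False
  then have "y powr (\<delta> - 1) \<le> y powr 1" using delta by (intro powr_mono) auto
  then show ?thesis using False by simp
qed

lemma m_integrable:
  assumes \<phi>: "continuous_on {0<..} \<phi>" and C: "\<And>y. 0 < y \<Longrightarrow> y powr (\<delta> - 1) * \<bar>\<phi> y\<bar> \<le> C * (1 + y ^ 6)"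
  shows "set_integrable lborel {0..} (\<lambda>y. m y * \<phi> y)"
proof -
  obtain K where K: "\<And>y. 0 \<le> y \<Longrightarrow> (1 + y ^ 6) * exp (- (lam * \<beta> / 2 * y\<^sup>2)) \<le> K * exp (- y)"
    using poly_gauss_le_exp[of "lam * \<beta> / 2"] lam beta by auto
  have b: "\<bar>m y * \<phi> y\<bar> \<le> \<bar>\<beta> * \<bar>C\<bar> * K * exp (- y)\<bar>" if y: "0 < y" for y
  proof -
    have "\<bar>m y * \<phi> y\<bar> = \<beta> * exp (- z y) * (y powr (\<delta> - 1) * \<bar>\<phi> y\<bar>)"
      using beta by (simp add: m_eq q_def abs_mult)
    also have "\<dots> \<le> \<beta> * exp (- z y) * (\<bar>C\<bar> * (1 + y ^ 6))"
    proof (intro mult_left_mono)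
      have "0 \<le> 1 + y ^ 6" using y by simp
      then have "C * (1 + y ^ 6) \<le> \<bar>C\<bar> * (1 + y ^ 6)" by (intro mult_right_mono) auto
      with C[OF y] show "y powr (\<delta> - 1) * \<bar>\<phi> y\<bar> \<le> \<bar>C\<bar> * (1 + y ^ 6)" by linarith
    qed (use beta in auto)
    also have "\<dots> = \<beta> * \<bar>C\<bar> * ((1 + y ^ 6) * exp (- (lam * \<beta> / 2 * y\<^sup>2)))"
      by (simp add: z_def cir_z_def)
    also have "\<dots> \<le> \<beta> * \<bar>C\<bar> * (K * exp (- y))"
      using K[of y] y beta by (intro mult_left_mono) auto
    finally show ?thesis by (simp add: mult.assoc)
  qed
  have "set_integrable lborel {0<..} (\<lambda>y. m y * \<phi> y)"
  proof (rule set_integrable_bound)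
    have "set_integrable lborel {0<..} (\<lambda>y::real. exp (- y))"
      by (rule set_integrable_subset[OF set_integrable_exp_minus]) auto
    then show "set_integrable lborel {0<..} (\<lambda>y. \<beta> * \<bar>C\<bar> * K * exp (- y))" by simp
    have "continuous_on {0<..} (\<lambda>y. m y * \<phi> y)"
      unfolding m_eq q_def by (intro continuous_intros \<phi>) auto
    then show "set_borel_measurable lborel {0<..} (\<lambda>y. m y * \<phi> y)"
      unfolding set_borel_measurable_def
      using borel_measurable_continuous_on_indicator[of "{0<..}" "\<lambda>y. m y * \<phi> y"] by simp
    show "AE y in lborel. y \<in> {0<..} \<longrightarrow> norm (m y * \<phi> y) \<le> norm (\<beta> * \<bar>C\<bar> * K * exp (- y))"
      using b by auto
  qed
  \<comment> \<open>As \<delta> > 1, the integrand vanishes at 0 whatever \<phi> 0 is, and the open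
    half-line can be exchanged for the closed one.\<close>
  moreover have "m 0 = 0" using delta by (simp add: m_eq q_def)
  moreover have "(\<lambda>y. indicator {0<..} y *\<^sub>R (m y * \<phi> y)) = (\<lambda>y. indicator {0..} y *\<^sub>R (m y * \<phi> y))"
    using \<open>m 0 = 0\<close> by (auto simp: indicator_def fun_eq_iff)
  ultimately show ?thesis unfolding set_integrable_def by simp
qed

lemma m_integrable4:
  assumes \<phi>: "continuous_on {0<..} \<phi>" and C: "\<And>y. 0 < y \<Longrightarrow> \<bar>\<phi> y\<bar> \<le> C * (1 + y ^ 4)"
  shows "set_integrable lborel {0..} (\<lambda>y. m y * \<phi> y)"
proof (rule m_integrable[OF \<phi>])
  fix y :: real assume y: "0 < y"
  have C0: "0 \<le> C * (1 + y ^ 4)" using C[OF y] by linarith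
  have "0 < 1 + y ^ 4" using y by (simp add: add_pos_pos)
  with C0 have "0 \<le> C" by (simp add: zero_le_mult_iff)
  have "y powr (\<delta> - 1) * \<bar>\<phi> y\<bar> \<le> (1 + y) * (C * (1 + y ^ 4))"
    using powr_delta_le[of y] y C[OF y] C0 by (intro mult_mono) auto
  also have "\<dots> = C * ((1 + y) * (1 + y ^ 4))" by simp
  also have "\<dots> \<le> C * (4 * (1 + y ^ 6))" by (intro mult_left_mono poly4_6) (use y \<open>0 \<le> C\<close> in auto)
  finally show "y powr (\<delta> - 1) * \<bar>\<phi> y\<bar> \<le> (4 * C) * (1 + y ^ 6)" by (simp only: mult_ac)
qed

text \<open>Growth bounds replace the integrability conditions. The boundary term
  \<open>P2 x * f x\<close> is Gaussian times a polynomial by \<open>PU_lower\<close>.\<close>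

lemma test_funI:
  assumes f: "continuous_on {0..} f" and F: "continuous_on {0..} F" and g: "continuous_on {0<..} g"
    and f': "\<And>x. 0 < x \<Longrightarrow> (f has_real_derivative F x / q x) (at x)"
    and F': "\<And>x. 0 < x \<Longrightarrow> (F has_real_derivative m x * g x) (at x)"
    and C: "\<And>y. 0 < y \<Longrightarrow> \<bar>f y\<bar> \<le> C * (1 + y ^ 4)"
    and D: "\<And>y. 0 < y \<Longrightarrow> y powr (\<delta> - 1) * \<bar>g y\<bar> \<le> D * (1 + y ^ 6)"
    and lim: "(F \<longlongrightarrow> 0) at_top"
  shows "test_fun f F g"
  unfolding test_fun_def
proof (intro conjI allI impI)
  show "set_integrable lborel {0..} (\<lambda>y. m y * f y)"
    by (rule m_integrable4[OF _ C]) (auto intro: continuous_on_subset[OF f])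
  show "set_integrable lborel {0..} (\<lambda>y. m y * g y)"
    by (rule m_integrable[OF g D])
  show "((\<lambda>x. P2 x * f x) \<longlongrightarrow> 0) at_top"
  proof (rule Lim_null_comparison)
    define k where "k = lam * \<beta> / 2"
    have k: "0 < k" using lam beta by (simp add: k_def)
    have "filterlim (\<lambda>x. k * x\<^sup>2) at_top at_top" using k by real_asymp
    then have "eventually (\<lambda>x. 1 \<le> k * x\<^sup>2) at_top" by (simp add: filterlim_at_top)
    then show "eventually (\<lambda>x. norm (P2 x * f x) \<le> (\<kappa> * a * A * C) * ((1 + x ^ 4) * exp (- (k * x\<^sup>2)))) at_top"
      using eventually_gt_at_top[of 0]
    proof eventually_elim
      case (elim x)
      have zx: "z x = k * x\<^sup>2" by (simp add: z_def cir_z_def k_def)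
      have "\<bar>PU (z x)\<bar> \<le> a * A * exp (- z x)"
        using PU_lower[of "z x"] PU_nonpos[OF z_nonneg, of x] elim zx by linarith
      then have "\<bar>P2 x\<bar> \<le> \<kappa> * (a * A * exp (- z x))"
        using kappa_pos by (simp add: P2_def abs_mult mult_left_mono)
      then have "\<bar>P2 x\<bar> * \<bar>f x\<bar> \<le> \<kappa> * (a * A * exp (- z x)) * (C * (1 + x ^ 4))"
        using C[of x] elim by (intro mult_mono) auto
      then show ?case by (simp add: abs_mult zx mult_ac)
    qed
    have "((\<lambda>x. (1 + x ^ 4) * exp (- (k * x\<^sup>2))) \<longlongrightarrow> 0) at_top" using k by real_asymp
    then have "((\<lambda>x. (\<kappa> * a * A * C) * ((1 + x ^ 4) * exp (- (k * x\<^sup>2)))) \<longlongrightarrow> (\<kappa> * a * A * C) * 0) at_top"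
      by (rule tendsto_mult_left)
    then show "((\<lambda>x. (\<kappa> * a * A * C) * ((1 + x ^ 4) * exp (- (k * x\<^sup>2)))) \<longlongrightarrow> 0) at_top" by simp
  qed
qed (use assms in auto)

lemma test_one: "test_fun (\<lambda>_. 1) (\<lambda>_. 0) (\<lambda>_. 0)"
  by (rule test_funI[where C = 1 and D = 0]) auto

lemma q_deriv_powr:
  assumes x: "0 < x"
  shows "((\<lambda>x. x powr k * exp (- z x)) has_real_derivative
     m x * ((k / \<beta>) * x powr (k - \<delta>) - lam * x powr (k + 2 - \<delta>))) (at x)"
proof -
  have "((\<lambda>x. x powr k * exp (- z x)) has_real_derivative
     k * x powr (k - 1) * exp (- z x) + x powr k * (exp (- z x) * - (lam * \<beta> * x))) (at x)"
    using x by (auto intro!: derivative_eq_intros z_deriv)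
  moreover have "k * x powr (k - 1) * exp (- z x) + x powr k * (exp (- z x) * - (lam * \<beta> * x))
     = m x * ((k / \<beta>) * x powr (k - \<delta>) - lam * x powr (k + 2 - \<delta>))"
  proof -
    have 1: "x powr (k - 1) = x powr (\<delta> - 1) * x powr (k - \<delta>)" by (simp add: powr_add[symmetric])
    have 2: "x powr k * x = x powr (\<delta> - 1) * x powr (k + 2 - \<delta>)"
    proof -
      have "x powr k * x powr 1 = x powr (\<delta> - 1) * x powr (k + 2 - \<delta>)"
        unfolding powr_add[symmetric] by (rule arg_cong[of _ _ "\<lambda>t. x powr t"]) simp
      then show ?thesis using x by simp
    qed
    have 3: "x powr k * (exp (- z x) * - (lam * \<beta> * x)) = - (exp (- z x) * lam * \<beta> * (x powr k * x))" by simp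
    show ?thesis unfolding 3 1 2 using beta by (simp add: m_eq q_def field_simps)
  qed
  ultimately show ?thesis by simp
qed

lemma exp_z_lim: "((\<lambda>x. x powr k * exp (- z x)) \<longlongrightarrow> 0) at_top"
proof -
  define c where "c = lam * \<beta> / 2"
  have "0 < c" using lam beta by (simp add: c_def)
  then have "((\<lambda>x. x powr k * exp (- (c * x\<^sup>2))) \<longlongrightarrow> 0) at_top" by real_asymp
  then show ?thesis by (simp add: z_def cir_z_def c_def)
qed

lemma powr_exp_z_cont: "0 < k \<Longrightarrow> continuous_on {0..} (\<lambda>x. x powr k * exp (- z x))"
  by (intro continuous_intros continuous_on_powr') auto

text \<open>The generator maps x^2 into the span of 1 and x^2 and the flux vanishes at 0, so the
  second moment will solve a linear equation.\<close>

lemma test_sq: "test_fun (\<lambda>x. x\<^sup>2) (\<lambda>x. 2 * (x powr \<delta> * exp (- z x))) (\<lambda>x. 2 * \<delta> / \<beta> - 2 * lam * x\<^sup>2)"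
proof (rule test_funI[where C = 1 and D = "4 * (2 * \<delta> / \<beta> + 2 * lam)"])
  show "((\<lambda>x. x\<^sup>2) has_real_derivative 2 * (x powr \<delta> * exp (- z x)) / q x) (at x)" if "0 < x" for x
    using that by (auto intro!: derivative_eq_intros simp: q_def powr_diff)
  show "((\<lambda>x. 2 * (x powr \<delta> * exp (- z x))) has_real_derivative m x * (2 * \<delta> / \<beta> - 2 * lam * x\<^sup>2)) (at x)"
    if x: "0 < x" for x
  proof -
    have "x powr (\<delta> + 2 - \<delta>) = x\<^sup>2" using x by (simp flip: powr_numeral)
    with DERIV_cmult[OF q_deriv_powr[OF x, of \<delta>], of 2] show ?thesis using x by (simp add: algebra_simps)
  qed
  fix y :: real assume y: "0 < y"
  have le: "y\<^sup>2 \<le> 1 + y ^ 4"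
  proof -
    have "2 * y\<^sup>2 \<le> 1 + y ^ 4" using sum_squares_bound[of 1 "y\<^sup>2"] by (simp add: power_mult[symmetric])
    then show ?thesis using zero_le_power2[of y] by linarith
  qed
  show "\<bar>y\<^sup>2\<bar> \<le> 1 * (1 + y ^ 4)" using le by simp
  have d0: "0 \<le> 2 * \<delta> / \<beta>" "0 \<le> 2 * lam * y\<^sup>2" "0 \<le> y ^ 4" using delta beta lam y by auto
  have "\<bar>2 * \<delta> / \<beta> - 2 * lam * y\<^sup>2\<bar> \<le> 2 * \<delta> / \<beta> + 2 * lam * y\<^sup>2" using d0 by linarith
  also have "\<dots> \<le> 2 * \<delta> / \<beta> * (1 + y ^ 4) + 2 * lam * (1 + y ^ 4)"
  proof (rule add_mono)
    show "2 * \<delta> / \<beta> \<le> 2 * \<delta> / \<beta> * (1 + y ^ 4)" using d0 mult_left_mono[of 1 "1 + y ^ 4" "2 * \<delta> / \<beta>"] by simp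
    show "2 * lam * y\<^sup>2 \<le> 2 * lam * (1 + y ^ 4)" using le lam by (intro mult_left_mono) auto
  qed
  finally have "\<bar>2 * \<delta> / \<beta> - 2 * lam * y\<^sup>2\<bar> \<le> (2 * \<delta> / \<beta> + 2 * lam) * (1 + y ^ 4)" by (simp add: algebra_simps)
  then have "y powr (\<delta> - 1) * \<bar>2 * \<delta> / \<beta> - 2 * lam * y\<^sup>2\<bar> \<le> (1 + y) * ((2 * \<delta> / \<beta> + 2 * lam) * (1 + y ^ 4))"
    using powr_delta_le[of y] y by (intro mult_mono) auto
  also have "\<dots> = (2 * \<delta> / \<beta> + 2 * lam) * ((1 + y) * (1 + y ^ 4))" by simp
  also have "\<dots> \<le> (2 * \<delta> / \<beta> + 2 * lam) * (4 * (1 + y ^ 6))"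
    by (intro mult_left_mono poly4_6) (use y d0 lam in auto)
  finally show "y powr (\<delta> - 1) * \<bar>2 * \<delta> / \<beta> - 2 * lam * y\<^sup>2\<bar> \<le> 4 * (2 * \<delta> / \<beta> + 2 * lam) * (1 + y ^ 6)" by (simp only: mult_ac)
next
  show "((\<lambda>x. 2 * (x powr \<delta> * exp (- z x))) \<longlongrightarrow> 0) at_top"
    using tendsto_mult_left[OF exp_z_lim, of 2] by simp
  show "continuous_on {0..} (\<lambda>x. 2 * (x powr \<delta> * exp (- z x)))"
    by (intro continuous_on_mult continuous_on_const powr_exp_z_cont) (use delta in auto)
  show "continuous_on {0<..} (\<lambda>x. 2 * \<delta> / \<beta> - 2 * lam * x\<^sup>2)"
    by (intro continuous_on_diff continuous_on_mult continuous_on_const continuous_on_power continuous_on_id)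
  show "continuous_on {0..} (\<lambda>x :: real. x\<^sup>2)" by (intro continuous_on_power continuous_on_id)
qed

text \<open>Provides the fourth moment, which controls the tail in
  \<open>atom_bound\<close>.\<close>

lemma test_four: "test_fun (\<lambda>x. x ^ 4) (\<lambda>x. 4 * (x powr (\<delta> + 2) * exp (- z x)))
    (\<lambda>x. 4 * (\<delta> + 2) / \<beta> * x\<^sup>2 - 4 * lam * x ^ 4)"
proof (rule test_funI[where C = 1 and D = "4 * (4 * (\<delta> + 2) / \<beta> + 4 * lam)"])
  show "((\<lambda>x. x ^ 4) has_real_derivative 4 * (x powr (\<delta> + 2) * exp (- z x)) / q x) (at x)" if "0 < x" for x
  proof -
    have "x powr (\<delta> + 2) = x powr (\<delta> - 1) * x powr 3"
      unfolding powr_add[symmetric] by (rule arg_cong[of _ _ "\<lambda>t. x powr t"]) simp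
    then have "4 * (x powr (\<delta> + 2) * exp (- z x)) / q x = 4 * x ^ 3"
      using that by (simp add: q_def)
    then show ?thesis by (auto intro!: derivative_eq_intros)
  qed
  show "((\<lambda>x. 4 * (x powr (\<delta> + 2) * exp (- z x))) has_real_derivative m x * (4 * (\<delta> + 2) / \<beta> * x\<^sup>2 - 4 * lam * x ^ 4)) (at x)"
    if x: "0 < x" for x
  proof -
    have "x powr (\<delta> + 2 + 2 - \<delta>) = x ^ 4" "x powr (\<delta> + 2 - \<delta>) = x\<^sup>2" using x by (simp_all flip: powr_numeral)
    with DERIV_cmult[OF q_deriv_powr[OF x, of "\<delta> + 2"], of 4] show ?thesis using x by (simp add: algebra_simps)
  qed
  fix y :: real assume y: "0 < y"
  have le: "y\<^sup>2 \<le> 1 + y ^ 4"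
  proof -
    have "2 * y\<^sup>2 \<le> 1 + y ^ 4" using sum_squares_bound[of 1 "y\<^sup>2"] by (simp add: power_mult[symmetric])
    then show ?thesis using zero_le_power2[of y] by linarith
  qed
  show "\<bar>y ^ 4\<bar> \<le> 1 * (1 + y ^ 4)" using y by simp
  have d0: "0 \<le> 4 * (\<delta> + 2) / \<beta>" "0 \<le> 4 * (\<delta> + 2) / \<beta> * y\<^sup>2" "0 \<le> 4 * lam * y ^ 4" using delta beta lam y by auto
  have "\<bar>4 * (\<delta> + 2) / \<beta> * y\<^sup>2 - 4 * lam * y ^ 4\<bar> \<le> 4 * (\<delta> + 2) / \<beta> * y\<^sup>2 + 4 * lam * y ^ 4" using d0 by linarith
  also have "\<dots> \<le> 4 * (\<delta> + 2) / \<beta> * (1 + y ^ 4) + 4 * lam * (1 + y ^ 4)"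
    using le lam d0 by (intro add_mono mult_left_mono) auto
  finally have "\<bar>4 * (\<delta> + 2) / \<beta> * y\<^sup>2 - 4 * lam * y ^ 4\<bar> \<le> (4 * (\<delta> + 2) / \<beta> + 4 * lam) * (1 + y ^ 4)" by (simp add: algebra_simps)
  then have "y powr (\<delta> - 1) * \<bar>4 * (\<delta> + 2) / \<beta> * y\<^sup>2 - 4 * lam * y ^ 4\<bar> \<le> (1 + y) * ((4 * (\<delta> + 2) / \<beta> + 4 * lam) * (1 + y ^ 4))"
    using powr_delta_le[of y] y by (intro mult_mono) auto
  also have "\<dots> = (4 * (\<delta> + 2) / \<beta> + 4 * lam) * ((1 + y) * (1 + y ^ 4))" by simp
  also have "\<dots> \<le> (4 * (\<delta> + 2) / \<beta> + 4 * lam) * (4 * (1 + y ^ 6))"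
    by (intro mult_left_mono poly4_6) (use y d0 lam in auto)
  finally show "y powr (\<delta> - 1) * \<bar>4 * (\<delta> + 2) / \<beta> * y\<^sup>2 - 4 * lam * y ^ 4\<bar> \<le> 4 * (4 * (\<delta> + 2) / \<beta> + 4 * lam) * (1 + y ^ 6)" by (simp only: mult_ac)
next
  show "((\<lambda>x. 4 * (x powr (\<delta> + 2) * exp (- z x))) \<longlongrightarrow> 0) at_top"
    using tendsto_mult_left[OF exp_z_lim, of 4] by simp
  show "continuous_on {0..} (\<lambda>x. 4 * (x powr (\<delta> + 2) * exp (- z x)))"
    by (intro continuous_on_mult continuous_on_const powr_exp_z_cont) (use delta in auto)
  show "continuous_on {0<..} (\<lambda>x. 4 * (\<delta> + 2) / \<beta> * x\<^sup>2 - 4 * lam * x ^ 4)"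
    by (intro continuous_on_diff continuous_on_mult continuous_on_const continuous_on_power continuous_on_id)
  show "continuous_on {0..} (\<lambda>x :: real. x ^ 4)" by (intro continuous_on_power continuous_on_id)
qed


lemma q_dscale_fn: "0 < x \<Longrightarrow> exp (- (B * x) - z x) / q x = dscale_fn \<delta> B x"
proof -
  assume x: "0 < x"
  have "x powr (1 - \<delta>) * x powr (\<delta> - 1) = 1" using x by (simp add: powr_add[symmetric])
  then have "dscale_fn \<delta> B x * q x = exp (- (B * x)) * exp (- z x)"
    by (simp add: dscale_fn_def q_def)
  also have "\<dots> = exp (- (B * x) - z x)" by (simp add: exp_add[symmetric])
  finally have "exp (- (B * x) - z x) = dscale_fn \<delta> B x * q x" ..
  then show ?thesis using q_pos[OF x] by simp
qed

lemma scale_fn_le4: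
  assumes B: "0 \<le> B" and y: "0 \<le> y"
  shows "\<bar>scale_fn \<delta> B y\<bar> \<le> 1 / (2 - \<delta>) * (1 + y ^ 4)"
proof -
  have "y powr (2 - \<delta>) \<le> 1 + y ^ 4"
  proof (cases "y \<le> 1")
    case True
    then have "y powr (2 - \<delta>) \<le> 1 powr (2 - \<delta>)" using y delta by (intro powr_mono2) auto
    then show ?thesis using y by (simp add: add_increasing2)
  next
    case False
    then have "y powr (2 - \<delta>) \<le> y powr 4" using delta by (intro powr_mono) auto
    then show ?thesis using False by simp
  qed
  then have "y powr (2 - \<delta>) / (2 - \<delta>) \<le> (1 + y ^ 4) / (2 - \<delta>)" using delta by (intro divide_right_mono) auto
  then show ?thesis using scale_fn_le[OF delta B y] scale_fn_nonneg[OF delta B y] by simp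
qed

text \<open>The power 1 - \<delta> in \<open>dscale_fn\<close> cancels the singular drift (\<delta>
  - 1) / (\<beta> x), so the flux is a smooth exponential. Its value 1 at 0 is the price: it adds h
  \<mu> times the mass of the atom.\<close>

lemma test_scale_fn:
  assumes B: "0 \<le> B"
  shows "test_fun (scale_fn \<delta> B) (\<lambda>x. exp (- (B * x) - z x)) (\<lambda>y. - ((B / \<beta> + lam * y) * dscale_fn \<delta> B y))"
proof (rule test_funI[where C = "1 / (2 - \<delta>)" and D = "(B / \<beta> + lam) * 4"])
  show "continuous_on {0..} (scale_fn \<delta> B)" by (rule scale_fn_cont[OF delta B])
  show "continuous_on {0..} (\<lambda>x. exp (- (B * x) - z x))" by (intro continuous_intros)
  show "continuous_on {0<..} (\<lambda>y. - ((B / \<beta> + lam * y) * dscale_fn \<delta> B y))"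
    unfolding dscale_fn_def by (intro continuous_intros) auto
  show "(scale_fn \<delta> B has_real_derivative exp (- (B * x) - z x) / q x) (at x)" if "0 < x" for x
    unfolding q_dscale_fn[OF that] by (rule scale_fn_deriv[OF delta B that])
  show "((\<lambda>x. exp (- (B * x) - z x)) has_real_derivative m x * - ((B / \<beta> + lam * x) * dscale_fn \<delta> B x)) (at x)"
    if x: "0 < x" for x
  proof -
    have "((\<lambda>x. exp (- (B * x) - z x)) has_real_derivative exp (- (B * x) - z x) * (- B - lam * \<beta> * x)) (at x)"
      by (auto intro!: derivative_eq_intros z_deriv)
    moreover have "exp (- (B * x) - z x) = q x * dscale_fn \<delta> B x" using q_dscale_fn[OF x, of B] q_pos[OF x] by (simp add: field_simps)
    moreover have "exp (- (B * x) - z x) * (- B - lam * \<beta> * x) = m x * - ((B / \<beta> + lam * x) * dscale_fn \<delta> B x)"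
      unfolding \<open>exp (- (B * x) - z x) = q x * dscale_fn \<delta> B x\<close> using beta by (simp add: m_eq field_simps)
    ultimately show ?thesis by simp
  qed
  show "\<bar>scale_fn \<delta> B y\<bar> \<le> 1 / (2 - \<delta>) * (1 + y ^ 4)" if "0 < y" for y using scale_fn_le4[OF B, of y] that by simp
  show "y powr (\<delta> - 1) * \<bar>- ((B / \<beta> + lam * y) * dscale_fn \<delta> B y)\<bar> \<le> (B / \<beta> + lam) * 4 * (1 + y ^ 6)" if y: "0 < y" for y
  proof -
    have B': "0 \<le> B / \<beta>" using B beta by simp
    have "y powr (\<delta> - 1) * y powr (1 - \<delta>) = 1" using y by (simp add: powr_add[symmetric])
    then have "y powr (\<delta> - 1) * \<bar>- ((B / \<beta> + lam * y) * dscale_fn \<delta> B y)\<bar> = (B / \<beta> + lam * y) * exp (- (B * y))"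
      using B' lam y by (simp add: dscale_fn_def abs_mult)
    also have "\<dots> \<le> (B / \<beta> + lam * y) * 1" using B' B lam y by (intro mult_left_mono) auto
    also have "\<dots> \<le> (B / \<beta> + lam) * (1 + y)"
    proof -
      have "0 \<le> B / \<beta> * y" by (rule mult_nonneg_nonneg[OF B']) (use y in simp)
      moreover have "(B / \<beta> + lam) * (1 + y) = B / \<beta> + B / \<beta> * y + lam + lam * y" by (simp only: algebra_simps)
      ultimately show ?thesis using lam by simp
    qed
    also have "\<dots> \<le> (B / \<beta> + lam) * ((1 + y) * (1 + y ^ 4))"
      using B' lam y mult_left_mono[of 1 "1 + y ^ 4" "1 + y"] by (intro mult_left_mono) auto
    also have "\<dots> \<le> (B / \<beta> + lam) * (4 * (1 + y ^ 6))"
      using B' lam y by (intro mult_left_mono poly4_6) auto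
    finally show ?thesis by (simp only: mult.assoc)
  qed
  show "((\<lambda>x. exp (- (B * x) - z x)) \<longlongrightarrow> 0) at_top"
  proof (rule Lim_null_comparison)
    show "((\<lambda>x. x powr 0 * exp (- z x)) \<longlongrightarrow> 0) at_top" by (rule exp_z_lim)
    show "eventually (\<lambda>x. norm (exp (- (B * x) - z x)) \<le> x powr 0 * exp (- z x)) at_top"
      using eventually_gt_at_top[of 0] by eventually_elim (use B in auto)
  qed
qed

section \<open>Moments under the resolvent kernel\<close>

lemma test_integrable:
  assumes "test_fun f F g"
  shows "set_integrable lborel {0..} (\<lambda>y. m y * f y)" "set_integrable lborel {0..} (\<lambda>y. m y * g y)"
  using assms unfolding test_fun_def by blast+

lemma test_adm: "test_fun f F g \<Longrightarrow> adm f"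
  unfolding test_fun_def adm_def by (auto intro: borel_measurable_halfline_continuous)

lemma integral_R_one: assumes s: "0 \<le> s" shows "(\<integral>y. (1 :: real) \<partial>R s) = 1"
proof -
  have "(\<integral>y. (1 :: real) \<partial>R s) = 1 + h * (LBINT y:{0..}. r s y * 0) + h * \<mu> * 0 * \<rho> s"
    by (rule resolvent_identity[OF test_one s])
  also have "\<dots> = 1" by (simp add: set_lebesgue_integral_def)
  finally show ?thesis .
qed

lemma LBINT_r: assumes "0 \<le> s" shows "(LBINT y:{0..}. r s y) = 1 - \<rho> s" and "\<rho> s \<le> 1"
  and "set_integrable lborel {0..} (r s)"
proof -
  show e: "(LBINT y:{0..}. r s y) = 1 - \<rho> s"
    using integral_R[OF assms test_adm[OF test_one]] unfolding integral_R_one[OF assms] by simp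
  have "0 \<le> (LBINT y:{0..}. r s y)" unfolding set_lebesgue_integral_def
    by (rule integral_nonneg_AE) (auto simp: indicator_def r_nonneg assms)
  with e show "\<rho> s \<le> 1" by simp
  show "set_integrable lborel {0..} (r s)"
    using r_integrable[OF assms test_integrable(1)[OF test_one]] by simp
qed

lemma prob_space_R: assumes "0 \<le> s" shows "prob_space (R s)"
proof
  have "integrable (R s) (\<lambda>_. 1 :: real)" by (rule integrable_R[OF assms test_adm[OF test_one]])
  then have "(\<integral>\<^sup>+y. ennreal (norm (1 :: real)) \<partial>R s) < \<infinity>" unfolding integrable_iff_bounded by blast
  then have fin: "emeasure (R s) (space (R s)) \<noteq> \<infinity>" by simp
  have "(\<integral>y. (1 :: real) \<partial>R s) = 1" by (rule integral_R_one[OF assms])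
  then have "measure (R s) (space (R s)) = 1" by (simp del: space_R)
  then show "emeasure (R s) (space (R s)) = 1"
    using emeasure_eq_ennreal_measure[of "R s" "space (R s)"] fin by (simp del: space_R)
qed

definition y2 where "y2 s = (\<integral>y. y\<^sup>2 \<partial>R s)"

text \<open>The resolvent identity for y^2, solved for the second moment. The factor
  \<open>1 - \<rho> s\<close> is the mass of the density: at the atom y^2 has no flux.\<close>

lemma y2_eq: assumes s: "0 \<le> s"
  shows "(1 + 2 * lam * h) * y2 s = s\<^sup>2 + h * (2 * \<delta> / \<beta>) * (1 - \<rho> s)"
proof -
  have i: "set_integrable lborel {0..} (\<lambda>y. r s y * y\<^sup>2)"
    by (rule r_integrable[OF s test_integrable(1)[OF test_sq]])
  have "y2 s = s\<^sup>2 + h * (LBINT y:{0..}. r s y * (2 * \<delta> / \<beta> - 2 * lam * y\<^sup>2))"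
    unfolding y2_def using resolvent_identity[OF test_sq s] delta by simp
  also have "(LBINT y:{0..}. r s y * (2 * \<delta> / \<beta> - 2 * lam * y\<^sup>2))
     = (LBINT y:{0..}. (2 * \<delta> / \<beta>) * r s y - (2 * lam) * (r s y * y\<^sup>2))"
    by (rule set_lebesgue_integral_cong) (auto simp: algebra_simps)
  also have "\<dots> = (2 * \<delta> / \<beta>) * (LBINT y:{0..}. r s y) - (2 * lam) * (LBINT y:{0..}. r s y * y\<^sup>2)"
    using LBINT_r(3)[OF s] i by (subst set_integral_diff) auto
  also have "(LBINT y:{0..}. r s y * y\<^sup>2) = y2 s"
    using integral_R[OF s test_adm[OF test_sq]] by (simp add: y2_def)
  finally have e: "y2 s = s\<^sup>2 + h * ((2 * \<delta> / \<beta>) * (1 - \<rho> s) - 2 * lam * y2 s)"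
    unfolding LBINT_r(1)[OF s] .
  define C0 where "C0 = 2 * \<delta> / \<beta>"
  show ?thesis using e unfolding C0_def[symmetric] by (simp add: algebra_simps)
qed

lemma y2_nonneg: "0 \<le> s \<Longrightarrow> 0 \<le> y2 s"
  unfolding y2_def by simp

lemma y2_le: assumes s: "0 \<le> s" shows "y2 s \<le> s\<^sup>2 + h * (2 * \<delta> / \<beta>) * (1 - \<rho> s)"
  and "y2 s \<le> (1 - lam * h) * (s\<^sup>2 + h * (2 * \<delta> / \<beta>))"
proof -
  have lh: "0 \<le> lam * h" using lam h by simp
  have "0 \<le> 2 * lam * h * y2 s" using lam h y2_nonneg[OF s] by simp
  then show "y2 s \<le> s\<^sup>2 + h * (2 * \<delta> / \<beta>) * (1 - \<rho> s)" using y2_eq[OF s] by (simp add: algebra_simps)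
  have p: "0 \<le> h * (2 * \<delta> / \<beta>)" using h delta beta by simp
  have X: "(1 + 2 * lam * h) * y2 s \<le> s\<^sup>2 + h * (2 * \<delta> / \<beta>)"
    unfolding y2_eq[OF s] using mult_left_mono[of "1 - \<rho> s" 1, OF _ p] \<rho>_pos[of s] by simp
  \<comment> \<open>The product is 1 + lam h (1 - 2 lam h); the step size restriction 2 lam h \<le>
    1 gives the sign.\<close>
  have k: "1 \<le> (1 - lam * h) * (1 + 2 * lam * h)"
  proof -
    have "(1 - lam * h) * (1 + 2 * lam * h) = 1 + lam * h * (1 - 2 * lam * h)" by (simp add: algebra_simps)
    moreover have "0 \<le> lam * h * (1 - 2 * lam * h)" using h by (intro mult_nonneg_nonneg[OF lh]) auto
    ultimately show ?thesis by simp
  qed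
  have lh1: "0 \<le> 1 - lam * h" using h(2) lh by (simp add: mult.assoc)
  have "y2 s \<le> (1 - lam * h) * (1 + 2 * lam * h) * y2 s" using mult_right_mono[OF k y2_nonneg[OF s]] by simp
  also have "\<dots> = (1 - lam * h) * ((1 + 2 * lam * h) * y2 s)" by simp
  also have "\<dots> \<le> (1 - lam * h) * (s\<^sup>2 + h * (2 * \<delta> / \<beta>))"
    by (rule mult_left_mono[OF X lh1])
  finally show "y2 s \<le> (1 - lam * h) * (s\<^sup>2 + h * (2 * \<delta> / \<beta>))" .
qed

lemma y4_le: assumes s: "0 \<le> s"
  shows "(\<integral>y. y ^ 4 \<partial>R s) \<le> s ^ 4 + h * (4 * (\<delta> + 2) / \<beta>) * y2 s"
proof -
  have i: "set_integrable lborel {0..} (\<lambda>y. r s y * y\<^sup>2)"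
    by (rule r_integrable[OF s test_integrable(1)[OF test_sq]])
  have i4: "set_integrable lborel {0..} (\<lambda>y. r s y * y ^ 4)"
    by (rule r_integrable[OF s test_integrable(1)[OF test_four]])
  have "(\<integral>y. y ^ 4 \<partial>R s) = s ^ 4 + h * (LBINT y:{0..}. r s y * (4 * (\<delta> + 2) / \<beta> * y\<^sup>2 - 4 * lam * y ^ 4))"
    using resolvent_identity[OF test_four s] delta by simp
  also have "(LBINT y:{0..}. r s y * (4 * (\<delta> + 2) / \<beta> * y\<^sup>2 - 4 * lam * y ^ 4))
     = (LBINT y:{0..}. (4 * (\<delta> + 2) / \<beta>) * (r s y * y\<^sup>2) - (4 * lam) * (r s y * y ^ 4))"
    by (rule set_lebesgue_integral_cong) (auto simp: algebra_simps)
  also have "\<dots> = (4 * (\<delta> + 2) / \<beta>) * (LBINT y:{0..}. r s y * y\<^sup>2) - (4 * lam) * (LBINT y:{0..}. r s y * y ^ 4)"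
    by (subst set_integral_diff(2), rule set_integrable_mult_right, rule i, rule set_integrable_mult_right, rule i4,
        simp only: set_integral_mult_right)
  also have "(LBINT y:{0..}. r s y * y\<^sup>2) = y2 s"
    using integral_R[OF s test_adm[OF test_sq]] by (simp add: y2_def)
  also have "(LBINT y:{0..}. r s y * y ^ 4) = (\<integral>y. y ^ 4 \<partial>R s)"
    using integral_R[OF s test_adm[OF test_four]] by simp
  finally have "(\<integral>y. y ^ 4 \<partial>R s) = s ^ 4 + h * (4 * (\<delta> + 2) / \<beta> * y2 s - 4 * lam * (\<integral>y. y ^ 4 \<partial>R s))" .
  moreover have "0 \<le> h * (4 * lam * (\<integral>y. y ^ 4 \<partial>R s))" using h lam by simp
  ultimately show ?thesis by (simp add: right_diff_distrib)
qed

text \<open>Of the generator of \<open>scale_fn\<close> the part - lam y g' is discarded by its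
  sign; the part proportional to B is the one that will beat the drift of the Euler step.\<close>

lemma integral_scale_fn_le:
  assumes s: "0 \<le> s" and B: "0 \<le> B"
  shows "(\<integral>y. scale_fn \<delta> B y \<partial>R s) \<le> scale_fn \<delta> B s - h * (B / \<beta>) * (LBINT y:{0..}. r s y * dscale_fn \<delta> B y) + h * \<mu> * \<rho> s"
    and "0 \<le> (LBINT y:{0..}. r s y * dscale_fn \<delta> B y)"
    and "set_integrable lborel {0..} (\<lambda>y. r s y * dscale_fn \<delta> B y)"
proof -
  have d0: "0 \<le> dscale_fn \<delta> B y" for y by (simp add: dscale_fn_def)
  have "set_integrable lborel {0..} (\<lambda>y. m y * dscale_fn \<delta> B y)"
  proof (rule m_integrable[where C = 1])
    show "continuous_on {0<..} (dscale_fn \<delta> B)" unfolding dscale_fn_def[abs_def] by (intro continuous_intros) auto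
    fix y :: real assume y: "0 < y"
    have "y powr (\<delta> - 1) * y powr (1 - \<delta>) = 1" using y by (simp add: powr_add[symmetric])
    then have "y powr (\<delta> - 1) * \<bar>dscale_fn \<delta> B y\<bar> = exp (- (B * y))" by (simp add: dscale_fn_def abs_mult)
    also have "\<dots> \<le> 1" using B y by simp
    finally show "y powr (\<delta> - 1) * \<bar>dscale_fn \<delta> B y\<bar> \<le> 1 * (1 + y ^ 6)" using y by (simp add: add_increasing2)
  qed
  then show i: "set_integrable lborel {0..} (\<lambda>y. r s y * dscale_fn \<delta> B y)" by (rule r_integrable[OF s])
  show "0 \<le> (LBINT y:{0..}. r s y * dscale_fn \<delta> B y)" unfolding set_lebesgue_integral_def
    by (rule integral_nonneg_AE) (auto simp: indicator_def r_nonneg s d0)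
  have i2: "set_integrable lborel {0..} (\<lambda>y. r s y * - ((B / \<beta> + lam * y) * dscale_fn \<delta> B y))"
    by (rule r_integrable[OF s test_integrable(2)[OF test_scale_fn[OF B]]])
  have "(LBINT y:{0..}. r s y * - ((B / \<beta> + lam * y) * dscale_fn \<delta> B y)) \<le> (LBINT y:{0..}. - (B / \<beta>) * (r s y * dscale_fn \<delta> B y))"
  proof (rule set_integral_mono[OF i2])
    show "set_integrable lborel {0..} (\<lambda>y. - (B / \<beta>) * (r s y * dscale_fn \<delta> B y))"
      by (intro set_integrable_mult_right i)
    fix y :: real assume "y \<in> {0..}"
    then have y: "0 \<le> y" by simp
    have "0 \<le> r s y * (lam * y * dscale_fn \<delta> B y)" using r_nonneg[OF s y] lam y d0 by simp
    then show "r s y * - ((B / \<beta> + lam * y) * dscale_fn \<delta> B y) \<le> - (B / \<beta>) * (r s y * dscale_fn \<delta> B y)"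
      by (simp add: algebra_simps)
  qed
  then have "(LBINT y:{0..}. r s y * - ((B / \<beta> + lam * y) * dscale_fn \<delta> B y)) \<le> - (B / \<beta>) * (LBINT y:{0..}. r s y * dscale_fn \<delta> B y)"
    by (simp only: set_integral_mult_right)
  then have "h * (LBINT y:{0..}. r s y * - ((B / \<beta> + lam * y) * dscale_fn \<delta> B y)) \<le> h * (- (B / \<beta>) * (LBINT y:{0..}. r s y * dscale_fn \<delta> B y))"
    using h by (intro mult_left_mono) auto
  then show "(\<integral>y. scale_fn \<delta> B y \<partial>R s) \<le> scale_fn \<delta> B s - h * (B / \<beta>) * (LBINT y:{0..}. r s y * dscale_fn \<delta> B y) + h * \<mu> * \<rho> s"
    using resolvent_identity[OF test_scale_fn[OF B] s] by (simp add: z_0 del: minus_mult_minus) 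
qed

text \<open>Jensen's inequality in the variable y^2, through the tangent at t^2, where t^2 bounds
  the second moment. The density has mass \<open>1 - \<rho> s\<close>, and the missing mass costs
  the term with \<open>\<rho> s\<close>.\<close>

lemma LBINT_dscale_fn_ge:
  assumes s: "0 \<le> s" and B: "0 \<le> B" and t: "0 < t" and ty: "y2 s \<le> t\<^sup>2"
  shows "dscale_fn \<delta> B t - 2 * \<rho> s * t powr (1 - \<delta>) \<le> (LBINT y:{0..}. r s y * dscale_fn \<delta> B y)"
proof -
  define k where "k = (\<delta> - 1 + B * t) / 2"
  have k: "0 \<le> k" using delta B t by (simp add: k_def)
  have i: "set_integrable lborel {0..} (\<lambda>y. r s y * y\<^sup>2)"
    by (rule r_integrable[OF s test_integrable(1)[OF test_sq]])
  have "(LBINT y:{0..}. dscale_fn \<delta> B t * (1 + k) * r s y - dscale_fn \<delta> B t * k / t\<^sup>2 * (r s y * y\<^sup>2)) \<le> (LBINT y:{0..}. r s y * dscale_fn \<delta> B y)"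
  proof (rule set_integral_mono)
    show "set_integrable lborel {0..} (\<lambda>y. dscale_fn \<delta> B t * (1 + k) * r s y - dscale_fn \<delta> B t * k / t\<^sup>2 * (r s y * y\<^sup>2))"
      by (intro set_integral_diff set_integrable_mult_right i LBINT_r(3)[OF s])
    show "set_integrable lborel {0..} (\<lambda>y. r s y * dscale_fn \<delta> B y)" by (rule integral_scale_fn_le(3)[OF s B])
    fix y :: real assume "y \<in> {0..}"
    then consider "y = 0" | "0 < y" by fastforce
    then show "dscale_fn \<delta> B t * (1 + k) * r s y - dscale_fn \<delta> B t * k / t\<^sup>2 * (r s y * y\<^sup>2) \<le> r s y * dscale_fn \<delta> B y"
    proof cases
      case 1
      then show ?thesis using delta by (simp add: r_eq m_eq q_def)
    next
      case 2
      have "r s y * (dscale_fn \<delta> B t * (1 - k * (y\<^sup>2 / t\<^sup>2 - 1))) \<le> r s y * dscale_fn \<delta> B y"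
        using dscale_fn_tangent[OF delta B 2 t] r_nonneg[OF s, of y] 2 by (intro mult_left_mono) (auto simp: k_def)
      then show ?thesis by (simp add: algebra_simps)
    qed
  qed
  also have "(LBINT y:{0..}. dscale_fn \<delta> B t * (1 + k) * r s y - dscale_fn \<delta> B t * k / t\<^sup>2 * (r s y * y\<^sup>2))
      = dscale_fn \<delta> B t * (1 + k) * (1 - \<rho> s) - dscale_fn \<delta> B t * k / t\<^sup>2 * y2 s"
  proof -
    have "(LBINT y:{0..}. r s y * y\<^sup>2) = y2 s"
      using integral_R[OF s test_adm[OF test_sq]] by (simp add: y2_def)
    moreover have "set_integrable lborel {0..} (\<lambda>y. dscale_fn \<delta> B t * (1 + k) * r s y)"
      by (rule set_integrable_mult_right) (rule LBINT_r(3)[OF s])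
    moreover have "set_integrable lborel {0..} (\<lambda>y. dscale_fn \<delta> B t * k / t\<^sup>2 * (r s y * y\<^sup>2))"
      by (rule set_integrable_mult_right) (rule i)
    ultimately show ?thesis
      by (simp only: set_integral_diff(2) set_integral_mult_right LBINT_r(1)[OF s])
  qed
  finally have 1: "dscale_fn \<delta> B t * (1 + k) * (1 - \<rho> s) - dscale_fn \<delta> B t * k / t\<^sup>2 * y2 s \<le> (LBINT y:{0..}. r s y * dscale_fn \<delta> B y)" .
  have "dscale_fn \<delta> B t * k / t\<^sup>2 * y2 s \<le> dscale_fn \<delta> B t * k / t\<^sup>2 * t\<^sup>2"
    using ty k dscale_fn_pos[OF delta B t] by (intro mult_left_mono) auto
  also have "\<dots> = dscale_fn \<delta> B t * k" using t by simp
  finally have 2: "dscale_fn \<delta> B t * k / t\<^sup>2 * y2 s \<le> dscale_fn \<delta> B t * k" .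
  \<comment> \<open>The slope k grows with B, but 1 + k \<le> 2 exp (B t), and the exponential
    inside \<open>dscale_fn\<close> absorbs this. The error is thus uniform in B.\<close>
  have 3: "dscale_fn \<delta> B t * (1 + k) \<le> 2 * t powr (1 - \<delta>)"
  proof -
    have "0 \<le> B * t" using B t by simp
    then have "1 + k \<le> 2 * (1 + B * t)" using delta by (simp add: k_def)
    also have "\<dots> \<le> 2 * exp (B * t)" by (rule mult_left_mono[OF exp_ge_add_one_self]) simp
    finally have "exp (- (B * t)) * (1 + k) \<le> exp (- (B * t)) * (2 * exp (B * t))" by (intro mult_left_mono) auto
    also have "\<dots> = 2" by (simp add: exp_minus)
    finally have "t powr (1 - \<delta>) * (exp (- (B * t)) * (1 + k)) \<le> t powr (1 - \<delta>) * 2" by (intro mult_left_mono) auto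
    then show ?thesis by (simp add: dscale_fn_def mult_ac)
  qed
  have "\<rho> s * (dscale_fn \<delta> B t * (1 + k)) \<le> \<rho> s * (2 * t powr (1 - \<delta>))" using 3 \<rho>_pos[of s] by (intro mult_left_mono) auto
  with 1 2 show ?thesis by (simp add: algebra_simps)
qed

end

section \<open>Lyapunov bounds and single crossing\<close>

definition lyapunov :: "real \<Rightarrow> real \<Rightarrow> real \<Rightarrow> real \<Rightarrow> real" where
  "lyapunov \<delta> kap B x = (if x = 0 then 0 else 1 + kap * scale_fn \<delta> B x + x\<^sup>2)"

section \<open>The mass of the atom\<close>

context sticky
begin

text \<open>The split is at y^2 = K h: below it, y^\<delta> \<le> (K h)^(\<delta>/2); above it, y^2
  \<le> y^4 / (K h). The exponent 2 - \<delta> is that of \<open>scale_fn\<close> at B = 0, whose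
  resolvent integral is under control.\<close>

lemma square_interpolation:
  assumes K: "0 < K" and y: "0 \<le> y"
  shows "y\<^sup>2 \<le> K powr (\<delta> / 2) * h powr (\<delta> / 2) * y powr (2 - \<delta>) + y ^ 4 / (K * h)"
proof (cases "y = 0")
  case False
  then have y: "0 < y" using y by simp
  define v where "v = y\<^sup>2 / h"
  have v: "0 < v" using y h by (simp add: v_def)
  have yv: "y\<^sup>2 = h * v" using h by (simp add: v_def)
  have y4: "y ^ 4 / (K * h) = h * (v\<^sup>2 / K)"
  proof -
    have "y ^ 4 = (y\<^sup>2)\<^sup>2" by (simp add: power_mult[symmetric])
    then show ?thesis unfolding yv using h K by (simp add: power2_eq_square)
  qed
  have yp: "h powr (\<delta> / 2) * y powr (2 - \<delta>) = h * v powr (1 - \<delta> / 2)"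
  proof -
    have "y powr (2 - \<delta>) = (y\<^sup>2) powr (1 - \<delta> / 2)"
      using y by (simp add: powr_powr algebra_simps flip: powr_numeral)
    also have "\<dots> = h powr (1 - \<delta> / 2) * v powr (1 - \<delta> / 2)" unfolding yv using h v by (simp add: powr_mult)
    finally have "h powr (\<delta> / 2) * y powr (2 - \<delta>) = (h powr (\<delta> / 2) * h powr (1 - \<delta> / 2)) * v powr (1 - \<delta> / 2)" by simp
    then show ?thesis using h by (simp add: powr_add[symmetric])
  qed
  have "v \<le> K powr (\<delta> / 2) * v powr (1 - \<delta> / 2) + v\<^sup>2 / K"
  proof (cases "v \<le> K")
    case True
    have "v = v powr (\<delta> / 2) * v powr (1 - \<delta> / 2)" using v by (simp add: powr_add[symmetric])
    also have "\<dots> \<le> K powr (\<delta> / 2) * v powr (1 - \<delta> / 2)"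
      using True v delta by (intro mult_right_mono powr_mono2) auto
    finally show ?thesis using K by (simp add: add_increasing2)
  next
    case False
    then have "v * K \<le> v\<^sup>2" using v by (simp add: power2_eq_square)
    then have "v \<le> v\<^sup>2 / K" using K by (simp add: pos_le_divide_eq)
    then show ?thesis by (simp add: add_increasing)
  qed
  then have "h * v \<le> h * (K powr (\<delta> / 2) * v powr (1 - \<delta> / 2) + v\<^sup>2 / K)" using h by (intro mult_left_mono) auto
  also have "\<dots> = K powr (\<delta> / 2) * (h * v powr (1 - \<delta> / 2)) + h * (v\<^sup>2 / K)" by (simp add: distrib_left)
  finally show ?thesis unfolding yp[symmetric] y4[symmetric] yv[symmetric] by (simp only: mult.assoc)
qed (use K h in simp)

text \<open>At B = 0 the function \<open>scale_fn\<close> is y^(2-\<delta>) / (2-\<delta>). Its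
  generator has only the inward part, so all growth comes from the flux at the sticky point.\<close>

lemma integral_powr_le:
  assumes s: "0 \<le> s"
  shows "(\<integral>y. y powr (2 - \<delta>) \<partial>R s) \<le> s powr (2 - \<delta>) + h * \<mu>" and "adm (\<lambda>y. y powr (2 - \<delta>))"
proof -
  have g: "scale_fn \<delta> 0 y = y powr (2 - \<delta>) / (2 - \<delta>)" for y by (simp add: scale_fn_def)
  have a: "adm (scale_fn \<delta> 0)" by (rule test_adm[OF test_scale_fn]) simp
  have "(\<integral>y. (2 - \<delta>) * scale_fn \<delta> 0 y \<partial>R s) = (2 - \<delta>) * (\<integral>y. scale_fn \<delta> 0 y \<partial>R s)" by (rule integral_mult_right_zero)
  also have "\<dots> \<le> (2 - \<delta>) * (scale_fn \<delta> 0 s + h * \<mu> * \<rho> s)"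
    using integral_scale_fn_le(1)[OF s, of 0] delta by (intro mult_left_mono) auto
  also have "\<dots> = s powr (2 - \<delta>) + (2 - \<delta>) * (h * \<mu> * \<rho> s)" using delta by (simp add: g distrib_left)
  also have "(2 - \<delta>) * (h * \<mu> * \<rho> s) \<le> 1 * (h * \<mu> * 1)"
    using delta h mu LBINT_r(2)[OF s] \<rho>_pos[of s] by (intro mult_mono) auto
  finally show "(\<integral>y. y powr (2 - \<delta>) \<partial>R s) \<le> s powr (2 - \<delta>) + h * \<mu>" using delta by (simp add: g)
  have "(\<lambda>y. m y * y powr (2 - \<delta>)) = (\<lambda>y. (2 - \<delta>) * (m y * scale_fn \<delta> 0 y))" using delta by (simp add: g fun_eq_iff)
  moreover have "set_integrable lborel {0..} (\<lambda>y. (2 - \<delta>) * (m y * scale_fn \<delta> 0 y))"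
    using a unfolding adm_def by (intro set_integrable_mult_right) blast
  ultimately have i: "set_integrable lborel {0..} (\<lambda>y. m y * y powr (2 - \<delta>))" by (simp only:)
  have "continuous_on {0..} (\<lambda>y. y powr (2 - \<delta>))"
    using delta by (intro continuous_on_powr' continuous_on_id continuous_on_const) auto
  from borel_measurable_halfline_continuous[OF this] i show "adm (\<lambda>y. y powr (2 - \<delta>))"
    unfolding adm_def by blast
qed

text \<open>The second moment is squeezed. By \<open>y2_eq\<close> it is at least of order h times
  the mass off 0; interpolating between the moments of order 2 - \<delta> and 4 bounds it from above
  by a small multiple of h when s is small against sqrt h. Dividing by h shows that little mass is
  off 0.\<close>

lemma atom_bound:
  assumes s: "0 \<le> s" "s \<le> e * sqrt h" and e: "0 \<le> e"
  shows "3 / 8 * (2 * \<delta> / \<beta>) * (1 - \<rho> s) \<le>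
    (4 * (4 * (\<delta> + 2) / \<beta>)) powr (\<delta> / 2) * (e powr (2 - \<delta>) + \<mu> * h powr (\<delta> / 2)) + e ^ 4 / (4 * (4 * (\<delta> + 2) / \<beta>))"
proof -
  define C4 where "C4 = 4 * (\<delta> + 2) / \<beta>"
  define C0 where "C0 = 2 * \<delta> / \<beta>"
  \<comment> \<open>The interpolation is used with K = 4 * C4, so that the fourth moment returns a
    quarter of \<open>y2 s\<close>. Absorbing it leaves 3 / 4, and 1 + 2 lam h \<le> 2 halves this
    to 3 / 8.\<close>
  define A where "A = (4 * C4) powr (\<delta> / 2)"
  have C4: "0 < C4" using delta beta by (simp add: C4_def)
  have C0: "0 < C0" using delta beta by (simp add: C0_def)
  have A: "0 < A" using C4 by (simp add: A_def)
  have hp: "0 < h powr (\<delta> / 2)" using h by simp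
  have i2: "integrable (R s) (\<lambda>y. y\<^sup>2)" by (rule integrable_R[OF s(1) test_adm[OF test_sq]])
  have i4: "integrable (R s) (\<lambda>y. y ^ 4)" by (rule integrable_R[OF s(1) test_adm[OF test_four]])
  have ip: "integrable (R s) (\<lambda>y. y powr (2 - \<delta>))" by (rule integrable_R[OF s(1) integral_powr_le(2)[OF s(1)]])
  have "y2 s \<le> (\<integral>y. A * h powr (\<delta> / 2) * y powr (2 - \<delta>) + y ^ 4 / (4 * C4 * h) \<partial>R s)"
    unfolding y2_def
  proof (rule integral_mono)
    show "integrable (R s) (\<lambda>y. A * h powr (\<delta> / 2) * y powr (2 - \<delta>) + y ^ 4 / (4 * C4 * h))"
      using i4 ip by simp
    show "y\<^sup>2 \<le> A * h powr (\<delta> / 2) * y powr (2 - \<delta>) + y ^ 4 / (4 * C4 * h)" if "y \<in> space (R s)" for y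
      using square_interpolation[of "4 * C4" y] that C4 unfolding A_def by simp
  qed (rule i2)
  also have "\<dots> = A * h powr (\<delta> / 2) * (\<integral>y. y powr (2 - \<delta>) \<partial>R s) + (\<integral>y. y ^ 4 \<partial>R s) / (4 * C4 * h)"
    using i4 ip by simp
  also have "\<dots> \<le> A * h powr (\<delta> / 2) * (s powr (2 - \<delta>) + h * \<mu>) + (s ^ 4 + h * C4 * y2 s) / (4 * C4 * h)"
  proof (rule add_mono)
    show "A * h powr (\<delta> / 2) * (\<integral>y. y powr (2 - \<delta>) \<partial>R s) \<le> A * h powr (\<delta> / 2) * (s powr (2 - \<delta>) + h * \<mu>)"
      using integral_powr_le(1)[OF s(1)] A by (intro mult_left_mono) auto
    show "(\<integral>y. y ^ 4 \<partial>R s) / (4 * C4 * h) \<le> (s ^ 4 + h * C4 * y2 s) / (4 * C4 * h)"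
    proof (rule divide_right_mono)
      show "(\<integral>y. y ^ 4 \<partial>R s) \<le> s ^ 4 + h * C4 * y2 s" using y4_le[OF s(1)] by (simp only: C4_def)
      show "0 \<le> 4 * C4 * h" using C4 h by simp
    qed
  qed
  also have "(s ^ 4 + h * C4 * y2 s) / (4 * C4 * h) = s ^ 4 / (4 * C4 * h) + y2 s / 4"
    using C4 h by (simp add: add_divide_distrib)
  finally have 1: "3 / 4 * y2 s \<le> A * h powr (\<delta> / 2) * (s powr (2 - \<delta>) + h * \<mu>) + s ^ 4 / (4 * C4 * h)" by simp
  have 2: "h * C0 * (1 - \<rho> s) \<le> 2 * y2 s"
  proof -
    have "h * C0 * (1 - \<rho> s) \<le> (1 + 2 * lam * h) * y2 s" unfolding y2_eq[OF s(1)] C0_def by simp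
    also have "\<dots> \<le> 2 * y2 s" using h y2_nonneg[OF s(1)] by (intro mult_right_mono) auto
    finally show ?thesis .
  qed
  have 3: "h powr (\<delta> / 2) * s powr (2 - \<delta>) \<le> h * e powr (2 - \<delta>)"
  proof -
    have "s powr (2 - \<delta>) \<le> (e * sqrt h) powr (2 - \<delta>)" using s delta by (intro powr_mono2) auto
    also have "\<dots> = e powr (2 - \<delta>) * h powr (1 - \<delta> / 2)"
      using e h by (simp add: powr_mult powr_half_sqrt[symmetric] powr_powr diff_divide_distrib)
    finally have "h powr (\<delta> / 2) * s powr (2 - \<delta>) \<le> h powr (\<delta> / 2) * (e powr (2 - \<delta>) * h powr (1 - \<delta> / 2))"
      using hp by (intro mult_left_mono) auto
    also have "\<dots> = (h powr (\<delta> / 2) * h powr (1 - \<delta> / 2)) * e powr (2 - \<delta>)" by simp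
    also have "\<dots> = h * e powr (2 - \<delta>)" using h by (simp add: powr_add[symmetric])
    finally show ?thesis .
  qed
  have 4: "s ^ 4 / (4 * C4 * h) \<le> h * (e ^ 4 / (4 * C4))"
  proof -
    have "s ^ 4 \<le> (e * sqrt h) ^ 4" using s by (intro power_mono) auto
    also have "\<dots> = e ^ 4 * h\<^sup>2"
    proof -
      have "sqrt h ^ 4 = ((sqrt h)\<^sup>2)\<^sup>2" by (simp add: power_mult[symmetric])
      then show ?thesis using h by (simp add: power_mult_distrib)
    qed
    finally have "s ^ 4 / (4 * C4 * h) \<le> (e ^ 4 * h\<^sup>2) / (4 * C4 * h)" using C4 h by (intro divide_right_mono) auto
    also have "(e ^ 4 * h\<^sup>2) / (4 * C4 * h) = h * (e ^ 4 / (4 * C4))"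
      using h C4 by (simp add: power2_eq_square mult.commute)
    finally show ?thesis .
  qed
  have "3 / 8 * (h * C0 * (1 - \<rho> s)) \<le> 3 / 4 * y2 s"
  proof -
    have "3 / 8 * X \<le> 3 / 4 * y" if "X \<le> 2 * y" for X y :: real using that by simp
    from this[OF 2] show ?thesis .
  qed
  also have "\<dots> \<le> A * (h powr (\<delta> / 2) * s powr (2 - \<delta>)) + A * (h powr (\<delta> / 2) * (h * \<mu>)) + s ^ 4 / (4 * C4 * h)"
    using 1 by (simp add: distrib_left mult.assoc)
  also have "\<dots> \<le> A * (h * e powr (2 - \<delta>)) + A * (h powr (\<delta> / 2) * (h * \<mu>)) + h * (e ^ 4 / (4 * C4))"
    by (intro add_mono mult_left_mono[OF 3] order_refl 4) (use A in simp)
  finally have "h * (3 / 8 * C0 * (1 - \<rho> s)) \<le> h * (A * (e powr (2 - \<delta>) + \<mu> * h powr (\<delta> / 2)) + e ^ 4 / (4 * C4))"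
    by (simp add: distrib_left mult_ac)
  then have "3 / 8 * C0 * (1 - \<rho> s) \<le> A * (e powr (2 - \<delta>) + \<mu> * h powr (\<delta> / 2)) + e ^ 4 / (4 * C4)"
    using h(1) by (simp only: mult_le_cancel_left_pos)
  then show ?thesis by (simp only: C4_def C0_def A_def)
qed

lemma r_0: "r s 0 = 0"
  using delta by (simp add: r_eq m_eq q_def)

lemma adm_linear: "adm f \<Longrightarrow> adm g \<Longrightarrow> adm (\<lambda>y. k * f y + l * g y)"
proof -
  assume fg: "adm f" "adm g"
  have "(\<lambda>y. m y * (k * f y + l * g y)) = (\<lambda>y. k * (m y * f y) + l * (m y * g y))"
    by (auto simp: fun_eq_iff algebra_simps)
  moreover have "set_integrable lborel {0..} (\<lambda>y. k * (m y * f y) + l * (m y * g y))"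
    using fg unfolding adm_def by (intro set_integral_add set_integrable_mult_right) blast+
  moreover have "(\<lambda>y. k * f y + l * g y) \<in> borel_measurable halfline"
    using fg unfolding adm_def by (intro borel_measurable_add borel_measurable_times) auto
  ultimately show ?thesis by (simp add: adm_def)
qed

text \<open>For the jump of the Lyapunov function at 0: the density part ignores a single point, and
  only the atom sees it.\<close>

lemma adm_drop_0:
  assumes "adm f" and "\<And>y. 0 < y \<Longrightarrow> g y = f y"
  shows "adm g"
proof -
  have "(\<lambda>y. indicator {0..} y *\<^sub>R (m y * g y)) = (\<lambda>y. indicator {0..} y *\<^sub>R (m y * f y))"
    using assms(2) delta by (auto simp: fun_eq_iff indicator_def m_eq q_def) (metis less_eq_real_def)
  moreover have "g \<in> borel_measurable halfline"
  proof -
    have "(\<lambda>y. if y = 0 then g 0 else f y) \<in> borel_measurable halfline"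
    proof (rule measurable_If)
      have "{y \<in> space halfline. y = 0} = {0}" by auto
      then show "{y \<in> space halfline. y = 0} \<in> sets halfline" by (simp add: sets_halfline)
    qed (use assms in \<open>auto simp: adm_def\<close>)
    then show ?thesis by (subst measurable_cong[where g = "\<lambda>y. if y = 0 then g 0 else f y"]) (use assms in auto)
  qed
  ultimately show ?thesis using assms(1) by (simp add: adm_def set_integrable_def)
qed

lemma integral_drop_0:
  assumes "adm f" and "\<And>y. 0 < y \<Longrightarrow> g y = f y" and s: "0 \<le> s"
  shows "(\<integral>y. g y \<partial>R s) = (\<integral>y. f y \<partial>R s) + \<rho> s * (g 0 - f 0)"
proof -
  have "(LBINT y:{0..}. r s y * g y) = (LBINT y:{0..}. r s y * f y)"
    by (rule set_lebesgue_integral_cong) (use assms(2) r_0 in \<open>auto simp: le_less\<close>)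
  then show ?thesis
    using integral_R[OF s assms(1)] integral_R[OF s adm_drop_0[OF assms(1,2)]] by (simp add: algebra_simps)
qed

text \<open>The term \<open>- \<rho> s\<close> is the gain from the jump, the atom having value 0
  instead of 1.\<close>

lemma W_integral:
  assumes s: "0 \<le> s" and B: "0 \<le> B"
  shows "adm (lyapunov \<delta> kap B)"
    and "(\<integral>y. lyapunov \<delta> kap B y \<partial>R s) = 1 + kap * (\<integral>y. scale_fn \<delta> B y \<partial>R s) + y2 s - \<rho> s"
proof -
  let ?w = "\<lambda>y. 1 * (1 * 1 + kap * scale_fn \<delta> B y) + 1 * y\<^sup>2"
  have a: "adm ?w"
    by (intro adm_linear test_adm[OF test_one] test_adm[OF test_sq] test_adm[OF test_scale_fn[OF B]])
  have e: "lyapunov \<delta> kap B y = ?w y" if "0 < y" for y using that by (simp add: lyapunov_def)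
  show "adm (lyapunov \<delta> kap B)" by (rule adm_drop_0[OF a e])
  have "(\<integral>y. lyapunov \<delta> kap B y \<partial>R s) = (\<integral>y. ?w y \<partial>R s) + \<rho> s * (lyapunov \<delta> kap B 0 - ?w 0)"
    by (rule integral_drop_0[OF a e s])
  also have "\<rho> s * (lyapunov \<delta> kap B 0 - ?w 0) = - \<rho> s" by (simp add: lyapunov_def scale_fn_0)
  also have "(\<integral>y. ?w y \<partial>R s) = 1 + kap * (\<integral>y. scale_fn \<delta> B y \<partial>R s) + y2 s"
  proof -
    have "integrable (R s) (\<lambda>_. 1 :: real)" "integrable (R s) (\<lambda>y. kap * scale_fn \<delta> B y)" "integrable (R s) (\<lambda>y. y\<^sup>2)"
      using integrable_R[OF s test_adm[OF test_one]] integrable_R[OF s test_adm[OF test_scale_fn[OF B]]]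
        integrable_R[OF s test_adm[OF test_sq]] by auto
    then show ?thesis using integral_R_one[OF s] by (simp add: y2_def)
  qed
  finally show "(\<integral>y. lyapunov \<delta> kap B y \<partial>R s) = 1 + kap * (\<integral>y. scale_fn \<delta> B y \<partial>R s) + y2 s - \<rho> s" by simp
qed

text \<open>The version away from 0, which retains the negative generator term of
  \<open>scale_fn\<close>, evaluated at a bound t for the root mean square.\<close>

lemma W_bound:
  assumes s: "0 \<le> s" and B: "0 \<le> B" and kap: "0 \<le> kap" and t: "0 < t" and ty: "s\<^sup>2 + h * (2 * \<delta> / \<beta>) \<le> t\<^sup>2"
  shows "(\<integral>y. lyapunov \<delta> kap B y \<partial>R s) \<le> 1 + kap * (scale_fn \<delta> B s - h * (B / \<beta>) * (dscale_fn \<delta> B t - 2 * \<rho> s * t powr (1 - \<delta>)) + h * \<mu> * \<rho> s)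
     + (1 - lam * h) * (s\<^sup>2 + h * (2 * \<delta> / \<beta>)) - \<rho> s"
proof -
  have p: "0 \<le> h * (2 * \<delta> / \<beta>)" using h delta beta by simp
  have "y2 s \<le> s\<^sup>2 + h * (2 * \<delta> / \<beta>) * (1 - \<rho> s)" by (rule y2_le(1)[OF s])
  also have "\<dots> \<le> s\<^sup>2 + h * (2 * \<delta> / \<beta>)" using mult_left_mono[of "1 - \<rho> s" 1, OF _ p] \<rho>_pos[of s] by simp
  also note ty
  finally have "y2 s \<le> t\<^sup>2" .
  from LBINT_dscale_fn_ge[OF s B t this]
  have "h * (B / \<beta>) * (dscale_fn \<delta> B t - 2 * \<rho> s * t powr (1 - \<delta>)) \<le> h * (B / \<beta>) * (LBINT y:{0..}. r s y * dscale_fn \<delta> B y)"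
    using h B beta by (intro mult_left_mono) auto
  with integral_scale_fn_le(1)[OF s B]
  have "(\<integral>y. scale_fn \<delta> B y \<partial>R s) \<le> scale_fn \<delta> B s - h * (B / \<beta>) * (dscale_fn \<delta> B t - 2 * \<rho> s * t powr (1 - \<delta>)) + h * \<mu> * \<rho> s"
    by linarith
  then have "kap * (\<integral>y. scale_fn \<delta> B y \<partial>R s) \<le> kap * (scale_fn \<delta> B s - h * (B / \<beta>) * (dscale_fn \<delta> B t - 2 * \<rho> s * t powr (1 - \<delta>)) + h * \<mu> * \<rho> s)"
    using kap by (rule mult_left_mono)
  then show ?thesis unfolding W_integral(2)[OF s B] using y2_le(2)[OF s] by linarith
qed

text \<open>The version near 0: the generator term is given up, and the contraction has to come from
  the atom.\<close>

lemma W_bound_near: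
  assumes s: "0 \<le> s" and B: "0 \<le> B" and kap: "0 \<le> kap"
  shows "(\<integral>y. lyapunov \<delta> kap B y \<partial>R s) \<le> 1 + kap * (scale_fn \<delta> B s + h * \<mu>) + s\<^sup>2 + h * (2 * \<delta> / \<beta>) - \<rho> s"
proof -
  have p: "0 \<le> h * (2 * \<delta> / \<beta>)" using h delta beta by simp
  have "y2 s \<le> s\<^sup>2 + h * (2 * \<delta> / \<beta>) * (1 - \<rho> s)" by (rule y2_le(1)[OF s])
  also have "\<dots> \<le> s\<^sup>2 + h * (2 * \<delta> / \<beta>)" using mult_left_mono[of "1 - \<rho> s" 1, OF _ p] \<rho>_pos[of s] by simp
  finally have 1: "y2 s \<le> s\<^sup>2 + h * (2 * \<delta> / \<beta>)" .
  have "0 \<le> h * (B / \<beta>) * (LBINT y:{0..}. r s y * dscale_fn \<delta> B y)"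
    using h B beta integral_scale_fn_le(2)[OF s B] by simp
  moreover have "h * \<mu> * \<rho> s \<le> h * \<mu> * 1" using h mu LBINT_r(2)[OF s] by (intro mult_left_mono) auto
  ultimately have "(\<integral>y. scale_fn \<delta> B y \<partial>R s) \<le> scale_fn \<delta> B s + h * \<mu>" using integral_scale_fn_le(1)[OF s B] by linarith
  then have "kap * (\<integral>y. scale_fn \<delta> B y \<partial>R s) \<le> kap * (scale_fn \<delta> B s + h * \<mu>)" using kap by (rule mult_left_mono)
  then show ?thesis unfolding W_integral(2)[OF s B] using 1 by linarith
qed

section \<open>Single crossing and monotone comparison of resolvent kernels\<close>

definition \<theta> where "\<theta> s y = u1 (min s y) * u2 (max s y)"

lemma \<theta>_pos: "0 \<le> s \<Longrightarrow> 0 \<le> y \<Longrightarrow> 0 < \<theta> s y"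
  using u1_pos[of "min s y"] u2_pos[of "max s y"] by (simp add: \<theta>_def)

lemma r_\<theta>: "r s y = \<theta> s y * (m y / (h * Wr))"
  by (simp add: r_eq \<theta>_def)

text \<open>Total positivity of order 2. After cancelling common factors, every ordering of the four
  points gives either an equality or the fact that u1 / u2 is increasing.\<close>

lemma \<theta>_TP2:
  assumes "0 \<le> s" "s \<le> s'" "0 \<le> x" "x \<le> y"
  shows "\<theta> s' x * \<theta> s y \<le> \<theta> s' y * \<theta> s x"
proof -
  have gen: "p * p' * u \<le> q * q' * u" if "p \<le> q" "p' \<le> q'" "0 \<le> p" "0 \<le> p'" "0 \<le> u" for p q p' q' u :: real
    using that by (intro mult_right_mono mult_mono) auto
  consider "s' \<le> x" | "s \<le> x" "x \<le> s'" "s' \<le> y" | "s \<le> x" "y \<le> s'" | "x \<le> s" "s' \<le> y"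
    | "x \<le> s" "s \<le> y" "y \<le> s'" | "y \<le> s"
    by linarith
  then show ?thesis
  proof cases
    case 1
    then show ?thesis using assms by (simp add: \<theta>_def min_absorb1 max_absorb2 min_absorb2 max_absorb1 mult_ac)
  next
    case 2
    have "u1 x * u2 s' * (u1 s * u2 y) \<le> u1 s' * u2 x * (u1 s * u2 y)"
      using 2 assms u1_pos[of s] u1_pos[of x] u2_pos[of s'] u2_pos[of y] by (intro gen u1_mono u2_antimono) (auto simp: less_imp_le)
    then show ?thesis using 2 assms by (simp add: \<theta>_def min_absorb1 max_absorb2 min_absorb2 max_absorb1 mult_ac)
  next
    case 3
    have "u1 x * u2 y * (u1 s * u2 s') \<le> u1 y * u2 x * (u1 s * u2 s')"
      using 3 assms u1_pos[of s] u1_pos[of x] u2_pos[of s'] u2_pos[of y] by (intro gen u1_mono u2_antimono) (auto simp: less_imp_le)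
    then show ?thesis using 3 assms by (simp add: \<theta>_def min_absorb1 max_absorb2 min_absorb2 max_absorb1 mult_ac)
  next
    case 4
    have "u1 s * u2 s' * (u1 x * u2 y) \<le> u1 s' * u2 s * (u1 x * u2 y)"
      using 4 assms u1_pos[of s] u1_pos[of x] u2_pos[of s'] u2_pos[of y] by (intro gen u1_mono u2_antimono) (auto simp: less_imp_le)
    then show ?thesis using 4 assms by (simp add: \<theta>_def min_absorb1 max_absorb2 min_absorb2 max_absorb1 mult_ac)
  next
    case 5
    have "u1 s * u2 y * (u1 x * u2 s') \<le> u1 y * u2 s * (u1 x * u2 s')"
      using 5 assms u1_pos[of s] u1_pos[of x] u2_pos[of s'] u2_pos[of y] by (intro gen u1_mono u2_antimono) (auto simp: less_imp_le)
    then show ?thesis using 5 assms by (simp add: \<theta>_def min_absorb1 max_absorb2 min_absorb2 max_absorb1 mult_ac)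
  next
    case 6
    then show ?thesis using assms by (simp add: \<theta>_def min_absorb1 max_absorb2 min_absorb2 max_absorb1 mult_ac)
  qed
qed

text \<open>The densities of \<open>R s\<close> and \<open>R s'\<close> cross once, so \<open>R s' - R s\<close> is a positive measure to the right
  of a negative one of the same mass.\<close>

lemma R_diff_le:
  assumes s: "0 \<le> s" "s \<le> s'" and f: "adm f" and W: "adm W" "\<And>x. 0 \<le> x \<Longrightarrow> 0 \<le> W x"
    and osc: "\<And>x y. 0 \<le> x \<Longrightarrow> x < y \<Longrightarrow> f y - f x \<le> W y"
  shows "(\<integral>y. f y \<partial>R s') - (\<integral>y. f y \<partial>R s) \<le> (\<integral>y. W y \<partial>R s')"
proof -
  have s': "0 \<le> s'" using s by simp
  \<comment> \<open>Where the smaller starting point puts more mass. The point 0 belongs here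
    because the atom shrinks as the starting point grows.\<close>
  define Neg where "Neg = {y. 0 \<le> y \<and> \<theta> s' y < \<theta> s y} \<union> {0}"
  \<comment> \<open>By \<open>\<theta>_TP2\<close> the quotient of the two densities is monotone, so
    \<open>Neg\<close> lies to the left of every positive point outside it.\<close>
  have less: "u < v" if "u \<in> Neg" "0 < v" "v \<notin> Neg" for u v
  proof (rule ccontr)
    assume "\<not> u < v"
    with that have vu: "v < u" by (cases "v = u") (auto simp: not_less)
    then have u: "0 \<le> u" "\<theta> s' u < \<theta> s u" using that by (auto simp: Neg_def)
    have v: "\<theta> s v \<le> \<theta> s' v" using that by (auto simp: Neg_def)
    have "\<theta> s' v * \<theta> s u \<le> \<theta> s' u * \<theta> s v" by (rule \<theta>_TP2) (use s that vu in auto)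
    also have "\<dots> < \<theta> s u * \<theta> s v" using u \<theta>_pos[of s v] s that by (intro mult_strict_right_mono) auto
    also have "\<dots> \<le> \<theta> s u * \<theta> s' v" using v \<theta>_pos[of s u] s u by (intro mult_left_mono) auto
    finally show False by (simp add: mult.commute)
  qed
  \<comment> \<open>To the right of s' both kernels share the factor u2, so monotonicity of u1 keeps
    v0 out of \<open>Neg\<close>. One such point suffices to bound f from below on
    \<open>Neg\<close>.\<close>
  define v0 where "v0 = s' + 1"
  have v0: "0 < v0" "v0 \<notin> Neg"
  proof -
    show "0 < v0" using s' by (simp add: v0_def)
    have "\<theta> s v0 \<le> \<theta> s' v0"
      using u1_mono[OF s] u2_pos[of v0] s by (simp add: \<theta>_def v0_def mult_right_mono)
    then show "v0 \<notin> Neg" using s' by (auto simp: Neg_def v0_def)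
  qed
  have ge: "f v - W v \<le> f u" if "u \<in> Neg" "0 < v" "v \<notin> Neg" for u v
    using osc[of u v] less[OF that] that by (auto simp: Neg_def)
  \<comment> \<open>The separating level: f is at least k on \<open>Neg\<close> and exceeds k by at
    most W to its right. Subtracting k leaves the difference of the integrals unchanged, since both
    laws have mass 1.\<close>
  define k where "k = Inf (f ` Neg)"
  have bdd: "bdd_below (f ` Neg)" using ge[OF _ v0] by (auto intro!: bdd_belowI[of _ "f v0 - W v0"])
  have k1: "k \<le> f u" if "u \<in> Neg" for u unfolding k_def using that by (intro cInf_lower bdd) auto
  have k2: "f v - k \<le> W v" if "0 < v" "v \<notin> Neg" for v
  proof -
    have "f v - W v \<le> k" unfolding k_def using ge[OF _ that] by (intro cInf_greatest) (auto simp: Neg_def)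
    then show ?thesis by simp
  qed
  have pt: "(r s' y - r s y) * (f y - k) \<le> r s' y * W y" if y: "0 \<le> y" for y
  proof (cases "y = 0")
    case False
    then have y: "0 < y" using y by simp
    have mm: "0 \<le> m y / (h * Wr)" using m_nonneg h Wr_pos by simp
    have rr: "0 \<le> r s y" "0 \<le> r s' y" using r_nonneg s s' y by auto
    show ?thesis
    proof (cases "y \<in> Neg")
      case True
      then have "\<theta> s' y - \<theta> s y \<le> 0" using y by (auto simp: Neg_def)
      then have "r s' y - r s y \<le> 0" unfolding r_\<theta> left_diff_distrib[symmetric] using mm by (rule mult_nonpos_nonneg)
      then have "(r s' y - r s y) * (f y - k) \<le> 0" using k1[OF True] by (intro mult_nonpos_nonneg) auto
      also have "0 \<le> r s' y * W y" using rr W(2)[of y] y by simp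
      finally show ?thesis .
    next
      case False
      then have "0 \<le> \<theta> s' y - \<theta> s y" using y by (auto simp: Neg_def)
      then have "0 \<le> r s' y - r s y" unfolding r_\<theta> left_diff_distrib[symmetric] using mm by (rule mult_nonneg_nonneg)
      then have "(r s' y - r s y) * (f y - k) \<le> (r s' y - r s y) * W y" using k2[OF y False] by (intro mult_left_mono) auto
      also have "\<dots> \<le> r s' y * W y" using rr W(2)[of y] y by (intro mult_right_mono) auto
      finally show ?thesis .
    qed
  qed (simp add: r_0)
  have fk: "adm (\<lambda>y. f y - k)" using adm_linear[OF f test_adm[OF test_one], of 1 "- k"] by simp
  have e: "(\<integral>y. f y - k \<partial>R t) = (\<integral>y. f y \<partial>R t) - k" if "0 \<le> t" for t
  proof -
    have "integrable (R t) (\<lambda>_. 1 * k)" using integrable_R[OF that test_adm[OF test_one]] by (rule integrable_mult_left)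
    then have i: "integrable (R t) (\<lambda>_. k)" by (simp only: mult_1)
    have c: "(\<integral>y. k \<partial>R t) = k"
      using prob_space.prob_space[OF prob_space_R[OF that]] by (simp del: space_R)
    show ?thesis by (simp only: Bochner_Integration.integral_diff[OF integrable_R[OF that f] i] c)
  qed
  have ri: "set_integrable lborel {0..} (\<lambda>y. r t y * (f y - k))" "set_integrable lborel {0..} (\<lambda>y. r t y * W y)" if "0 \<le> t" for t
    using r_integrable[OF that] fk W(1) by (auto simp: adm_def)
  have e1: "(\<integral>y. f y \<partial>R s') - (\<integral>y. f y \<partial>R s) = (\<integral>y. f y - k \<partial>R s') - (\<integral>y. f y - k \<partial>R s)"
    using e[OF s(1)] e[OF s'] by simp
  have e2: "(\<integral>y. f y - k \<partial>R s') - (\<integral>y. f y - k \<partial>R s) = (LBINT y:{0..}. r s' y * (f y - k)) - (LBINT y:{0..}. r s y * (f y - k)) + (\<rho> s' - \<rho> s) * (f 0 - k)"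
    unfolding integral_R[OF s(1) fk] integral_R[OF s' fk] by (simp add: algebra_simps)
  have "(LBINT y:{0..}. r s' y * (f y - k)) - (LBINT y:{0..}. r s y * (f y - k))
      = (LBINT y:{0..}. r s' y * (f y - k) - r s y * (f y - k))"
    by (rule set_integral_diff(2)[symmetric]) (intro ri s s')+
  also have "\<dots> \<le> (LBINT y:{0..}. r s' y * W y)"
  proof (rule set_integral_mono[OF set_integral_diff(1)[OF ri(1)[OF s'] ri(1)[OF s(1)]] ri(2)[OF s']])
    fix y :: real assume "y \<in> {0..}"
    then have "0 \<le> y" by simp
    from pt[OF this] show "r s' y * (f y - k) - r s y * (f y - k) \<le> r s' y * W y"
      by (simp only: left_diff_distrib)
  qed
  finally have le: "(LBINT y:{0..}. r s' y * (f y - k)) - (LBINT y:{0..}. r s y * (f y - k)) \<le> (LBINT y:{0..}. r s' y * W y)" .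
  have "(\<rho> s' - \<rho> s) * (f 0 - k) \<le> \<rho> s' * W 0"
  proof -
    have "(\<rho> s' - \<rho> s) * (f 0 - k) \<le> 0"
      using \<rho>_antimono[OF s] k1[of 0] by (intro mult_nonpos_nonneg) (auto simp: Neg_def)
    also have "0 \<le> \<rho> s' * W 0" using \<rho>_pos[of s'] W(2)[of 0] by simp
    finally show ?thesis .
  qed
  with le show ?thesis unfolding integral_R[OF s' W(1)] e1 e2 by (rule add_mono)
qed

lemma R_abs_diff_le:
  assumes s: "0 \<le> s" "s \<le> s'" and f: "adm f" and W: "adm W" "\<And>x. 0 \<le> x \<Longrightarrow> 0 \<le> W x"
    and osc: "\<And>x y. 0 \<le> x \<Longrightarrow> x < y \<Longrightarrow> \<bar>f y - f x\<bar> \<le> W y"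
  shows "\<bar>(\<integral>y. f y \<partial>R s') - (\<integral>y. f y \<partial>R s)\<bar> \<le> (\<integral>y. W y \<partial>R s')"
proof -
  have 1: "(\<integral>y. f y \<partial>R s') - (\<integral>y. f y \<partial>R s) \<le> (\<integral>y. W y \<partial>R s')"
    by (rule R_diff_le[OF s f W]) (use osc in \<open>auto dest: abs_le_D1\<close>)
  have nf: "adm (\<lambda>y. - f y)" using adm_linear[OF f f, of "-1" 0] by simp
  have "(\<integral>y. - f y \<partial>R s') - (\<integral>y. - f y \<partial>R s) \<le> (\<integral>y. W y \<partial>R s')"
  proof (rule R_diff_le[OF s nf W])
    show "- f y - - f x \<le> W y" if "0 \<le> x" "x < y" for x y using osc[OF that] by linarith
  qed
  with 1 show ?thesis by simp
qed

lemma R_measurable: "R \<in> measurable halfline (prob_algebra halfline)"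
proof (rule measurable_prob_algebraI)
  show "prob_space (R s)" if "s \<in> space halfline" for s using prob_space_R that by simp
  show "R \<in> halfline \<rightarrow>\<^sub>M subprob_algebra halfline"
  proof (rule measurable_subprob_algebra)
    show "subprob_space (R s)" if "s \<in> space halfline" for s
      using prob_space_R that by (intro prob_space_imp_subprob_space) simp
    fix A assume A: "A \<in> sets halfline"
    then have A': "A \<in> sets borel" "A \<subseteq> {0..}" by (auto simp: sets_halfline)
    have [measurable]: "A \<in> sets borel" by fact
    have [measurable]: "u1 \<in> borel_measurable borel" "u2 \<in> borel_measurable borel"
      by (intro borel_measurable_continuous_onI u1_cont u2_cont)+
    have [measurable]: "m \<in> borel_measurable borel"
      unfolding m_def cir_speed_def[abs_def] by measurable
    have e: "emeasure (R s) A = (\<integral>\<^sup>+y. ennreal (r s y) * indicator A y \<partial>lborel) + ennreal (\<rho> s) * indicator A 0" for s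
    proof -
      have "emeasure (R s) A = (\<integral>\<^sup>+y. indicator A y \<partial>R s)" using A by simp
      also have "\<dots> = (\<integral>\<^sup>+y. ennreal (r s y) * (indicator A y * indicator {0..} y) \<partial>lborel) + ennreal (\<rho> s) * indicator A 0"
        unfolding R_eq by (rule nn_integral_halfline_mix) (use A in auto)
      also have "(\<lambda>y. indicator A y * indicator {0..} y :: ennreal) = indicator A"
        using A' by (auto simp: fun_eq_iff indicator_def)
      finally show ?thesis .
    qed
    have "(\<lambda>s. (\<integral>\<^sup>+y. ennreal (r s y) * indicator A y \<partial>lborel) + ennreal (\<rho> s) * indicator A 0) \<in> borel_measurable borel"
      unfolding r_eq \<rho>_def by measurable
    then show "(\<lambda>s. emeasure (R s) A) \<in> borel_measurable halfline"
      unfolding e[abs_def] halfline_def by (rule measurable_restrict_space1)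
  qed simp
qed

end

section \<open>Geometric ergodicity of contracting kernels\<close>

text \<open>\<open>nn_integral_bind\<close> covers nonnegative integrands; f is the difference of f
  + g and g, which lie between 0 and 2 g.\<close>

lemma integral_bind_dominated:
  fixes f g :: "'a \<Rightarrow> real"
  assumes K: "K \<in> measurable S (prob_algebra S)" and ne: "space S \<noteq> {}" and \<mu>: "sets \<mu> = sets S"
    and f: "f \<in> borel_measurable S" and g: "g \<in> borel_measurable S"
    and fg: "\<And>x. x \<in> space S \<Longrightarrow> \<bar>f x\<bar> \<le> g x"
    and gK: "\<And>x. x \<in> space S \<Longrightarrow> integrable (K x) g"
    and gi: "integrable \<mu> (\<lambda>x. \<integral>y. g y \<partial>K x)"
  shows "integrable (\<mu> \<bind> K) f" "(\<integral>y. f y \<partial>(\<mu> \<bind> K)) = (\<integral>x. \<integral>y. f y \<partial>K x \<partial>\<mu>)"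
    "integrable \<mu> (\<lambda>x. \<integral>y. f y \<partial>K x)"
proof -
  have sp: "space \<mu> = space S" using \<mu> by (rule sets_eq_imp_space_eq)
  have K': "K \<in> measurable \<mu> (subprob_algebra S)"
    using measurable_prob_algebraD[OF K] measurable_cong_sets[OF \<mu> refl] by blast
  have sK: "sets (K x) = sets S" "space (K x) = space S" if "x \<in> space S" for x
    using measurable_space[OF K that] by (auto simp: space_prob_algebra dest: sets_eq_imp_space_eq)
  have meas: "(\<lambda>x. \<integral>y. k y \<partial>K x) \<in> borel_measurable \<mu>" if "k \<in> borel_measurable S" for k :: "'a \<Rightarrow> real"
    by (rule measurable_compose[OF K' integral_measurable_subprob_algebra[OF that]])
  have pos: "integrable (\<mu> \<bind> K) k \<and> (\<integral>y. k y \<partial>(\<mu> \<bind> K)) = (\<integral>x. \<integral>y. k y \<partial>K x \<partial>\<mu>) \<and> integrable \<mu> (\<lambda>x. \<integral>y. k y \<partial>K x)"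
    if k: "k \<in> borel_measurable S" "\<And>x. x \<in> space S \<Longrightarrow> 0 \<le> k x" "\<And>x. x \<in> space S \<Longrightarrow> k x \<le> 2 * g x" for k
  proof -
    have sb: "sets (\<mu> \<bind> K) = sets S" by (rule sets_bind[OF _ ]) (use sK sp ne in auto)
    then have spb: "space (\<mu> \<bind> K) = space S" by (rule sets_eq_imp_space_eq)
    have ki: "integrable (K x) k" if x: "x \<in> space S" for x
    proof (rule Bochner_Integration.integrable_bound[of _ "\<lambda>y. 2 * g y"])
      show "k \<in> borel_measurable (K x)" using k(1) measurable_cong_sets[OF sK(1)[OF x] refl] by blast
      show "AE y in K x. norm (k y) \<le> norm (2 * g y)"
        using k sK[OF x] by (intro AE_I2) force
    qed (use gK[OF x] in simp)
    have kP: "integrable \<mu> (\<lambda>x. \<integral>y. k y \<partial>K x)"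
    proof (rule Bochner_Integration.integrable_bound[of _ "\<lambda>x. 2 * (\<integral>y. g y \<partial>K x)"])
      show "AE x in \<mu>. norm (\<integral>y. k y \<partial>K x) \<le> norm (2 * (\<integral>y. g y \<partial>K x))"
      proof (rule AE_I2)
        fix x assume "x \<in> space \<mu>"
        then have x: "x \<in> space S" using sp by simp
        have "(\<integral>y. k y \<partial>K x) \<le> (\<integral>y. 2 * g y \<partial>K x)"
          by (rule integral_mono[OF ki[OF x]]) (use gK[OF x] k sK[OF x] in auto)
        moreover have "0 \<le> (\<integral>y. k y \<partial>K x)" using k sK[OF x] by (intro integral_nonneg_AE AE_I2) auto
        ultimately show "norm (\<integral>y. k y \<partial>K x) \<le> norm (2 * (\<integral>y. g y \<partial>K x))" by simp
      qed
    qed (use gi meas[OF k(1)] in auto)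
    have "(\<integral>\<^sup>+y. ennreal (k y) \<partial>(\<mu> \<bind> K)) = (\<integral>\<^sup>+x. \<integral>\<^sup>+y. ennreal (k y) \<partial>K x \<partial>\<mu>)"
      by (rule nn_integral_bind[OF _ K']) (use k in simp)
    also have "\<dots> = (\<integral>\<^sup>+x. ennreal (\<integral>y. k y \<partial>K x) \<partial>\<mu>)"
    proof (rule nn_integral_cong)
      fix x assume "x \<in> space \<mu>"
      then have x: "x \<in> space S" using sp by simp
      show "(\<integral>\<^sup>+y. ennreal (k y) \<partial>K x) = ennreal (\<integral>y. k y \<partial>K x)"
        by (rule nn_integral_eq_integral[OF ki[OF x]]) (use k sK[OF x] in \<open>auto intro: AE_I2\<close>)
    qed
    also have "\<dots> = ennreal (\<integral>x. \<integral>y. k y \<partial>K x \<partial>\<mu>)"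
      by (rule nn_integral_eq_integral[OF kP]) (use k sK sp in \<open>auto intro!: AE_I2 integral_nonneg_AE\<close>)
    finally have e: "(\<integral>\<^sup>+y. ennreal (k y) \<partial>(\<mu> \<bind> K)) = ennreal (\<integral>x. \<integral>y. k y \<partial>K x \<partial>\<mu>)" .
    have "0 \<le> (\<integral>x. \<integral>y. k y \<partial>K x \<partial>\<mu>)"
      using k sK sp by (auto intro!: integral_nonneg_AE AE_I2)
    moreover have "k \<in> borel_measurable (\<mu> \<bind> K)" using k(1) measurable_cong_sets[OF sb refl] by blast
    moreover have "AE y in \<mu> \<bind> K. 0 \<le> k y" using k spb by (intro AE_I2) auto
    ultimately show ?thesis using nn_integral_eq_integrable[of k "\<mu> \<bind> K"] e kP by blast
  qed
  have gpos: "0 \<le> g x" if "x \<in> space S" for x using fg[OF that] by linarith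
  have p1: "integrable (\<mu> \<bind> K) (\<lambda>y. f y + g y) \<and> (\<integral>y. f y + g y \<partial>(\<mu> \<bind> K)) = (\<integral>x. \<integral>y. f y + g y \<partial>K x \<partial>\<mu>) \<and> integrable \<mu> (\<lambda>x. \<integral>y. f y + g y \<partial>K x)"
  proof (rule pos)
    show "(\<lambda>y. f y + g y) \<in> borel_measurable S" using f g by simp
    show "0 \<le> f x + g x" if "x \<in> space S" for x using fg[OF that] by linarith
    show "f x + g x \<le> 2 * g x" if "x \<in> space S" for x using fg[OF that] by linarith
  qed
  have p2: "integrable (\<mu> \<bind> K) g \<and> (\<integral>y. g y \<partial>(\<mu> \<bind> K)) = (\<integral>x. \<integral>y. g y \<partial>K x \<partial>\<mu>) \<and> integrable \<mu> (\<lambda>x. \<integral>y. g y \<partial>K x)"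
    by (rule pos) (use g gpos in auto)
  have "integrable (\<mu> \<bind> K) (\<lambda>y. (f y + g y) - g y)" using p1 p2 by (intro Bochner_Integration.integrable_diff) auto
  then show i: "integrable (\<mu> \<bind> K) f" by simp
  have fK: "integrable (K x) f" if x: "x \<in> space S" for x
  proof (rule Bochner_Integration.integrable_bound[OF gK[OF x]])
    show "f \<in> borel_measurable (K x)" using f measurable_cong_sets[OF sK(1)[OF x] refl] by blast
    show "AE y in K x. norm (f y) \<le> norm (g y)" using fg sK[OF x] by (intro AE_I2) force
  qed
  have Pf: "(\<integral>y. f y + g y \<partial>K x) - (\<integral>y. g y \<partial>K x) = (\<integral>y. f y \<partial>K x)" if "x \<in> space S" for x
    using fK[OF that] gK[OF that] by simp
  have "integrable \<mu> (\<lambda>x. (\<integral>y. f y + g y \<partial>K x) - (\<integral>y. g y \<partial>K x))"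
    using p1 p2 by (intro Bochner_Integration.integrable_diff) auto
  then show iP: "integrable \<mu> (\<lambda>x. \<integral>y. f y \<partial>K x)"
    by (rule Bochner_Integration.integrable_cong[OF refl, THEN iffD1, rotated]) (use Pf sp in auto)
  have "(\<integral>y. f y + g y \<partial>(\<mu> \<bind> K)) = (\<integral>y. f y \<partial>(\<mu> \<bind> K)) + (\<integral>y. g y \<partial>(\<mu> \<bind> K))"
    using i p2 by simp
  then have "(\<integral>y. f y \<partial>(\<mu> \<bind> K)) = (\<integral>x. \<integral>y. f y + g y \<partial>K x \<partial>\<mu>) - (\<integral>x. \<integral>y. g y \<partial>K x \<partial>\<mu>)"
    using p1 p2 by simp
  also have "\<dots> = (\<integral>x. (\<integral>y. f y + g y \<partial>K x) - (\<integral>y. g y \<partial>K x) \<partial>\<mu>)"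
    using p1 p2 by simp
  also have "\<dots> = (\<integral>x. \<integral>y. f y \<partial>K x \<partial>\<mu>)"
    by (rule Bochner_Integration.integral_cong) (use Pf sp in auto)
  finally show "(\<integral>y. f y \<partial>(\<mu> \<bind> K)) = (\<integral>x. \<integral>y. f y \<partial>K x \<partial>\<mu>)" .
qed

text \<open>\<open>osc\<close> says that one step shrinks every oscillation bound of the form k max
  (W x) (W y) by the factor 1 - \<gamma>, where C is there for integrability. The drift of
  \<open>V\<close> supplies integrability and a bound on the stationary moment; the rate of
  convergence is \<gamma>.\<close>

locale contracting_kernel =
  fixes S :: "'a measure" and K :: "'a \<Rightarrow> 'a measure" and p :: 'a and V W :: "'a \<Rightarrow> real" and \<gamma> c b D :: real
  assumes K: "K \<in> measurable S (prob_algebra S)" and p: "p \<in> space S" "{p} \<in> sets S"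
    and V: "V \<in> borel_measurable S" "\<And>x. x \<in> space S \<Longrightarrow> 1 \<le> V x"
    and W: "W \<in> borel_measurable S" "\<And>x. x \<in> space S \<Longrightarrow> 0 \<le> W x" "W p = 0"
    and VW: "\<And>x y. x \<in> space S \<Longrightarrow> y \<in> space S \<Longrightarrow> x \<noteq> y \<Longrightarrow> V x + V y \<le> 2 * max (W x) (W y)"
      "\<And>x. x \<in> space S \<Longrightarrow> x \<noteq> p \<Longrightarrow> V x \<le> W x"
      "\<And>x. x \<in> space S \<Longrightarrow> W x \<le> D * V x"
    and \<gamma>: "0 < \<gamma>" "\<gamma> < 1" and c: "0 < c" "c < 1" and b: "0 \<le> b"
    and KV: "\<And>x. x \<in> space S \<Longrightarrow> integrable (K x) V"
      "\<And>x. x \<in> space S \<Longrightarrow> (\<integral>y. V y \<partial>K x) \<le> (1 - c) * V x + b"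
    and KW: "\<And>x. x \<in> space S \<Longrightarrow> x \<noteq> p \<Longrightarrow> (\<integral>y. W y \<partial>K x) \<le> (1 - \<gamma>) * W x"
    and osc: "\<And>f C k. f \<in> borel_measurable S \<Longrightarrow> (\<And>x. x \<in> space S \<Longrightarrow> \<bar>f x\<bar> \<le> C * V x) \<Longrightarrow> 0 \<le> k \<Longrightarrow>
        (\<And>x y. x \<in> space S \<Longrightarrow> y \<in> space S \<Longrightarrow> \<bar>f x - f y\<bar> \<le> k * max (W x) (W y)) \<Longrightarrow>
        (\<And>x y. x \<in> space S \<Longrightarrow> y \<in> space S \<Longrightarrow>
          \<bar>(\<integral>u. f u \<partial>K x) - (\<integral>u. f u \<partial>K y)\<bar> \<le> (1 - \<gamma>) * k * max (W x) (W y))"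
begin

lemma ne: "space S \<noteq> {}" using p by auto

lemma sets_K: "x \<in> space S \<Longrightarrow> sets (K x) = sets S" and space_K: "x \<in> space S \<Longrightarrow> space (K x) = space S"
  and prob_K: "x \<in> space S \<Longrightarrow> prob_space (K x)"
  using measurable_space[OF K] by (auto simp: space_prob_algebra dest: sets_eq_imp_space_eq)

lemma K_sub: "sets \<mu> = sets S \<Longrightarrow> K \<in> measurable \<mu> (subprob_algebra S)"
  using measurable_prob_algebraD[OF K] measurable_cong_sets[OF _ refl] by blast

lemma sets_bind_K: "sets \<mu> = sets S \<Longrightarrow> sets (\<mu> \<bind> K) = sets S"
proof -
  assume "sets \<mu> = sets S"
  then have sp: "space \<mu> = space S" by (rule sets_eq_imp_space_eq)
  show ?thesis
  proof (rule sets_bind)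
    show "sets (K x) = sets S" if "x \<in> space \<mu>" for x using sets_K that by (simp only: sp)
    show "space \<mu> \<noteq> {}" using ne by (simp only: sp not_False_eq_True)
  qed
qed

definition P where "P f x = (\<integral>y. f y \<partial>K x)" for f :: "'a \<Rightarrow> real"

lemma P_measurable: "f \<in> borel_measurable S \<Longrightarrow> P f \<in> borel_measurable S"
  unfolding P_def[abs_def]
  by (rule measurable_compose[OF K_sub[OF refl] integral_measurable_subprob_algebra])

lemma integrable_K:
  assumes "f \<in> borel_measurable S" "\<And>x. x \<in> space S \<Longrightarrow> \<bar>f x\<bar> \<le> C * V x" "x \<in> space S"
  shows "integrable (K x) f"
proof (rule Bochner_Integration.integrable_bound[of _ "\<lambda>y. C * V y"])
  show "f \<in> borel_measurable (K x)" using assms(1) measurable_cong_sets[OF sets_K[OF assms(3)] refl] by blast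
  show "AE y in K x. norm (f y) \<le> norm (C * V y)" using assms(2) space_K[OF assms(3)] by (intro AE_I2) force
qed (use KV(1)[OF assms(3)] in simp)

text \<open>Crude: the constant grows under iteration. It serves integrability, while the decay
  comes from \<open>Pn_osc\<close>.\<close>

lemma P_bound:
  assumes "f \<in> borel_measurable S" "\<And>x. x \<in> space S \<Longrightarrow> \<bar>f x\<bar> \<le> C * V x" "0 \<le> C" "x \<in> space S"
  shows "\<bar>P f x\<bar> \<le> C * (1 + b) * V x"
proof -
  have "\<bar>P f x\<bar> \<le> (\<integral>y. \<bar>f y\<bar> \<partial>K x)" unfolding P_def by (rule integral_abs_bound)
  also have "\<dots> \<le> (\<integral>y. C * V y \<partial>K x)"
    by (rule integral_mono) (use integrable_K[OF assms(1,2,4)] KV(1)[OF assms(4)] assms(2) space_K[OF assms(4)] in auto)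
  also have "\<dots> = C * (\<integral>y. V y \<partial>K x)" by simp
  also have "\<dots> \<le> C * ((1 - c) * V x + b)" using KV(2)[OF assms(4)] assms(3) by (rule mult_left_mono)
  also have "(1 - c) * V x + b \<le> (1 + b) * V x"
  proof -
    have "(1 - c) * V x \<le> 1 * V x" using c V(2)[OF assms(4)] by (intro mult_right_mono) auto
    moreover have "b * 1 \<le> b * V x" using b V(2)[OF assms(4)] by (intro mult_left_mono) auto
    ultimately show ?thesis by (simp add: distrib_right)
  qed
  then have "C * ((1 - c) * V x + b) \<le> C * ((1 + b) * V x)" using assms(3) by (rule mult_left_mono)
  finally show ?thesis by (simp add: mult.assoc)
qed

lemma P_bound_1:
  assumes "f \<in> borel_measurable S" "\<And>x. x \<in> space S \<Longrightarrow> \<bar>f x\<bar> \<le> 1" "x \<in> space S"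
  shows "\<bar>P f x\<bar> \<le> 1"
proof -
  interpret prob_space "K x" by (rule prob_K[OF assms(3)])
  have i: "integrable (K x) f"
    by (rule integrable_K[where C = 1]) (use assms V(2) in \<open>auto intro: order_trans\<close>)
  have "\<bar>P f x\<bar> \<le> (\<integral>y. \<bar>f y\<bar> \<partial>K x)" unfolding P_def by (rule integral_abs_bound)
  also have "\<dots> \<le> (\<integral>y. 1 \<partial>K x)" by (rule integral_mono) (use i assms space_K in auto)
  also have "\<dots> = 1" using prob_space by simp
  finally show ?thesis .
qed

lemma Pn_measurable: "f \<in> borel_measurable S \<Longrightarrow> (P ^^ n) f \<in> borel_measurable S"
  by (induction n) (auto intro: P_measurable)

lemma Pn_bound:
  assumes "f \<in> borel_measurable S" "\<And>x. x \<in> space S \<Longrightarrow> \<bar>f x\<bar> \<le> C * V x" "0 \<le> C" "x \<in> space S"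
  shows "\<bar>(P ^^ n) f x\<bar> \<le> C * (1 + b) ^ n * V x"
  using assms(4)
proof (induction n arbitrary: x)
  case 0
  then show ?case using assms by simp
next
  case (Suc n)
  have "\<bar>P ((P ^^ n) f) x\<bar> \<le> C * (1 + b) ^ n * (1 + b) * V x"
    by (rule P_bound[OF Pn_measurable[OF assms(1)]]) (use Suc assms b in auto)
  then show ?case by (simp add: mult_ac)
qed

lemma integral_bind_K:
  assumes \<mu>: "sets \<mu> = sets S" "integrable \<mu> V" and f: "f \<in> borel_measurable S" "\<And>x. x \<in> space S \<Longrightarrow> \<bar>f x\<bar> \<le> C * V x"
    and C: "0 \<le> C"
  shows "integrable (\<mu> \<bind> K) f" "(\<integral>y. f y \<partial>(\<mu> \<bind> K)) = (\<integral>x. P f x \<partial>\<mu>)"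
proof -
  have g: "(\<lambda>x. C * V x) \<in> borel_measurable S" using V by simp
  have i: "integrable \<mu> (P (\<lambda>x. C * V x))"
  proof (rule Bochner_Integration.integrable_bound[of _ "\<lambda>y. C * (1 + b) * V y"])
    show "P (\<lambda>x. C * V x) \<in> borel_measurable \<mu>"
      using P_measurable[OF g] measurable_cong_sets[OF \<mu>(1) refl] by blast
    show "AE x in \<mu>. norm (P (\<lambda>x. C * V x) x) \<le> norm (C * (1 + b) * V x)"
    proof (rule AE_I2)
      fix x assume "x \<in> space \<mu>"
      then have x: "x \<in> space S" using \<mu>(1) sets_eq_imp_space_eq by blast
      have "\<bar>P (\<lambda>x. C * V x) x\<bar> \<le> C * (1 + b) * V x"
      proof (rule P_bound[OF g _ C x])
        fix y assume "y \<in> space S"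
        then have "0 \<le> C * V y" using C V(2)[of y] by (intro mult_nonneg_nonneg) auto
        then show "\<bar>C * V y\<bar> \<le> C * V y" by simp
      qed
      then show "norm (P (\<lambda>x. C * V x) x) \<le> norm (C * (1 + b) * V x)" by simp
    qed
  qed (use \<mu>(2) in simp)
  show "integrable (\<mu> \<bind> K) f" "(\<integral>y. f y \<partial>(\<mu> \<bind> K)) = (\<integral>x. P f x \<partial>\<mu>)"
    using integral_bind_dominated[OF K ne \<mu>(1) f(1) g f(2)] KV(1) i unfolding P_def by auto
qed

lemma kernel_pow_prob: "x \<in> space S \<Longrightarrow> sets (kernel_pow S K n x) = sets S \<and> prob_space (kernel_pow S K n x)"
proof (induction n)
  case 0
  then show ?case by (simp add: prob_space_return)
next
  case (Suc n)
  then have s: "sets (kernel_pow S K n x) = sets S" "prob_space (kernel_pow S K n x)" by auto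
  have "K \<in> measurable (kernel_pow S K n x) (prob_algebra S)" using K measurable_cong_sets[OF s(1) refl] by blast
  then show ?case using prob_space_bind'[of "kernel_pow S K n x" "kernel_pow S K n x" K S] s sets_bind_K[OF s(1)]
    by (simp add: space_prob_algebra)
qed

lemma integral_kernel_pow:
  assumes "f \<in> borel_measurable S" "\<And>x. x \<in> space S \<Longrightarrow> \<bar>f x\<bar> \<le> C * V x" "0 \<le> C" "x \<in> space S"
  shows "integrable (kernel_pow S K n x) f \<and> (\<integral>y. f y \<partial>kernel_pow S K n x) = (P ^^ n) f x"
  using assms(1-3)
proof (induction n arbitrary: f C)
  case 0
  then show ?case using assms(4) by (simp add: integrable_iff_bounded nn_integral_return integral_return)
next
  case (Suc n)
  have V1: "integrable (kernel_pow S K n x) V"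
    using Suc.IH[OF V(1), of 1] V(2) by fastforce
  have s: "sets (kernel_pow S K n x) = sets S" using kernel_pow_prob[OF assms(4)] by simp
  have 1: "integrable (kernel_pow S K n x \<bind> K) f" "(\<integral>y. f y \<partial>(kernel_pow S K n x \<bind> K)) = (\<integral>y. P f y \<partial>kernel_pow S K n x)"
    using integral_bind_K[OF s V1 Suc.prems] by blast+
  have "(\<integral>y. P f y \<partial>kernel_pow S K n x) = (P ^^ n) (P f) x"
    using Suc.IH[OF P_measurable[OF Suc.prems(1)], of "C * (1 + b)"] P_bound[OF Suc.prems] b Suc.prems(3) by simp
  then show ?case using 1 by (simp add: funpow_swap1)
qed

text \<open>The factor 2 stems from n = 0, where |f x - f y| \<le> V x + V y for distinct points;
  each step then contributes 1 - \<gamma> through \<open>osc\<close>.\<close>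

lemma Pn_osc:
  assumes f: "f \<in> borel_measurable S" "\<And>x. x \<in> space S \<Longrightarrow> \<bar>f x\<bar> \<le> V x" and "x \<in> space S" "y \<in> space S"
  shows "\<bar>(P ^^ n) f x - (P ^^ n) f y\<bar> \<le> 2 * (1 - \<gamma>) ^ n * max (W x) (W y)"
  using assms(3,4)
proof (induction n arbitrary: x y)
  case 0
  show ?case
  proof (cases "x = y")
    case False
    have "\<bar>f x - f y\<bar> \<le> V x + V y" using f(2)[OF 0(1)] f(2)[OF 0(2)] by linarith
    then show ?thesis using VW(1)[OF 0 False] by simp
  next
    case True
    then show ?thesis using W(2)[OF 0(1)] by simp
  qed
next
  case (Suc n)
  have "\<bar>(\<integral>u. (P ^^ n) f u \<partial>K x) - (\<integral>u. (P ^^ n) f u \<partial>K y)\<bar> \<le> (1 - \<gamma>) * (2 * (1 - \<gamma>) ^ n) * max (W x) (W y)"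
  proof (rule osc[OF Pn_measurable[OF f(1)] _ _ _ Suc.prems])
    show "\<bar>(P ^^ n) f x\<bar> \<le> (1 * (1 + b) ^ n) * V x" if "x \<in> space S" for x
      by (rule Pn_bound[OF f(1) _ _ that]) (use f in auto)
  qed (use Suc.IH \<gamma> in auto)
  then show ?case by (simp add: P_def[of "(P ^^ n) f"] mult_ac)
qed

section \<open>Stationary distributions: moments, convergence and uniqueness\<close>

lemma stationary_integral:
  assumes st: "stationary_distribution S K \<pi>" and g: "integrable \<pi> V"
    and f: "f \<in> borel_measurable S" "\<And>x. x \<in> space S \<Longrightarrow> \<bar>f x\<bar> \<le> C * V x" "0 \<le> C"
  shows "integrable \<pi> f" "(\<integral>x. (P ^^ n) f x \<partial>\<pi>) = (\<integral>x. f x \<partial>\<pi>)"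
proof -
  have s: "sets \<pi> = sets S" "\<pi> \<bind> K = \<pi>" using st by (auto simp: stationary_distribution_def)
  show "integrable \<pi> f" using integral_bind_K(1)[OF s(1) g f] s(2) by simp
  show "(\<integral>x. (P ^^ n) f x \<partial>\<pi>) = (\<integral>x. f x \<partial>\<pi>)"
  proof (induction n)
    case (Suc n)
    have "(\<integral>y. (P ^^ n) f y \<partial>(\<pi> \<bind> K)) = (\<integral>x. P ((P ^^ n) f) x \<partial>\<pi>)"
      by (rule integral_bind_K(2)[OF s(1) g Pn_measurable[OF f(1)] Pn_bound[OF f]]) (use f b in auto)
    then show ?case using Suc s(2) by simp
  qed simp
qed

text \<open>The drift inequality integrated against \<pi>; finiteness of the moment permits the
  subtraction. In the application b and c are both proportional to h, so the quotient is uniform in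
  h.\<close>

lemma stationary_V_bound:
  assumes st: "stationary_distribution S K \<pi>" and g: "integrable \<pi> V"
  shows "(\<integral>x. V x \<partial>\<pi>) \<le> b / c"
proof -
  interpret prob_space \<pi> using st by (simp add: stationary_distribution_def)
  have s: "sets \<pi> = sets S" using st by (auto simp: stationary_distribution_def)
  then have sp: "space \<pi> = space S" by (rule sets_eq_imp_space_eq)
  have VV: "\<bar>V x\<bar> \<le> 1 * V x" if "x \<in> space S" for x using V(2)[OF that] by simp
  have "(\<integral>x. V x \<partial>\<pi>) = (\<integral>x. P V x \<partial>\<pi>)" using stationary_integral(2)[OF st g V(1) VV, of 1] by simp
  also have "\<dots> \<le> (\<integral>x. (1 - c) * V x + b \<partial>\<pi>)"
  proof (rule integral_mono)
    show "integrable \<pi> (P V)"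
      by (rule stationary_integral(1)[OF st g P_measurable[OF V(1)] P_bound[OF V(1) VV]]) (use b in auto)
    show "P V x \<le> (1 - c) * V x + b" if "x \<in> space \<pi>" for x using KV(2)[of x] that sp by (simp add: P_def)
  qed (use g in simp)
  also have "\<dots> = (1 - c) * (\<integral>x. V x \<partial>\<pi>) + b" using g prob_space by simp
  finally have "c * (\<integral>x. V x \<partial>\<pi>) \<le> b" by (simp add: algebra_simps)
  then show ?thesis using c by (simp add: pos_le_divide_eq mult.commute)
qed

text \<open>\<open>Pn_osc\<close> averaged over its second point under \<pi>, with max replaced by
  the sum.\<close>

lemma V_norm_bound:
  assumes st: "stationary_distribution S K \<pi>" and g: "integrable \<pi> V" and x: "x \<in> space S"
  shows "V_norm_diff V (kernel_pow S K n x) \<pi> \<le> ennreal (2 * D * (1 + b / c) * V x * (1 - \<gamma>) ^ n)"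
proof -
  interpret prob_space \<pi> using st by (simp add: stationary_distribution_def)
  have s: "sets \<pi> = sets S" using st by (auto simp: stationary_distribution_def)
  then have sp: "space \<pi> = space S" by (rule sets_eq_imp_space_eq)
  have sk: "sets (kernel_pow S K n x) = sets S" using kernel_pow_prob[OF x] by simp
  then have spk: "space (kernel_pow S K n x) = space S" by (rule sets_eq_imp_space_eq)
  have VV: "\<bar>V x\<bar> \<le> 1 * V x" if "x \<in> space S" for x using V(2)[OF that] by simp
  have iV: "integrable (kernel_pow S K n x) V" using integral_kernel_pow[OF V(1) VV _ x] by simp
  have D: "0 \<le> D"
  proof -
    have "0 \<le> D * V p" using W(2)[OF p(1)] VW(3)[OF p(1)] by linarith
    then show ?thesis using V(2)[OF p(1)] by (simp add: zero_le_mult_iff)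
  qed
  have WD: "\<bar>W x\<bar> \<le> D * V x" if "x \<in> space S" for x using VW(3)[OF that] W(2)[OF that] by simp
  have iW: "integrable \<pi> W" by (rule stationary_integral(1)[OF st g W(1) WD D])
  have "(\<integral>y. W y \<partial>\<pi>) \<le> (\<integral>y. D * V y \<partial>\<pi>)"
    by (rule integral_mono[OF iW]) (use g VW(3) sp in auto)
  also have "\<dots> = D * (\<integral>y. V y \<partial>\<pi>)" by simp
  also have "\<dots> \<le> D * (b / c)" by (rule mult_left_mono[OF stationary_V_bound[OF st g] D])
  finally have Wb: "(\<integral>y. W y \<partial>\<pi>) \<le> D * (b / c)" .
  have main: "\<bar>(\<integral>y. f y \<partial>kernel_pow S K n x) - (\<integral>y. f y \<partial>\<pi>)\<bar> \<le> 2 * D * (1 + b / c) * V x * (1 - \<gamma>) ^ n"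
    if f: "f \<in> borel_measurable S" "\<And>x. x \<in> space S \<Longrightarrow> \<bar>f x\<bar> \<le> V x" for f
  proof -
    have fV: "\<bar>f x\<bar> \<le> 1 * V x" if "x \<in> space S" for x using f(2)[OF that] by simp
    have fn: "integrable \<pi> ((P ^^ n) f)"
      by (rule stationary_integral(1)[OF st g Pn_measurable[OF f(1)] Pn_bound[OF f(1) fV]]) (use b in auto)
    have "(\<integral>y. f y \<partial>kernel_pow S K n x) - (\<integral>y. f y \<partial>\<pi>) = (P ^^ n) f x - (\<integral>y. (P ^^ n) f y \<partial>\<pi>)"
      using integral_kernel_pow[OF f(1) fV _ x] stationary_integral(2)[OF st g f(1) fV] by simp
    also have "\<dots> = (\<integral>y. (P ^^ n) f x - (P ^^ n) f y \<partial>\<pi>)" using fn prob_space by simp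
    also have "\<bar>\<dots>\<bar> \<le> (\<integral>y. \<bar>(P ^^ n) f x - (P ^^ n) f y\<bar> \<partial>\<pi>)" by (rule integral_abs_bound)
    also have "\<dots> \<le> (\<integral>y. 2 * (1 - \<gamma>) ^ n * (W x + W y) \<partial>\<pi>)"
    proof (rule integral_mono)
      fix y assume "y \<in> space \<pi>"
      then have y: "y \<in> space S" using sp by simp
      have "\<bar>(P ^^ n) f x - (P ^^ n) f y\<bar> \<le> 2 * (1 - \<gamma>) ^ n * max (W x) (W y)" by (rule Pn_osc[OF f x y])
      also have "\<dots> \<le> 2 * (1 - \<gamma>) ^ n * (W x + W y)"
        using \<gamma> W(2)[OF x] W(2)[OF y] by (intro mult_left_mono) auto
      finally show "\<bar>(P ^^ n) f x - (P ^^ n) f y\<bar> \<le> 2 * (1 - \<gamma>) ^ n * (W x + W y)" .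
    qed (use fn iW in auto)
    also have "\<dots> = 2 * (1 - \<gamma>) ^ n * (W x + (\<integral>y. W y \<partial>\<pi>))" using iW prob_space by simp
    also have "\<dots> \<le> 2 * (1 - \<gamma>) ^ n * (D * V x + D * (b / c) * V x)"
    proof (intro mult_left_mono add_mono VW(3) x)
      have "D * (b / c) * 1 \<le> D * (b / c) * V x" using D b c V(2)[OF x] by (intro mult_left_mono) auto
      with Wb show "(\<integral>y. W y \<partial>\<pi>) \<le> D * (b / c) * V x" by linarith
    qed (use \<gamma> in auto)
    also have "\<dots> = 2 * D * (1 + b / c) * V x * (1 - \<gamma>) ^ n" by (simp add: algebra_simps)
    finally show ?thesis .
  qed
  have "(SUP f\<in>{f \<in> borel_measurable (kernel_pow S K n x). \<forall>y\<in>space (kernel_pow S K n x). \<bar>f y\<bar> \<le> V y}.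
      ennreal \<bar>(\<integral>y. f y \<partial>kernel_pow S K n x) - (\<integral>y. f y \<partial>\<pi>)\<bar>) \<le> ennreal (2 * D * (1 + b / c) * V x * (1 - \<gamma>) ^ n)"
  proof (rule SUP_least)
    fix f assume "f \<in> {f \<in> borel_measurable (kernel_pow S K n x). \<forall>y\<in>space (kernel_pow S K n x). \<bar>f y\<bar> \<le> V y}"
    then have "f \<in> borel_measurable S" "\<And>y. y \<in> space S \<Longrightarrow> \<bar>f y\<bar> \<le> V y"
      using measurable_cong_sets[OF sk refl] spk by auto
    from main[OF this] show "ennreal \<bar>(\<integral>y. f y \<partial>kernel_pow S K n x) - (\<integral>y. f y \<partial>\<pi>)\<bar> \<le> ennreal (2 * D * (1 + b / c) * V x * (1 - \<gamma>) ^ n)"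
      by (rule ennreal_leI)
  qed
  then show ?thesis unfolding V_norm_diff_def using iV g by simp
qed

text \<open>Here \<pi> is an arbitrary stationary law, so integrability of V is not at hand.
  Indicators have iterates bounded by 1, their differences to the value at p vanish pointwise by
  \<open>Pn_osc\<close>, and dominated convergence applies. The sequence does not mention \<pi>,
  whence uniqueness.\<close>

lemma stationary_measure_LIMSEQ:
  assumes st: "stationary_distribution S K \<pi>" and A: "A \<in> sets S"
  shows "(\<lambda>n. (P ^^ n) (indicator A) p) \<longlonglongrightarrow> measure \<pi> A"
proof -
  interpret prob_space \<pi> using st by (simp add: stationary_distribution_def)
  have s: "sets \<pi> = sets S" "\<pi> \<bind> K = \<pi>" using st by (auto simp: stationary_distribution_def)
  then have sp: "space \<pi> = space S" using sets_eq_imp_space_eq by blast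
  define f :: "nat \<Rightarrow> 'a \<Rightarrow> real" where "f n = (P ^^ n) (indicator A)" for n
  have fm: "f n \<in> borel_measurable S" for n unfolding f_def by (rule Pn_measurable) (use A in simp)
  have fm': "f n \<in> borel_measurable \<pi>" for n using fm measurable_cong_sets[OF s(1) refl] by blast
  have f1: "\<bar>f n x\<bar> \<le> 1" if "x \<in> space S" for n x using that
  proof (induction n arbitrary: x)
    case (Suc n)
    then show ?case using P_bound_1[OF fm] by (simp add: f_def)
  qed (simp add: f_def indicator_def)
  have int: "(\<integral>x. f n x \<partial>\<pi>) = measure \<pi> A" for n
  proof (induction n)
    case 0
    then show ?case using A s sets.sets_into_space by (simp add: f_def)
  next
    case (Suc n)
    have "(\<integral>y. f n y \<partial>(\<pi> \<bind> K)) = (\<integral>x. \<integral>y. f n y \<partial>K x \<partial>\<pi>)"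
    proof (rule integral_bind_dominated(2)[OF K ne s(1) fm])
      show "integrable \<pi> (\<lambda>x. \<integral>y. (1 :: real) \<partial>K x)"
      proof (rule Bochner_Integration.integrable_cong[OF refl, THEN iffD1, rotated])
        show "integrable \<pi> (\<lambda>_. 1 :: real)" by simp
        show "1 = (\<integral>y. (1 :: real) \<partial>K x)" if "x \<in> space \<pi>" for x
          using prob_space.prob_space[OF prob_K, of x] that sp by simp
      qed
      show "integrable (K x) (\<lambda>_. 1 :: real)" if "x \<in> space S" for x
        using prob_space.finite_measure[OF prob_K[OF that]] by (simp add: finite_measure.integrable_const)
    qed (use f1 in auto)
    moreover have "f (Suc n) = P (f n)" by (simp add: f_def)
    ultimately show ?case using Suc s(2) by (simp add: P_def)
  qed
  have lim: "(\<lambda>n. \<integral>x. f n x - f n p \<partial>\<pi>) \<longlonglongrightarrow> (\<integral>x. 0 \<partial>\<pi>)"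
  proof (rule integral_dominated_convergence[where w = "\<lambda>_. 2"])
    show "AE x in \<pi>. (\<lambda>n. f n x - f n p) \<longlonglongrightarrow> 0"
    proof (rule AE_I2)
      fix x assume "x \<in> space \<pi>"
      then have x: "x \<in> space S" using sp by simp
      show "(\<lambda>n. f n x - f n p) \<longlonglongrightarrow> 0"
      proof (rule Lim_null_comparison)
        have iV: "\<bar>indicator A y :: real\<bar> \<le> V y" if "y \<in> space S" for y using V(2)[OF that] by (simp add: indicator_def)
        have im: "(indicator A :: 'a \<Rightarrow> real) \<in> borel_measurable S" using A by simp
        show "eventually (\<lambda>n. norm (f n x - f n p) \<le> 2 * (1 - \<gamma>) ^ n * max (W x) (W p)) sequentially"
          using Pn_osc[OF im iV x p(1)] by (intro always_eventually allI) (simp add: f_def)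
        have "(\<lambda>n. 2 * (1 - \<gamma>) ^ n * max (W x) (W p)) \<longlonglongrightarrow> 2 * 0 * max (W x) (W p)"
          using \<gamma> by (intro tendsto_intros LIMSEQ_power_zero) auto
        then show "(\<lambda>n. 2 * (1 - \<gamma>) ^ n * max (W x) (W p)) \<longlonglongrightarrow> 0" by simp
      qed
    qed
    show "AE x in \<pi>. norm (f n x - f n p) \<le> 2" for n
    proof (rule AE_I2)
      fix x assume "x \<in> space \<pi>"
      then show "norm (f n x - f n p) \<le> 2" using f1[of x n] f1[OF p(1), of n] sp by simp
    qed
  qed (use fm' in auto)
  have fi: "integrable \<pi> (f n)" for n
    by (rule integrable_const_bound[where B = 1]) (use f1 sp fm' in \<open>auto intro!: AE_I2\<close>)
  have "(\<lambda>n. measure \<pi> A - f n p) \<longlonglongrightarrow> 0"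
    using lim fi prob_space by (simp add: int)
  then have "(\<lambda>n. measure \<pi> A - (measure \<pi> A - f n p)) \<longlonglongrightarrow> measure \<pi> A - 0" by (intro tendsto_diff tendsto_const)
  then show ?thesis by (simp add: f_def)
qed

lemma stationary_unique:
  assumes "stationary_distribution S K \<pi>" "stationary_distribution S K \<pi>'"
  shows "\<pi>' = \<pi>"
proof (rule measure_eqI)
  have s: "sets \<pi> = sets S" "sets \<pi>' = sets S" "prob_space \<pi>" "prob_space \<pi>'" using assms by (auto simp: stationary_distribution_def)
  then show "sets \<pi>' = sets \<pi>" by simp
  fix A assume "A \<in> sets \<pi>'"
  then have A: "A \<in> sets S" using s by simp
  have "measure \<pi>' A = measure \<pi> A"
    by (rule LIMSEQ_unique[OF stationary_measure_LIMSEQ[OF assms(2) A] stationary_measure_LIMSEQ[OF assms(1) A]])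
  then show "emeasure \<pi>' A = emeasure \<pi> A"
    using s by (simp add: finite_measure.emeasure_eq_measure prob_space.finite_measure)
qed


section \<open>Existence of a stationary distribution\<close>

text \<open>The stationary distribution is the normalised occupation measure of an excursion from \<open>p\<close>:
  \<open>excursion n\<close> is the law of the \<open>n\<close>-th step, restricted to no return to \<open>p\<close> so far.\<close>

primrec excursion :: "nat \<Rightarrow> 'a measure" where
  "excursion 0 = return S p"
| "excursion (Suc n) = density (excursion n \<bind> K) (indicator (space S - {p}))"

lemma sets_excursion: "sets (excursion n) = sets S"
  by (induction n) (auto simp: sets_bind_K)

lemma nn_integral_excursion_Suc:
  assumes f: "f \<in> borel_measurable S"
  shows "(\<integral>\<^sup>+x. f x \<partial>excursion (Suc n)) = (\<integral>\<^sup>+x. \<integral>\<^sup>+y. indicator (space S - {p}) y * f y \<partial>K x \<partial>excursion n)"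
proof -
  have s: "sets (excursion n \<bind> K) = sets S" by (rule sets_bind_K[OF sets_excursion])
  have i: "(indicator (space S - {p}) :: 'a \<Rightarrow> ennreal) \<in> borel_measurable S" using p by simp
  have "(\<integral>\<^sup>+x. f x \<partial>excursion (Suc n)) = (\<integral>\<^sup>+y. indicator (space S - {p}) y * f y \<partial>(excursion n \<bind> K))"
    unfolding excursion.simps
    by (rule nn_integral_density) (use f i measurable_cong_sets[OF s refl] in blast)+
  also have "\<dots> = (\<integral>\<^sup>+x. \<integral>\<^sup>+y. indicator (space S - {p}) y * f y \<partial>K x \<partial>excursion n)"
    by (rule nn_integral_bind[OF _ K_sub[OF sets_excursion]]) (use f i in simp)
  finally show ?thesis .
qed

lemma nn_integral_K_W: "x \<in> space S \<Longrightarrow> (\<integral>\<^sup>+y. ennreal (W y) \<partial>K x) = ennreal (\<integral>y. W y \<partial>K x)"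
proof -
  assume x: "x \<in> space S"
  have "\<bar>W y\<bar> \<le> D * V y" if "y \<in> space S" for y using VW(3)[OF that] W(2)[OF that] by simp
  then have "integrable (K x) W" by (rule integrable_K[OF W(1) _ x])
  then show ?thesis by (rule nn_integral_eq_integral) (use W(2) space_K[OF x] in \<open>auto intro: AE_I2\<close>)
qed

text \<open>As W p = 0, killing at p does not change the integral of W, and every step from outside
  p gains 1 - \<gamma>. The first step starts at p, where \<open>KW\<close> says nothing; it
  contributes the leading factor and shifts the index.\<close>

lemma excursion_W: "(\<integral>\<^sup>+x. ennreal (W x) \<partial>excursion (Suc n)) \<le> ennreal ((\<integral>y. W y \<partial>K p) * (1 - \<gamma>) ^ n)"
proof (induction n)
  have Wm: "(\<lambda>x. ennreal (W x)) \<in> borel_measurable S" using W by simp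
  have drop: "(\<integral>\<^sup>+y. indicator (space S - {p}) y * ennreal (W y) \<partial>K x) = (\<integral>\<^sup>+y. ennreal (W y) \<partial>K x)"
    if "x \<in> space S" for x
    by (rule nn_integral_cong) (use W(3) space_K[OF that] in \<open>auto simp: indicator_def\<close>)
  {
    case 0
    have "(\<integral>\<^sup>+x. \<integral>\<^sup>+y. indicator (space S - {p}) y * ennreal (W y) \<partial>K x \<partial>excursion 0) = (\<integral>\<^sup>+y. indicator (space S - {p}) y * ennreal (W y) \<partial>K p)"
      unfolding excursion.simps
    proof (rule nn_integral_return[OF p(1)])
      have "(indicator (space S - {p}) :: 'a \<Rightarrow> ennreal) \<in> borel_measurable S" using p by simp
      then have "(\<lambda>y. indicator (space S - {p}) y * ennreal (W y)) \<in> borel_measurable S" using Wm by simp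
      from measurable_compose[OF K_sub[OF refl] nn_integral_measurable_subprob_algebra[OF this]]
      show "(\<lambda>x. \<integral>\<^sup>+y. indicator (space S - {p}) y * ennreal (W y) \<partial>K x) \<in> borel_measurable S" .
    qed
    then show ?case unfolding nn_integral_excursion_Suc[OF Wm] drop[OF p(1)] nn_integral_K_W[OF p(1)] by simp
  next
    case (Suc n)
    have "(\<integral>\<^sup>+x. ennreal (W x) \<partial>excursion (Suc (Suc n)))
      = (\<integral>\<^sup>+x. \<integral>\<^sup>+y. indicator (space S - {p}) y * ennreal (W y) \<partial>K x \<partial>excursion (Suc n))"
      by (rule nn_integral_excursion_Suc[OF Wm])
    also have "\<dots> = (\<integral>\<^sup>+x. ennreal (\<integral>y. W y \<partial>K x) \<partial>excursion (Suc n))"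
    proof (rule nn_integral_cong)
      fix x assume "x \<in> space (excursion (Suc n))"
      then have x: "x \<in> space S" by (simp only: sets_eq_imp_space_eq[OF sets_excursion])
      show "(\<integral>\<^sup>+y. indicator (space S - {p}) y * ennreal (W y) \<partial>K x) = ennreal (\<integral>y. W y \<partial>K x)"
        unfolding drop[OF x] by (rule nn_integral_K_W[OF x])
    qed
    also have "\<dots> \<le> (\<integral>\<^sup>+x. ennreal (1 - \<gamma>) * ennreal (W x) \<partial>excursion (Suc n))"
    proof (rule nn_integral_mono_AE)
      have s: "sets (excursion n \<bind> K) = sets S" by (rule sets_bind_K[OF sets_excursion])
      have "AE x in excursion (Suc n). x \<in> space S - {p}"
        unfolding excursion.simps
      proof (subst AE_density)
        show "(indicator (space S - {p}) :: 'a \<Rightarrow> ennreal) \<in> borel_measurable (excursion n \<bind> K)"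
        proof (rule borel_measurable_indicator)
          show "space S - {p} \<in> sets (excursion n \<bind> K)" unfolding s using p by auto
        qed
        show "AE x in excursion n \<bind> K. 0 < (indicator (space S - {p}) x :: ennreal) \<longrightarrow> x \<in> space S - {p}"
          by (auto simp: indicator_def)
      qed
      then show "AE x in excursion (Suc n). ennreal (\<integral>y. W y \<partial>K x) \<le> ennreal (1 - \<gamma>) * ennreal (W x)"
      proof eventually_elim
        case (elim x)
        then show ?case using KW[of x] W(2)[of x] \<gamma> by (auto simp: ennreal_mult'[symmetric] intro: ennreal_leI)
      qed
    qed
    also have "\<dots> = ennreal (1 - \<gamma>) * (\<integral>\<^sup>+x. ennreal (W x) \<partial>excursion (Suc n))"
      by (rule nn_integral_cmult) (use Wm measurable_cong_sets[OF sets_excursion refl] in blast)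
    also have "\<dots> \<le> ennreal (1 - \<gamma>) * ennreal ((\<integral>y. W y \<partial>K p) * (1 - \<gamma>) ^ n)"
      by (rule mult_left_mono[OF Suc.IH]) simp
    also have "\<dots> = ennreal ((\<integral>y. W y \<partial>K p) * (1 - \<gamma>) ^ Suc n)"
      using \<gamma> by (simp add: ennreal_mult'[symmetric] mult_ac)
    finally show ?case .
  }
qed

definition occupation where "occupation = sum_measure S excursion"

lemma occupation_W: "(\<integral>\<^sup>+x. ennreal (W x) \<partial>occupation) < \<infinity>"
proof -
  have Wm: "(\<lambda>x. ennreal (W x)) \<in> borel_measurable S" using W by simp
  define w where "w = (\<integral>y. W y \<partial>K p)"
  have w0: "0 \<le> w" unfolding w_def using W(2) space_K[OF p(1)] by (intro integral_nonneg_AE AE_I2) auto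
  have "(\<integral>\<^sup>+x. ennreal (W x) \<partial>occupation) = (\<Sum>n. \<integral>\<^sup>+x. ennreal (W x) \<partial>excursion n)"
    unfolding occupation_def by (rule nn_integral_sum_measure[OF sets_excursion Wm])
  also have "\<dots> = (\<integral>\<^sup>+x. ennreal (W x) \<partial>excursion 0) + (\<Sum>n. \<integral>\<^sup>+x. ennreal (W x) \<partial>excursion (Suc n))"
    by (subst suminf_offset[of _ 1]) (auto intro: summableI)
  also have "(\<integral>\<^sup>+x. ennreal (W x) \<partial>excursion 0) = 0"
    unfolding excursion.simps by (subst nn_integral_return[OF p(1) Wm]) (simp add: W(3))
  also have "0 + (\<Sum>n. \<integral>\<^sup>+x. ennreal (W x) \<partial>excursion (Suc n)) \<le> (\<Sum>n. ennreal (w * (1 - \<gamma>) ^ n))"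
    unfolding w_def add_0 by (intro suminf_le excursion_W summableI)
  also have "\<dots> = ennreal (w * (1 / (1 - (1 - \<gamma>))))"
    using \<gamma> w0 by (intro suminf_ennreal_eq sums_mult geometric_sums) auto
  also have "\<dots> < \<infinity>" by simp
  finally show ?thesis .
qed

lemma space_occupation: "space occupation = space S" and sets_occupation: "sets occupation = sets S"
  by (simp_all add: occupation_def)

lemma emeasure_excursion_0: "A \<in> sets S \<Longrightarrow> emeasure (excursion 0) A = indicator A p"
  unfolding excursion.simps(1) by (rule emeasure_return)

lemma emeasure_excursion_Suc_p: "emeasure (excursion (Suc n)) {p} = 0"
proof -
  have s: "sets (excursion n \<bind> K) = sets S" by (rule sets_bind_K[OF sets_excursion])
  have "space S - {p} \<in> sets (excursion n \<bind> K)" unfolding s using p by auto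
  then have i: "(indicator (space S - {p}) :: 'a \<Rightarrow> ennreal) \<in> borel_measurable (excursion n \<bind> K)"
    by (rule borel_measurable_indicator)
  have "emeasure (excursion (Suc n)) {p} = (\<integral>\<^sup>+x. indicator (space S - {p}) x * indicator {p} x \<partial>(excursion n \<bind> K))"
    unfolding excursion.simps(2) by (rule emeasure_density[OF i]) (use p s in simp)
  also have "\<dots> = (\<integral>\<^sup>+x. 0 \<partial>(excursion n \<bind> K))" by (rule nn_integral_cong) (simp add: indicator_def)
  finally show ?thesis by simp
qed

lemma occupation_ge_1: "1 \<le> emeasure occupation (space S)"
proof -
  have "emeasure (excursion 0) (space S) \<le> (\<Sum>n. emeasure (excursion n) (space S))"
    using sum_le_suminf[of "\<lambda>n. emeasure (excursion n) (space S)" "{0}"]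
    by (simp add: summableI del: excursion.simps)
  then show ?thesis
    using p unfolding occupation_def emeasure_sum_measure[OF sets_excursion sets.top] emeasure_excursion_0[OF sets.top] by simp
qed

text \<open>Off p the function W is at least 1, so \<open>occupation_W\<close> bounds the mass
  there; p itself is counted once, at time 0.\<close>

lemma occupation_finite: "emeasure occupation (space S) < \<infinity>"
proof -
  have "(\<integral>\<^sup>+x. indicator (space S - {p}) x \<partial>occupation) \<le> (\<integral>\<^sup>+x. ennreal (W x) \<partial>occupation)"
  proof (rule nn_integral_mono)
    fix x assume "x \<in> space occupation"
    then have "x \<in> space S" by (simp only: space_occupation)
    then have "x \<noteq> p \<Longrightarrow> 1 \<le> W x" using VW(2)[of x] V(2)[of x] by linarith
    then show "indicator (space S - {p}) x \<le> ennreal (W x)" by (auto simp: indicator_def)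
  qed
  also note occupation_W
  finally have 1: "emeasure occupation (space S - {p}) < \<infinity>"
    using p sets_occupation by (subst (asm) nn_integral_indicator) auto
  have "emeasure occupation {p} = (\<Sum>n. emeasure (excursion n) {p})"
    unfolding occupation_def by (rule emeasure_sum_measure[OF sets_excursion p(2)])
  also have "\<dots> = (\<Sum>n\<in>{0}. emeasure (excursion n) {p})"
  proof (rule suminf_finite)
    show "emeasure (excursion n) {p} = 0" if "n \<notin> {0}" for n
      using emeasure_excursion_Suc_p[of "n - 1"] that by (simp del: excursion.simps)
  qed simp
  also have "\<dots> = 1" using emeasure_excursion_0[OF p(2)] by (simp del: excursion.simps)
  finally have 2: "emeasure occupation {p} = 1" .
  have "emeasure occupation (space S) = emeasure occupation ((space S - {p}) \<union> {p})"
    using p by (intro arg_cong[where f = "emeasure occupation"]) auto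
  also have "\<dots> \<le> emeasure occupation (space S - {p}) + emeasure occupation {p}"
    by (rule emeasure_subadditive) (use p sets_occupation in auto)
  also have "\<dots> < \<infinity>" using 1 2 by simp
  finally show ?thesis .
qed

text \<open>One step turns each excursion law into the next one plus the mass that returns to p.
  Since the occupation measure gives p mass 1, invariance amounts to a total returning mass of
  1.\<close>

lemma occupation_invariant:
  assumes A: "A \<in> sets S"
  shows "(\<integral>\<^sup>+x. emeasure (K x) A \<partial>occupation) = emeasure occupation A"
proof -
  define E where "E B = (\<lambda>n. \<integral>\<^sup>+x. emeasure (K x) B \<partial>excursion n)" for B
  have m: "(\<lambda>x. emeasure (K x) B) \<in> borel_measurable S" if "B \<in> sets S" for B
    using measurable_emeasure_subprob_algebra[OF that] K_sub[OF refl] by (rule measurable_compose[rotated])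
  have occ: "(\<integral>\<^sup>+x. emeasure (K x) B \<partial>occupation) = (\<Sum>n. E B n)" if "B \<in> sets S" for B
    unfolding occupation_def E_def by (rule nn_integral_sum_measure[OF sets_excursion m[OF that]])
  have split: "E B n = emeasure (excursion (Suc n)) B + indicator B p * E {p} n" if B: "B \<in> sets S" for B n
  proof -
    have i: "(indicator B :: 'a \<Rightarrow> ennreal) \<in> borel_measurable S" using B by simp
    have "emeasure (excursion (Suc n)) B = (\<integral>\<^sup>+x. indicator B x \<partial>excursion (Suc n))"
      using B sets_excursion[of "Suc n"] by (simp del: excursion.simps)
    also have "\<dots> = (\<integral>\<^sup>+x. \<integral>\<^sup>+y. indicator (space S - {p}) y * indicator B y \<partial>K x \<partial>excursion n)"
      by (rule nn_integral_excursion_Suc[OF i])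
    also have "\<dots> = (\<integral>\<^sup>+x. emeasure (K x) (B - {p}) \<partial>excursion n)"
    proof (rule nn_integral_cong)
      fix x assume "x \<in> space (excursion n)"
      then have x: "x \<in> space S" using sets_eq_imp_space_eq[OF sets_excursion] by auto
      have "(\<integral>\<^sup>+y. indicator (space S - {p}) y * indicator B y \<partial>K x) = (\<integral>\<^sup>+y. indicator (B - {p}) y \<partial>K x)"
        by (rule nn_integral_cong) (use space_K[OF x] in \<open>auto simp: indicator_def\<close>)
      also have "\<dots> = emeasure (K x) (B - {p})" using B p sets_K[OF x] by (intro nn_integral_indicator) auto
      finally show "(\<integral>\<^sup>+y. indicator (space S - {p}) y * indicator B y \<partial>K x) = emeasure (K x) (B - {p})" .
    qed
    finally have 1: "emeasure (excursion (Suc n)) B = (\<integral>\<^sup>+x. emeasure (K x) (B - {p}) \<partial>excursion n)" .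
    have "E B n = (\<integral>\<^sup>+x. emeasure (K x) (B - {p}) + indicator B p * emeasure (K x) {p} \<partial>excursion n)"
      unfolding E_def
    proof (rule nn_integral_cong)
      fix x assume "x \<in> space (excursion n)"
      then have x: "x \<in> space S" using sets_eq_imp_space_eq[OF sets_excursion] by auto
      show "emeasure (K x) B = emeasure (K x) (B - {p}) + indicator B p * emeasure (K x) {p}"
      proof (cases "p \<in> B")
        case True
        have "emeasure (K x) ((B - {p}) \<union> {p}) = emeasure (K x) (B - {p}) + emeasure (K x) {p}"
          by (rule plus_emeasure[symmetric]) (use B p sets_K[OF x] in auto)
        moreover have "(B - {p}) \<union> {p} = B" using True by auto
        ultimately show ?thesis using True by simp
      qed simp
    qed
    also have "\<dots> = (\<integral>\<^sup>+x. emeasure (K x) (B - {p}) \<partial>excursion n) + indicator B p * E {p} n"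
    proof -
      have m1: "(\<lambda>x. emeasure (K x) (B - {p})) \<in> borel_measurable (excursion n)"
        using m[of "B - {p}"] B p measurable_cong_sets[OF sets_excursion refl] by blast
      have m2: "(\<lambda>x. emeasure (K x) {p}) \<in> borel_measurable (excursion n)"
        using m[OF p(2)] measurable_cong_sets[OF sets_excursion refl] by blast
      show ?thesis unfolding E_def nn_integral_cmult[OF m2, symmetric]
        by (rule nn_integral_add[OF m1]) (use m2 in simp)
    qed
    finally show ?thesis using 1 by simp
  qed
  \<comment> \<open>The probability of ever returning to p.\<close>
  define t where "t = (\<Sum>n. E {p} n)"
  have sum: "(\<Sum>n. E B n) = (\<Sum>n. emeasure (excursion (Suc n)) B) + indicator B p * t" if B: "B \<in> sets S" for B
  proof -
    have "(\<Sum>n. E B n) = (\<Sum>n. emeasure (excursion (Suc n)) B + indicator B p * E {p} n)" using split[OF B] by simp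
    also have "\<dots> = (\<Sum>n. emeasure (excursion (Suc n)) B) + (\<Sum>n. indicator B p * E {p} n)"
      by (rule suminf_add[symmetric]) (auto intro: summableI)
    finally show ?thesis by (simp add: t_def)
  qed
  have occ1: "emeasure occupation B = indicator B p + (\<Sum>n. emeasure (excursion (Suc n)) B)" if B: "B \<in> sets S" for B
  proof -
    have "emeasure occupation B = (\<Sum>n. emeasure (excursion n) B)"
      unfolding occupation_def by (rule emeasure_sum_measure[OF sets_excursion B])
    also have "\<dots> = emeasure (excursion 0) B + (\<Sum>n. emeasure (excursion (Suc n)) B)"
      by (subst suminf_offset[of _ 1]) (auto intro: summableI)
    finally show ?thesis using B by (simp add: emeasure_return)
  qed
  \<comment> \<open>Recurrence by conservation of mass: a step preserves the total mass of the
    occupation measure, and as this is finite, the common series cancels.\<close>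
  have "t = 1"
  proof -
    have "(\<Sum>n. E (space S) n) = emeasure occupation (space S)"
    proof -
      have "(\<integral>\<^sup>+x. emeasure (K x) (space S) \<partial>occupation) = (\<integral>\<^sup>+x. 1 \<partial>occupation)"
      proof (rule nn_integral_cong)
        fix x assume "x \<in> space occupation"
        then have x: "x \<in> space S" by (simp add: space_occupation)
        show "emeasure (K x) (space S) = 1" using prob_space.emeasure_space_1[OF prob_K[OF x]] space_K[OF x] by simp
      qed
      then show ?thesis using occ[of "space S"] by (simp add: space_occupation)
    qed
    then have e: "(\<Sum>n. emeasure (excursion (Suc n)) (space S)) + t = 1 + (\<Sum>n. emeasure (excursion (Suc n)) (space S))"
      unfolding sum[OF sets.top] occ1[OF sets.top] using p by (simp del: excursion.simps)
    have "(\<Sum>n. emeasure (excursion (Suc n)) (space S)) \<noteq> \<infinity>"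
      proof
      assume "(\<Sum>n. emeasure (excursion (Suc n)) (space S)) = \<infinity>"
      then have "emeasure occupation (space S) = \<infinity>" unfolding occ1[OF sets.top] by simp
      with occupation_finite show False by simp
    qed
    with e show ?thesis unfolding add.commute[of 1] ennreal_add_left_cancel by blast
  qed
  then show ?thesis using occ[OF A] sum[OF A] occ1[OF A] by (simp add: add.commute)
qed

lemma stationary_exists: "\<exists>\<pi>. stationary_distribution S K \<pi> \<and> integrable \<pi> V"
proof -
  \<comment> \<open>The mean return time to p; dividing by it is Kac's formula.\<close>
  define T where "T = emeasure occupation (space S)"
  have "1 \<le> T" "T < \<infinity>" unfolding T_def by (rule occupation_ge_1 occupation_finite)+
  then have T: "T \<noteq> 0" "T \<noteq> \<infinity>" by auto
  define \<pi> where "\<pi> = scale_measure (inverse T) occupation"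
  have s: "sets \<pi> = sets S" "space \<pi> = space S"
    by (simp_all add: \<pi>_def sets_occupation space_occupation space_scale_measure)
  have "inverse T \<noteq> top" using T(1) by simp
  then have iT: "inverse T < \<infinity>" unfolding infinity_ennreal_def by (rule top.not_eq_extremum[THEN iffD1])
  have pr: "prob_space \<pi>"
  proof
    have "emeasure \<pi> (space \<pi>) = inverse T * T" unfolding s(2) by (simp add: \<pi>_def T_def)
    also have "\<dots> = T / T" by (simp add: divide_ennreal_def mult.commute)
    also have "\<dots> = 1" using ennreal_divide_self[of T] T \<open>T < \<infinity>\<close> by simp
    finally show "emeasure \<pi> (space \<pi>) = 1" .
  qed
  have inv: "\<pi> \<bind> K = \<pi>"
  proof (rule measure_eqI)
    show "sets (\<pi> \<bind> K) = sets \<pi>" using sets_bind_K[OF s(1)] s by simp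
    fix A assume "A \<in> sets (\<pi> \<bind> K)"
    then have A: "A \<in> sets S" using sets_bind_K[OF s(1)] by simp
    have m: "(\<lambda>x. emeasure (K x) A) \<in> borel_measurable occupation"
      using measurable_compose[OF K_sub[OF sets_occupation] measurable_emeasure_subprob_algebra[OF A]] .
    have "emeasure (\<pi> \<bind> K) A = (\<integral>\<^sup>+x. emeasure (K x) A \<partial>\<pi>)"
      by (rule emeasure_bind[OF _ K_sub[OF s(1)] A]) (use s ne in simp)
    also have "\<dots> = inverse T * (\<integral>\<^sup>+x. emeasure (K x) A \<partial>occupation)"
      unfolding \<pi>_def by (rule nn_integral_scale_measure[OF m])
    also have "\<dots> = emeasure \<pi> A" unfolding occupation_invariant[OF A] by (simp add: \<pi>_def)
    finally show "emeasure (\<pi> \<bind> K) A = emeasure \<pi> A" .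
  qed
  have "W \<in> borel_measurable occupation"
    using W(1) measurable_cong_sets[OF sets_occupation refl] by blast
  then have Wm: "(\<lambda>x. ennreal (W x)) \<in> borel_measurable occupation" by simp
  have "(\<integral>\<^sup>+x. ennreal (W x) \<partial>\<pi>) = inverse T * (\<integral>\<^sup>+x. ennreal (W x) \<partial>occupation)"
    unfolding \<pi>_def by (rule nn_integral_scale_measure[OF Wm])
  also have "\<dots> < \<infinity>" using iT occupation_W by (simp add: ennreal_mult_less_top)
  finally have nW: "(\<integral>\<^sup>+x. ennreal (W x) \<partial>\<pi>) < \<infinity>" .
  have mW: "W \<in> borel_measurable \<pi>" "V \<in> borel_measurable \<pi>"
    using W(1) V(1) measurable_cong_sets[OF s(1) refl] by blast+
  have "(\<integral>\<^sup>+x. ennreal (norm (W x)) \<partial>\<pi>) = (\<integral>\<^sup>+x. ennreal (W x) \<partial>\<pi>)"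
    by (rule nn_integral_cong) (use W(2) s in simp)
  then have iW: "integrable \<pi> W" using nW mW unfolding integrable_iff_bounded by simp
  interpret prob_space \<pi> by (rule pr)
  have "integrable \<pi> V"
  \<comment> \<open>W dominates V off p but vanishes at p, hence the added constant.\<close>
  proof (rule Bochner_Integration.integrable_bound[of _ "\<lambda>x. V p + W x"])
    show "AE x in \<pi>. norm (V x) \<le> norm (V p + W x)"
    proof (rule AE_I2)
      fix x assume "x \<in> space \<pi>"
      then have x: "x \<in> space S" using s by simp
      have "V x \<le> V p + W x" using VW(2)[OF x] W(2)[OF x] V(2)[OF p(1)] by (cases "x = p") auto
      then show "norm (V x) \<le> norm (V p + W x)" using V(2)[OF x] by simp
    qed
  qed (use iW mW in auto)
  then show ?thesis using pr inv s(1) unfolding stationary_distribution_def by blast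
qed

theorem geometric_ergodicity:
  "\<exists>\<pi>. stationary_distribution S K \<pi> \<and> (\<forall>\<pi>'. stationary_distribution S K \<pi>' \<longrightarrow> \<pi>' = \<pi>) \<and>
     (\<forall>x\<in>space S. \<forall>n. V_norm_diff V (kernel_pow S K n x) \<pi> \<le> ennreal (2 * D * (1 + b / c) * V x * (1 - \<gamma>) ^ n))"
  using stationary_exists stationary_unique V_norm_bound by blast

end

section \<open>The clamped chain\<close>

lemma powr_le_V:
  fixes x \<delta> :: real
  assumes "0 \<le> x" "1 < \<delta>" "\<delta> < 2" shows "x powr (2 - \<delta>) \<le> 1 + x\<^sup>2"
proof (cases "x \<le> 1")
  case True
  then have "x powr (2 - \<delta>) \<le> 1 powr (2 - \<delta>)" using assms by (intro powr_mono2) auto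
  then show ?thesis by (simp add: add_increasing2)
next
  case False
  then have "x powr (2 - \<delta>) \<le> x powr 2" using assms by (intro powr_mono) auto
  then show ?thesis using False by simp
qed

lemma lyapunov_pos: "0 < x \<Longrightarrow> lyapunov \<delta> kap B x = 1 + kap * scale_fn \<delta> B x + x\<^sup>2"
  by (simp add: lyapunov_def)

lemma lyapunov_le:
  assumes "1 < \<delta>" "\<delta> < 2" "0 \<le> B" "0 \<le> kap" "0 \<le> x"
  shows "lyapunov \<delta> kap B x \<le> (1 + kap / (2 - \<delta>)) * (1 + x\<^sup>2)"
proof (cases "x = 0")
  case False
  have "scale_fn \<delta> B x \<le> (1 + x\<^sup>2) / (2 - \<delta>)"
    using scale_fn_le[OF assms(1-3,5)] powr_le_V[OF assms(5,1,2)] assms(2)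
    by (meson divide_right_mono diff_ge_0_iff_ge less_imp_le order_trans)
  then have "kap * scale_fn \<delta> B x \<le> kap * ((1 + x\<^sup>2) / (2 - \<delta>))" using assms(4) by (rule mult_left_mono)
  then show ?thesis using False by (simp add: lyapunov_def distrib_right)
qed (use assms in \<open>simp add: lyapunov_def\<close>)

lemma lyapunov_ge: assumes "1 < \<delta>" "\<delta> < 2" "0 \<le> B" "0 \<le> kap" "0 < x" shows "1 + x\<^sup>2 \<le> lyapunov \<delta> kap B x"
  using assms scale_fn_nonneg[OF assms(1-3), of x] by (simp add: lyapunov_def)

lemma lyapunov_nonneg: assumes "1 < \<delta>" "\<delta> < 2" "0 \<le> B" "0 \<le> kap" "0 \<le> x" shows "0 \<le> lyapunov \<delta> kap B x"
  using assms scale_fn_nonneg[OF assms(1-3), of x] by (simp add: lyapunov_def)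

lemma lyapunov_mono: assumes "1 < \<delta>" "\<delta> < 2" "0 \<le> B" "0 \<le> kap" "0 \<le> x" "x \<le> y" shows "lyapunov \<delta> kap B x \<le> lyapunov \<delta> kap B y"
proof (cases "x = 0")
  case True
  then show ?thesis using lyapunov_nonneg[OF assms(1-4), of y] assms by (simp add: lyapunov_def)
next
  case False
  then have xy: "0 < x" "0 < y" using assms by auto
  have "x\<^sup>2 \<le> y\<^sup>2" using assms by (intro power_mono) auto
  moreover have "kap * scale_fn \<delta> B x \<le> kap * scale_fn \<delta> B y" using scale_fn_mono[OF assms(1-3,5,6)] assms(4) by (rule mult_left_mono)
  ultimately show ?thesis unfolding lyapunov_pos[OF xy(1)] lyapunov_pos[OF xy(2)] by linarith
qed

text \<open>Young's inequality absorbs the cross term \<open>2 h M x\<close>.\<close>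

lemma shifted_square_bound:
  fixes lam M h x s C0 :: real
  assumes lam: "0 < lam" and M: "0 \<le> M" and h: "0 < h" "h \<le> 1" "lam * h \<le> 1" and C0: "0 \<le> C0"
    and s: "0 \<le> x" "0 \<le> s" "s \<le> x + h * M"
  shows "(1 - lam * h) * (s\<^sup>2 + h * C0) \<le> x\<^sup>2 - lam / 2 * h * x\<^sup>2 + h * (2 * M\<^sup>2 / lam + M\<^sup>2 + C0)"
proof -
  define r where "r = h * (2 * M * x) + h\<^sup>2 * M\<^sup>2 + h * C0"
  have r: "0 \<le> r" using M h C0 s by (simp add: r_def)
  have "s\<^sup>2 \<le> (x + h * M)\<^sup>2" using s by (intro power_mono) auto
  then have "s\<^sup>2 + h * C0 \<le> x\<^sup>2 + r" by (simp add: r_def power2_eq_square algebra_simps)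
  then have "(1 - lam * h) * (s\<^sup>2 + h * C0) \<le> (1 - lam * h) * (x\<^sup>2 + r)"
    using h by (intro mult_left_mono) auto
  also have "\<dots> = x\<^sup>2 - lam * h * x\<^sup>2 + r - lam * h * r" by (simp add: algebra_simps)
  also have "\<dots> \<le> x\<^sup>2 - lam * h * x\<^sup>2 + r" using lam h r by simp
  finally have 1: "(1 - lam * h) * (s\<^sup>2 + h * C0) \<le> x\<^sup>2 - lam * h * x\<^sup>2 + r" .
  have "0 \<le> (lam * x - 2 * M)\<^sup>2" by simp
  then have "4 * lam * M * x \<le> lam\<^sup>2 * x\<^sup>2 + 4 * M\<^sup>2" by (simp add: power2_eq_square algebra_simps)
  then have "(4 * lam * M * x) / (2 * lam) \<le> (lam\<^sup>2 * x\<^sup>2 + 4 * M\<^sup>2) / (2 * lam)" using lam by (intro divide_right_mono) auto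
  then have "2 * M * x \<le> lam / 2 * x\<^sup>2 + 2 * M\<^sup>2 / lam" using lam by (simp add: add_divide_distrib power2_eq_square)
  then have 2: "h * (2 * M * x) \<le> h * (lam / 2 * x\<^sup>2 + 2 * M\<^sup>2 / lam)" using h by (intro mult_left_mono) auto
  have "h\<^sup>2 \<le> h" using h by (simp add: power2_eq_square mult_left_le)
  then have 3: "h\<^sup>2 * M\<^sup>2 \<le> h * M\<^sup>2" by (intro mult_right_mono) auto
  have "lam * h * x\<^sup>2 = lam / 2 * h * x\<^sup>2 + h * (lam / 2 * x\<^sup>2)" by simp
  with 1 2 3 show ?thesis unfolding r_def by (simp only: distrib_left)
qed

section \<open>Small step sizes and the drift inequality\<close>

lemma eventually_at_right_0_E:
  fixes Q :: "real \<Rightarrow> bool"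
  assumes "eventually Q (at_right 0)"
  obtains h0 where "0 < h0" "\<And>h. 0 < h \<Longrightarrow> h \<le> h0 \<Longrightarrow> Q h"
proof -
  obtain b where b: "0 < b" "\<And>h. 0 < h \<Longrightarrow> h < b \<Longrightarrow> Q h"
    using assms by (auto simp: eventually_at_right_field)
  show thesis by (rule that[of "b / 2"]) (use b in auto)
qed

lemma eventually_small:
  assumes "((f :: real \<Rightarrow> real) \<longlongrightarrow> 0) (at_right 0)" "0 < \<epsilon>"
  shows "eventually (\<lambda>h. f h \<le> \<epsilon>) (at_right 0)"
  using order_tendstoD(2)[OF assms] by (rule eventually_mono) simp

lemma tendsto_powr_0_right:
  assumes "0 < a" shows "((\<lambda>h::real. h powr a) \<longlongrightarrow> 0) (at_right 0)"
proof -
  have "((\<lambda>h::real. h powr a) \<longlongrightarrow> 0 powr a) (at_right 0)"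
  proof (rule tendsto_powr')
    have "eventually (\<lambda>h::real. 0 \<le> h) (at_right 0)"
      using eventually_at_right_less[of "0::real"] by (rule eventually_mono) simp
    then show "0 \<noteq> (0::real) \<or> 0 < a \<and> eventually (\<lambda>h::real. 0 \<le> h) (at_right 0)" using assms by blast
  qed (rule tendsto_ident_at tendsto_const)+
  then show ?thesis by simp
qed

lemma tendsto_0_right_ident: "((\<lambda>h::real. h) \<longlongrightarrow> 0) (at_right 0)"
  by (rule tendsto_ident_at)

text \<open>\<open>e\<close> fixes the scale \<open>e * sqrt h\<close> below which the atom of the resolvent kernel has mass at least
  one half. Above it, the tangent bound for \<open>dscale_fn\<close> and the choice of \<open>B\<close> absorb the drift \<open>M\<close>; at
  moderate distances the choice of \<open>kap\<close> beats the constant in the drift of \<open>x\<^sup>2\<close>.\<close>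

lemma lyapunov_drift:
  fixes lam \<beta> \<delta> \<mu> M :: real
  assumes lam: "0 < lam" and beta: "0 < \<beta>" and mu: "0 < \<mu>" and delta: "1 < \<delta>" "\<delta> < 2" and M: "0 \<le> M"
  shows "\<exists>B kap c h0. 0 \<le> B \<and> 0 \<le> kap \<and> 0 < c \<and> 0 < h0 \<and> (\<forall>h x s. 0 < h \<longrightarrow> h \<le> h0 \<longrightarrow>
    2 * lam * h \<le> 1 \<and> h \<le> 1 \<and> c * h < 1 \<and>
    (0 < x \<longrightarrow> 0 \<le> s \<longrightarrow> s \<le> x + h * M \<longrightarrow>
      (\<integral>y. lyapunov \<delta> kap B y \<partial>sticky_resolvent lam \<beta> \<delta> \<mu> h s) \<le> (1 - c * h) * lyapunov \<delta> kap B x))"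
proof -
  define C0 where "C0 = 2 * \<delta> / \<beta>"
  define C4 where "C4 = 4 * (4 * (\<delta> + 2) / \<beta>)"
  define C1 where "C1 = 2 * M\<^sup>2 / lam + M\<^sup>2 + C0"
  define A where "A = C4 powr (\<delta> / 2)"
  have C0: "0 < C0" and C4: "0 < C4" using delta beta by (auto simp: C0_def C4_def)
  have C1: "0 \<le> C1" using lam C0 by (simp add: C1_def)
  have A: "0 < A" using C4 by (simp add: A_def)
  have "((\<lambda>e. A * e powr (2 - \<delta>) + e ^ 4 / C4) \<longlongrightarrow> A * 0 + 0 ^ 4 / C4) (at_right 0)"
    by (intro tendsto_intros tendsto_powr_0_right tendsto_0_right_ident) (use delta C4 in auto)
  then have "((\<lambda>e. A * e powr (2 - \<delta>) + e ^ 4 / C4) \<longlongrightarrow> 0) (at_right 0)" by simp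
  then have "eventually (\<lambda>e. A * e powr (2 - \<delta>) + e ^ 4 / C4 \<le> 3 / 32 * C0) (at_right 0)"
    by (rule eventually_small) (use C0 in simp)
  \<comment> \<open>A starting point up to ee sqrt h spends half of the budget in
    \<open>atom_bound\<close>, the term with \<mu> the other half: 3/32 + 3/32 is half of 3/8, which
    makes \<open>1 - \<rho>\<close> at most 1/2.\<close>
  then obtain ee where ee: "0 < ee" "A * ee powr (2 - \<delta>) + ee ^ 4 / C4 \<le> 3 / 32 * C0"
    by (rule eventually_at_right_0_E) blast
  \<comment> \<open>Halved because the Euler step moves x < e sqrt h by up to h M \<le> e sqrt
    h.\<close>
  define e where "e = ee / 2"
  have e: "0 < e" using ee by (simp add: e_def)
  \<comment> \<open>Bound for t / x when x \<ge> e sqrt h, with t the root mean square bound below: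
    one unit for x, one for h M, the rest for the variance C0 h.\<close>
  define KK where "KK = 2 + C0 / (2 * e\<^sup>2)"
  have KK: "2 \<le> KK" using C0 e by (simp add: KK_def)
  \<comment> \<open>Makes B / \<beta> times \<open>dscale_fn\<close> at t at least M + 1 times its
    value at x: KK compensates the power and exp 1 the exponential. M of this cancels the drift, the
    remaining 1 is the gain.\<close>
  define B where "B = \<beta> * (M + 1) * (exp 1 * KK)"
  have B: "0 < B" using beta M KK by (simp add: B_def)
  define X0 where "X0 = sqrt (4 * (C1 + 1) / lam)"
  have X0: "0 < X0" "lam / 4 * X0\<^sup>2 = C1 + 1" using C1 lam by (auto simp: X0_def)
  have dX0: "0 < dscale_fn \<delta> B X0" by (rule dscale_fn_pos[OF delta less_imp_le[OF B] X0(1)])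
  \<comment> \<open>Up to X0 the gain kap g' is at least C1 + 1 since g' is decreasing; beyond X0 a
    quarter of lam x^2 takes over.\<close>
  define kap where "kap = (C1 + 1) / dscale_fn \<delta> B X0"
  have kap: "0 < kap" using dX0 C1 by (simp add: kap_def)
  \<comment> \<open>The net gain will be h (1 + lam / 4 x^2), to be compared with the bound of
    \<open>lyapunov_le\<close>.\<close>
  define c where "c = min 1 (lam / 4) / (1 + kap / (2 - \<delta>))"
  have c: "0 < c" using lam kap delta by (simp add: c_def add_pos_pos)
  have B0: "0 \<le> B" and kap0: "0 \<le> kap" using B kap by auto

  have t1: "((\<lambda>h. A * (\<mu> * h powr (\<delta> / 2))) \<longlongrightarrow> A * (\<mu> * 0)) (at_right 0)"
    by (intro tendsto_intros tendsto_powr_0_right) (use delta in auto)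
  have t2: "((\<lambda>h. B * (h * M + C0 * sqrt h / (2 * e))) \<longlongrightarrow> B * (0 * M + C0 * sqrt 0 / (2 * e))) (at_right 0)"
    by (intro tendsto_intros tendsto_0_right_ident) (use e in auto)
  have t3: "((\<lambda>h. kap * (h * \<mu> + 2 * (B / \<beta>) * (C0 powr ((1 - \<delta>) / 2) * h powr ((3 - \<delta>) / 2))))
      \<longlongrightarrow> kap * (0 * \<mu> + 2 * (B / \<beta>) * (C0 powr ((1 - \<delta>) / 2) * 0))) (at_right 0)"
    by (intro tendsto_intros tendsto_powr_0_right tendsto_0_right_ident) (use delta in auto)
  have t4: "((\<lambda>h. kap * (ee powr (2 - \<delta>) * h powr (1 - \<delta> / 2) / (2 - \<delta>) + h * \<mu>) + ee\<^sup>2 * h + h * C0)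
      \<longlongrightarrow> kap * (ee powr (2 - \<delta>) * 0 / (2 - \<delta>) + 0 * \<mu>) + ee\<^sup>2 * 0 + 0 * C0) (at_right 0)"
    by (intro tendsto_intros tendsto_powr_0_right tendsto_0_right_ident) (use delta in auto)
  have t5: "((\<lambda>h. sqrt h * M) \<longlongrightarrow> sqrt 0 * M) (at_right 0)"
    by (intro tendsto_intros tendsto_0_right_ident)
  have t6: "((\<lambda>h. c * h) \<longlongrightarrow> c * 0) (at_right 0)" "((\<lambda>h. 2 * lam * h) \<longlongrightarrow> 2 * lam * 0) (at_right 0)"
    by (intro tendsto_intros tendsto_0_right_ident)+
  \<comment> \<open>All constants are fixed by now, and every term that must be small vanishes with
    h.\<close>
  have "eventually (\<lambda>h. A * (\<mu> * h powr (\<delta> / 2)) \<le> 3 / 32 * C0 \<and> B * (h * M + C0 * sqrt h / (2 * e)) \<le> 1 \<and>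
      kap * (h * \<mu> + 2 * (B / \<beta>) * (C0 powr ((1 - \<delta>) / 2) * h powr ((3 - \<delta>) / 2))) \<le> 1 \<and>
      kap * (ee powr (2 - \<delta>) * h powr (1 - \<delta> / 2) / (2 - \<delta>) + h * \<mu>) + ee\<^sup>2 * h + h * C0 \<le> 1 / 4 \<and>
      sqrt h * M \<le> e \<and> c * h \<le> 1 / 4 \<and> 2 * lam * h \<le> 1 \<and> h \<le> 1) (at_right 0)"
    by (intro eventually_conj eventually_small)
      (use t1 t2 t3 t4 t5 t6 tendsto_0_right_ident C0 e in simp_all)
  then obtain h0 where h0: "0 < h0" and H: "\<And>h. 0 < h \<Longrightarrow> h \<le> h0 \<Longrightarrow>
      A * (\<mu> * h powr (\<delta> / 2)) \<le> 3 / 32 * C0 \<and> B * (h * M + C0 * sqrt h / (2 * e)) \<le> 1 \<and>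
      kap * (h * \<mu> + 2 * (B / \<beta>) * (C0 powr ((1 - \<delta>) / 2) * h powr ((3 - \<delta>) / 2))) \<le> 1 \<and>
      kap * (ee powr (2 - \<delta>) * h powr (1 - \<delta> / 2) / (2 - \<delta>) + h * \<mu>) + ee\<^sup>2 * h + h * C0 \<le> 1 / 4 \<and>
      sqrt h * M \<le> e \<and> c * h \<le> 1 / 4 \<and> 2 * lam * h \<le> 1 \<and> h \<le> 1"
    by (rule eventually_at_right_0_E) blast

  have drift: "(\<integral>y. lyapunov \<delta> kap B y \<partial>sticky_resolvent lam \<beta> \<delta> \<mu> h s) \<le> (1 - c * h) * lyapunov \<delta> kap B x"
    if h: "0 < h" "h \<le> h0" and x: "0 < x" and s: "0 \<le> s" "s \<le> x + h * M" for h x s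
  proof -
    note E = H[OF h]
    interpret S: sticky lam \<beta> \<delta> \<mu> h
      by unfold_locales (use lam beta mu delta h E in auto)
    define \<rho> where "\<rho> = S.\<rho> s"
    have \<rho>: "0 < \<rho>" by (simp add: \<rho>_def S.\<rho>_pos)
    have sq: "sqrt h * sqrt h = h" "0 < sqrt h" using h by auto
    have hM: "h * M \<le> e * sqrt h"
    proof -
      have "h * M = (sqrt h * M) * sqrt h" using sq(1) by (metis mult.assoc mult.commute)
      also have "\<dots> \<le> e * sqrt h" using E sq by (intro mult_right_mono) auto
      finally show ?thesis .
    qed
    have R: "sticky_resolvent lam \<beta> \<delta> \<mu> h s = S.R s" by (simp add: S.R_def)
    have g0: "0 \<le> scale_fn \<delta> B x" using scale_fn_nonneg[OF delta B0, of x] x by simp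
    show ?thesis
    proof (cases "x < e * sqrt h")
      case True
      have s2: "s \<le> ee * sqrt h"
      proof -
        have "s \<le> e * sqrt h + e * sqrt h" using s True hM by linarith
        then show ?thesis by (simp add: e_def)
      qed
      have "3 / 8 * C0 * (1 - \<rho>) \<le> A * (ee powr (2 - \<delta>) + \<mu> * h powr (\<delta> / 2)) + ee ^ 4 / C4"
        using S.atom_bound[OF s(1) s2] ee unfolding C0_def C4_def A_def \<rho>_def by simp
      also have "\<dots> = (A * ee powr (2 - \<delta>) + ee ^ 4 / C4) + A * (\<mu> * h powr (\<delta> / 2))" by (simp add: distrib_left)
      also have "\<dots> \<le> 3 / 32 * C0 + 3 / 32 * C0" using ee(2) E by (intro add_mono) auto
      also have "\<dots> = 3 / 8 * C0 * (1 / 2)" by simp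
      finally have "1 - \<rho> \<le> 1 / 2" using mult_le_cancel_left_pos[of "3 / 8 * C0" "1 - \<rho>" "1 / 2"] C0 by simp
      moreover have "scale_fn \<delta> B s \<le> ee powr (2 - \<delta>) * h powr (1 - \<delta> / 2) / (2 - \<delta>)"
      proof -
        have "s powr (2 - \<delta>) \<le> (ee * sqrt h) powr (2 - \<delta>)" using s s2 delta by (intro powr_mono2) auto
        also have "\<dots> = ee powr (2 - \<delta>) * h powr (1 - \<delta> / 2)"
          using ee h by (simp add: powr_mult powr_half_sqrt[symmetric] powr_powr diff_divide_distrib)
        finally have "s powr (2 - \<delta>) / (2 - \<delta>) \<le> ee powr (2 - \<delta>) * h powr (1 - \<delta> / 2) / (2 - \<delta>)"
          using delta by (intro divide_right_mono) auto
        with scale_fn_le[OF delta B0 s(1)] show ?thesis by linarith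
      qed
      then have "kap * (scale_fn \<delta> B s + h * \<mu>) \<le> kap * (ee powr (2 - \<delta>) * h powr (1 - \<delta> / 2) / (2 - \<delta>) + h * \<mu>)"
        by (rule mult_left_mono[OF add_right_mono kap0])
      moreover have "s\<^sup>2 \<le> ee\<^sup>2 * h"
      proof -
        have "s\<^sup>2 \<le> (ee * sqrt h)\<^sup>2" using s s2 by (intro power_mono) auto
        then show ?thesis using h by (simp add: power_mult_distrib)
      qed
      moreover have "(\<integral>y. lyapunov \<delta> kap B y \<partial>S.R s) \<le> 1 + kap * (scale_fn \<delta> B s + h * \<mu>) + s\<^sup>2 + h * C0 - \<rho>"
        using S.W_bound_near[OF s(1) B0 kap0] by (simp only: C0_def \<rho>_def)
      \<comment> \<open>1 from the constant, at most 1/4 from the small terms, and at least 1/2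
        subtracted for the atom; the Lyapunov function at x > 0 is at least 1.\<close>
      ultimately have "(\<integral>y. lyapunov \<delta> kap B y \<partial>S.R s) \<le> 3 / 4" using E by linarith
      also have "\<dots> \<le> (1 - c * h) * 1" using E by simp
      also have "\<dots> \<le> (1 - c * h) * lyapunov \<delta> kap B x"
        using E kap g0 x by (intro mult_left_mono) (auto simp: lyapunov_pos)
      finally show ?thesis unfolding R .
    next
      case False
      then have xe: "e * sqrt h \<le> x" by simp
      define t where "t = sqrt ((x + h * M)\<^sup>2 + C0 * h)"
      have t2: "t\<^sup>2 = (x + h * M)\<^sup>2 + C0 * h" unfolding t_def using C0 h by simp
      have tpos: "0 < t" unfolding t_def using C0 h by (simp add: add_nonneg_pos)
      have st: "s\<^sup>2 + h * (2 * \<delta> / \<beta>) \<le> t\<^sup>2"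
      proof -
        have "s\<^sup>2 \<le> (x + h * M)\<^sup>2" using s by (intro power_mono) auto
        then show ?thesis unfolding t2 C0_def[symmetric] by (simp add: mult.commute)
      qed
      \<comment> \<open>From sqrt (y^2 + C0 h) \<le> y + C0 h / (2 y) at y = x + h M \<ge> e sqrt h.
        Small h makes B d \<le> 1, which keeps the two exponentials comparable.\<close>
      define d where "d = h * M + C0 * sqrt h / (2 * e)"
      have d0: "0 \<le> d" using h M C0 e by (simp add: d_def)
      have tx: "t \<le> x + d"
      proof -
        have "C0 * h \<le> 2 * x * (C0 * sqrt h / (2 * e))"
        proof -
          have "C0 * h = 2 * (e * sqrt h) * (C0 * sqrt h / (2 * e))" using e sq(1) by simp
          also have "\<dots> \<le> 2 * x * (C0 * sqrt h / (2 * e))" using xe C0 e h by (intro mult_right_mono) auto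
          finally show ?thesis .
        qed
        also have "\<dots> \<le> 2 * (x + h * M) * (C0 * sqrt h / (2 * e))" using h M C0 e by (intro mult_right_mono) auto
        finally have "t\<^sup>2 \<le> (x + h * M)\<^sup>2 + 2 * (x + h * M) * (C0 * sqrt h / (2 * e)) + (C0 * sqrt h / (2 * e))\<^sup>2"
          unfolding t2 using zero_le_power2[of "C0 * sqrt h / (2 * e)"] by linarith
        also have "\<dots> = (x + d)\<^sup>2" unfolding d_def by (simp add: power2_eq_square algebra_simps)
        finally show ?thesis by (rule power2_le_imp_le) (use d0 x in simp)
      qed
      have "t \<le> KK * x"
      proof -
        have "h * M \<le> x" using hM xe by linarith
        moreover have "C0 * sqrt h / (2 * e) \<le> C0 / (2 * e\<^sup>2) * x"
        proof -
          have "C0 * sqrt h / (2 * e) = C0 / (2 * e\<^sup>2) * (e * sqrt h)" using e by (simp add: power2_eq_square)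
          also have "\<dots> \<le> C0 / (2 * e\<^sup>2) * x" using xe C0 by (intro mult_left_mono) auto
          finally show ?thesis .
        qed
        ultimately show ?thesis using tx by (simp add: d_def KK_def distrib_right)
      qed
      have "dscale_fn \<delta> B x \<le> exp 1 * KK * dscale_fn \<delta> B t"
      proof -
        have "x powr (1 - \<delta>) \<le> KK * t powr (1 - \<delta>)"
        proof -
          have "(KK * x) powr (1 - \<delta>) \<le> t powr (1 - \<delta>)" using \<open>t \<le> KK * x\<close> tpos delta by (intro powr_mono2') auto
          then have "KK powr (\<delta> - 1) * (KK powr (1 - \<delta>) * x powr (1 - \<delta>)) \<le> KK powr (\<delta> - 1) * t powr (1 - \<delta>)"
            using KK x by (simp add: powr_mult mult_left_mono)
          moreover have "KK powr (\<delta> - 1) * KK powr (1 - \<delta>) = 1" using KK by (simp add: powr_add[symmetric])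
          ultimately have "x powr (1 - \<delta>) \<le> KK powr (\<delta> - 1) * t powr (1 - \<delta>)"
            by (metis mult.assoc mult_1)
          also have "\<dots> \<le> KK powr 1 * t powr (1 - \<delta>)" using KK delta by (intro mult_right_mono powr_mono) auto
          finally show ?thesis using KK by simp
        qed
        moreover have "exp (- (B * x)) \<le> exp 1 * exp (- (B * t))"
        proof -
          have "B * t \<le> B * (x + d)" using tx B0 by (rule mult_left_mono)
          moreover have "B * d \<le> 1" using E by (simp add: d_def)
          ultimately have "- (B * x) \<le> 1 + - (B * t)" by (simp add: distrib_left)
          then show ?thesis by (simp only: exp_add[symmetric] exp_le_cancel_iff)
        qed
        ultimately have "x powr (1 - \<delta>) * exp (- (B * x)) \<le> (KK * t powr (1 - \<delta>)) * (exp 1 * exp (- (B * t)))"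
          using KK by (intro mult_mono) auto
        then show ?thesis by (simp add: dscale_fn_def mult_ac)
      qed
      then have "(M + 1) * dscale_fn \<delta> B x \<le> (M + 1) * (exp 1 * KK * dscale_fn \<delta> B t)" using M by (intro mult_left_mono) auto
      also have "\<dots> = (B / \<beta>) * dscale_fn \<delta> B t" using beta by (simp add: B_def)
      finally have gain: "(M + 1) * dscale_fn \<delta> B x \<le> (B / \<beta>) * dscale_fn \<delta> B t" .
      \<comment> \<open>The terms with factor \<rho>, from the flux at 0 and from the mass missing
        in Jensen's inequality, are paid by the \<open>- \<rho>\<close> of the jump. They vanish
        with h because t \<ge> sqrt (C0 h) and (3 - \<delta>) / 2 > 0.\<close>
      have loss: "kap * (h * \<mu> + 2 * (B / \<beta>) * h * t powr (1 - \<delta>)) \<le> 1"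
      proof -
        have "h * t powr (1 - \<delta>) \<le> C0 powr ((1 - \<delta>) / 2) * h powr ((3 - \<delta>) / 2)"
        proof -
          have "sqrt (C0 * h) \<le> t" unfolding t_def by simp
          then have "t powr (1 - \<delta>) \<le> sqrt (C0 * h) powr (1 - \<delta>)" using C0 h delta by (intro powr_mono2') auto
          also have "\<dots> = C0 powr ((1 - \<delta>) / 2) * h powr ((1 - \<delta>) / 2)"
            using C0 h by (simp add: powr_half_sqrt[symmetric] powr_powr powr_mult)
          finally have "h * t powr (1 - \<delta>) \<le> h * (C0 powr ((1 - \<delta>) / 2) * h powr ((1 - \<delta>) / 2))" using h by (intro mult_left_mono) auto
          also have "\<dots> = C0 powr ((1 - \<delta>) / 2) * (h powr 1 * h powr ((1 - \<delta>) / 2))" using h by simp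
          also have "h powr 1 * h powr ((1 - \<delta>) / 2) = h powr ((3 - \<delta>) / 2)"
            unfolding powr_add[symmetric] by (rule arg_cong[where f = "\<lambda>v. h powr v"]) (simp add: field_simps)
          finally show ?thesis .
        qed
        then have "2 * (B / \<beta>) * (h * t powr (1 - \<delta>)) \<le> 2 * (B / \<beta>) * (C0 powr ((1 - \<delta>) / 2) * h powr ((3 - \<delta>) / 2))"
          using B0 beta by (intro mult_left_mono) auto
        then have "kap * (h * \<mu> + 2 * (B / \<beta>) * (h * t powr (1 - \<delta>))) \<le> kap * (h * \<mu> + 2 * (B / \<beta>) * (C0 powr ((1 - \<delta>) / 2) * h powr ((3 - \<delta>) / 2)))"
          by (rule mult_left_mono[OF add_left_mono kap0])
        also have "\<dots> \<le> 1" using E by blast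
        finally show ?thesis by (simp only: mult.assoc)
      qed
      have "kap * (h * \<mu> + 2 * (B / \<beta>) * h * t powr (1 - \<delta>)) * \<rho> \<le> 1 * \<rho>" using loss \<rho> by (intro mult_right_mono) auto
      then have loss': "kap * (2 * h * (B / \<beta>) * t powr (1 - \<delta>) * \<rho> + h * \<mu> * \<rho>) \<le> \<rho>" by (simp add: algebra_simps)
      have gs: "scale_fn \<delta> B s \<le> scale_fn \<delta> B x + h * M * dscale_fn \<delta> B x"
      proof -
        have "scale_fn \<delta> B s \<le> scale_fn \<delta> B (x + h * M)" by (rule scale_fn_mono[OF delta B0 s])
        also have "\<dots> \<le> scale_fn \<delta> B x + h * M * dscale_fn \<delta> B x"
          using scale_fn_increment[OF delta B0 x, of "x + h * M"] h M by simp
        finally show ?thesis .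
      qed
      have sqb: "(1 - lam * h) * (s\<^sup>2 + h * C0) \<le> x\<^sup>2 - lam / 2 * h * x\<^sup>2 + h * C1"
        unfolding C1_def
        by (rule shifted_square_bound) (use lam M h E C0 x s in auto)
      have "(\<integral>y. lyapunov \<delta> kap B y \<partial>S.R s) \<le> 1 + kap * (scale_fn \<delta> B s - h * (B / \<beta>) * (dscale_fn \<delta> B t - 2 * \<rho> * t powr (1 - \<delta>)) + h * \<mu> * \<rho>)
          + (1 - lam * h) * (s\<^sup>2 + h * C0) - \<rho>"
        using S.W_bound[OF s(1) B0 kap0 tpos st] by (simp only: C0_def \<rho>_def)
      also have "\<dots> = 1 + kap * scale_fn \<delta> B s - kap * h * ((B / \<beta>) * dscale_fn \<delta> B t)
          + kap * (2 * h * (B / \<beta>) * t powr (1 - \<delta>) * \<rho> + h * \<mu> * \<rho>) + (1 - lam * h) * (s\<^sup>2 + h * C0) - \<rho>"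
        by (simp add: algebra_simps)
      also have "\<dots> \<le> 1 + kap * (scale_fn \<delta> B x + h * M * dscale_fn \<delta> B x) - kap * h * ((M + 1) * dscale_fn \<delta> B x)
          + \<rho> + (x\<^sup>2 - lam / 2 * h * x\<^sup>2 + h * C1) - \<rho>"
      proof -
        have "0 \<le> kap * h" using kap0 h by simp
        moreover have "1 + v1 - v2 + v3 + v4 - v5 \<le> 1 + w1 - w2 + w3 + w4 - v5"
          if "v1 \<le> w1" "w2 \<le> v2" "v3 \<le> w3" "v4 \<le> w4" for v1 v2 v3 v4 v5 w1 w2 w3 w4 :: real
          using that by linarith
        ultimately show ?thesis
          using mult_left_mono[OF gs kap0] mult_left_mono[OF gain] loss' sqb by blast
      qed
      also have "\<dots> = lyapunov \<delta> kap B x - h * (kap * dscale_fn \<delta> B x + lam / 2 * x\<^sup>2 - C1)"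
        using x by (simp add: lyapunov_pos algebra_simps)
      also have "\<dots> \<le> lyapunov \<delta> kap B x - h * (1 + lam / 4 * x\<^sup>2)"
      proof -
        have "1 + lam / 4 * x\<^sup>2 \<le> kap * dscale_fn \<delta> B x + lam / 2 * x\<^sup>2 - C1"
        proof (cases "x \<le> X0")
          case True
          have "kap * dscale_fn \<delta> B X0 \<le> kap * dscale_fn \<delta> B x" using dscale_fn_antimono[OF delta B0 x True] kap0 by (rule mult_left_mono)
          moreover have "kap * dscale_fn \<delta> B X0 = C1 + 1" using dX0 by (simp add: kap_def)
          moreover have "0 \<le> lam / 4 * x\<^sup>2" "lam / 2 * x\<^sup>2 = lam / 4 * x\<^sup>2 + lam / 4 * x\<^sup>2" using lam by auto
          ultimately show ?thesis by linarith
        next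
          case False
          have "X0\<^sup>2 \<le> x\<^sup>2" using False X0(1) by (intro power_mono) auto
          then have "C1 + 1 \<le> lam / 4 * x\<^sup>2" unfolding X0(2)[symmetric] using lam by (intro mult_left_mono) auto
          moreover have "0 \<le> kap * dscale_fn \<delta> B x" using kap0 dscale_fn_pos[OF delta B0 x] by simp
          moreover have "lam / 2 * x\<^sup>2 = lam / 4 * x\<^sup>2 + lam / 4 * x\<^sup>2" by simp
          ultimately show ?thesis by linarith
        qed
        then have "h * (1 + lam / 4 * x\<^sup>2) \<le> h * (kap * dscale_fn \<delta> B x + lam / 2 * x\<^sup>2 - C1)" using h by (intro mult_left_mono) auto
        then show ?thesis by linarith
      qed
      also have "\<dots> \<le> lyapunov \<delta> kap B x - h * (c * lyapunov \<delta> kap B x)"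
      proof -
        have D: "0 < 1 + kap / (2 - \<delta>)" using kap delta by (simp add: add_pos_pos)
        have "c * lyapunov \<delta> kap B x \<le> c * ((1 + kap / (2 - \<delta>)) * (1 + x\<^sup>2))"
          using lyapunov_le[OF delta B0 kap0, of x] x c by (intro mult_left_mono) auto
        also have "\<dots> = min 1 (lam / 4) * (1 + x\<^sup>2)" using D by (simp add: c_def)
        also have "\<dots> = min 1 (lam / 4) * 1 + min 1 (lam / 4) * x\<^sup>2" by (simp only: distrib_left)
        also have "\<dots> \<le> 1 + lam / 4 * x\<^sup>2" by (intro add_mono mult_right_mono) auto
        finally have "h * (c * lyapunov \<delta> kap B x) \<le> h * (1 + lam / 4 * x\<^sup>2)" using h by (intro mult_left_mono) auto
        then show ?thesis by linarith
      qed
      also have "\<dots> = (1 - c * h) * lyapunov \<delta> kap B x" by (simp add: algebra_simps)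
      finally show ?thesis unfolding R .
    qed
  qed
  have "\<forall>h x s. 0 < h \<longrightarrow> h \<le> h0 \<longrightarrow> 2 * lam * h \<le> 1 \<and> h \<le> 1 \<and> c * h < 1 \<and>
    (0 < x \<longrightarrow> 0 \<le> s \<longrightarrow> s \<le> x + h * M \<longrightarrow>
      (\<integral>y. lyapunov \<delta> kap B y \<partial>sticky_resolvent lam \<beta> \<delta> \<mu> h s) \<le> (1 - c * h) * lyapunov \<delta> kap B x)"
  proof (intro allI impI)
    fix h x s assume h: "0 < h" "h \<le> h0"
    have "c * h < 1" using H[OF h] by linarith
    then show "2 * lam * h \<le> 1 \<and> h \<le> 1 \<and> c * h < 1 \<and>
      (0 < x \<longrightarrow> 0 \<le> s \<longrightarrow> s \<le> x + h * M \<longrightarrow>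
      (\<integral>y. lyapunov \<delta> kap B y \<partial>sticky_resolvent lam \<beta> \<delta> \<mu> h s) \<le> (1 - c * h) * lyapunov \<delta> kap B x)"
      using H[OF h] drift[OF h] by blast
  qed
  with B0 kap0 c h0 show ?thesis by blast
qed

section \<open>The clamped kernel as a contracting kernel\<close>

lemma resolvent_V_bound:
  assumes "sticky lam \<beta> \<delta> \<mu> h" "0 \<le> s"
  shows "integrable (sticky_resolvent lam \<beta> \<delta> \<mu> h s) (\<lambda>y. 1 + y\<^sup>2)"
    and "(\<integral>y. 1 + y\<^sup>2 \<partial>sticky_resolvent lam \<beta> \<delta> \<mu> h s) \<le> 1 + (1 - lam * h) * (s\<^sup>2 + h * (2 * \<delta> / \<beta>))"
proof -
  interpret S: sticky lam \<beta> \<delta> \<mu> h by fact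
  have i: "integrable (S.R s) (\<lambda>_. 1 :: real)" "integrable (S.R s) (\<lambda>y. y\<^sup>2)"
    by (rule S.integrable_R[OF assms(2) S.test_adm[OF S.test_one]], rule S.integrable_R[OF assms(2) S.test_adm[OF S.test_sq]])
  then show "integrable (sticky_resolvent lam \<beta> \<delta> \<mu> h s) (\<lambda>y. 1 + y\<^sup>2)"
    unfolding S.R_def[symmetric] by (rule Bochner_Integration.integrable_add)
  have "(\<integral>y. 1 + y\<^sup>2 \<partial>S.R s) = (\<integral>y. 1 \<partial>S.R s) + (\<integral>y. y\<^sup>2 \<partial>S.R s)"
    by (rule Bochner_Integration.integral_add[OF i])
  then show "(\<integral>y. 1 + y\<^sup>2 \<partial>sticky_resolvent lam \<beta> \<delta> \<mu> h s) \<le> 1 + (1 - lam * h) * (s\<^sup>2 + h * (2 * \<delta> / \<beta>))"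
    using S.y2_le(2)[OF assms(2)] unfolding S.integral_R_one[OF assms(2)] S.R_def[symmetric] S.y2_def by simp
qed

lemma cutoff_euler_properties:
  assumes G': "\<And>x. 0 \<le> x \<Longrightarrow> (G' has_real_derivative G'' x) (at x within {0..})"
    and bdd: "bounded (G' ` {0..})"
    and eta: "clamp_cutoff (h * sup_norm G') \<eta>"
    and euler: "clamped_euler_map G' h (cutoff_euler \<eta> G' h)" and h: "0 < h"
  shows "cutoff_euler \<eta> G' h \<in> measurable halfline halfline"
    and "\<And>x. 0 \<le> x \<Longrightarrow> 0 \<le> cutoff_euler \<eta> G' h x"
    and "\<And>x. 0 \<le> x \<Longrightarrow> cutoff_euler \<eta> G' h x \<le> x + h * sup_norm G'"
    and "cutoff_euler \<eta> G' h 0 = 0" and "0 \<le> sup_norm G'"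
proof -
  have "bdd_above ((\<lambda>x. \<bar>G' x\<bar>) ` {0..})"
    using bdd by (auto simp: bounded_iff bdd_above_def)
  then have M: "\<bar>G' x\<bar> \<le> sup_norm G'" if "0 \<le> x" for x
    unfolding sup_norm_def using that by (intro cSUP_upper) auto
  show M0: "0 \<le> sup_norm G'" using M[of 0] by simp
  show pos: "0 \<le> cutoff_euler \<eta> G' h x" if "0 \<le> x" for x
    using euler that by (simp add: clamped_euler_map_def)
  show "cutoff_euler \<eta> G' h 0 = 0" using euler by (simp add: clamped_euler_map_def)
  show "cutoff_euler \<eta> G' h x \<le> x + h * sup_norm G'" if x: "0 \<le> x" for x
  proof -
    have e: "0 \<le> \<eta> x" "\<eta> x \<le> 1" using eta x by (auto simp: clamp_cutoff_def)
    have "- (h * G' x) \<le> h * sup_norm G'" using M[OF x] h mult_left_mono[of "- G' x" "sup_norm G'" h] by simp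
    then have "x - h * G' x \<le> x + h * sup_norm G'" by simp
    then have "\<eta> x * (x - h * G' x) \<le> \<eta> x * (x + h * sup_norm G')" using e by (intro mult_left_mono)
    also have "\<dots> \<le> 1 * (x + h * sup_norm G')" using e x h M0 by (intro mult_right_mono) auto
    finally show ?thesis by (simp add: cutoff_euler_def)
  qed
  have "continuous_on {0..} \<eta>"
    using eta unfolding clamp_cutoff_def C1_halfline_def by (auto intro: DERIV_continuous_on)
  moreover have "continuous_on {0..} G'" by (rule DERIV_continuous_on) (use G' in auto)
  ultimately have "continuous_on {0..} (cutoff_euler \<eta> G' h)"
    unfolding cutoff_euler_def by (intro continuous_on_mult continuous_on_diff continuous_on_const continuous_on_id)
  then have m: "cutoff_euler \<eta> G' h \<in> borel_measurable halfline" by (rule borel_measurable_halfline_continuous)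
  have "cutoff_euler \<eta> G' h \<in> space halfline \<rightarrow> {0..}" using pos by simp
  from measurable_restrict_space2[OF this m]
  show "cutoff_euler \<eta> G' h \<in> measurable halfline halfline" by (simp only: halfline_def)
qed

lemma clamped_ula_contracting:
  assumes st: "sticky lam \<beta> \<delta> \<mu> h" and B: "0 \<le> B" and kap: "0 \<le> kap" and c: "0 < c" "c * h < 1" and M: "0 \<le> M" and h1: "h \<le> 1"
    and drift: "\<And>x s. 0 < x \<Longrightarrow> 0 \<le> s \<Longrightarrow> s \<le> x + h * M \<Longrightarrow>
      (\<integral>y. lyapunov \<delta> kap B y \<partial>sticky_resolvent lam \<beta> \<delta> \<mu> h s) \<le> (1 - c * h) * lyapunov \<delta> kap B x"
    and \<phi>: "\<phi> \<in> measurable halfline halfline" "\<And>x. 0 \<le> x \<Longrightarrow> 0 \<le> \<phi> x" "\<And>x. 0 \<le> x \<Longrightarrow> \<phi> x \<le> x + h * M" "\<phi> 0 = 0"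
  shows "contracting_kernel halfline (clamped_ula lam \<beta> \<delta> \<mu> \<phi> h) 0 (\<lambda>x. 1 + x\<^sup>2) (lyapunov \<delta> kap B) (c * h) (lam / 2 * h)
    (h * (lam / 2 + (2 * M\<^sup>2 / lam + M\<^sup>2 + 2 * \<delta> / \<beta>))) (1 + kap / (2 - \<delta>))"
proof -
  interpret S: sticky lam \<beta> \<delta> \<mu> h by fact
  have d: "1 < \<delta>" "\<delta> < 2" "0 < lam" "0 < \<beta>" "0 < h" "2 * lam * h \<le> 1" using S.delta S.lam S.beta S.h by auto
  have K: "clamped_ula lam \<beta> \<delta> \<mu> \<phi> h x = S.R (\<phi> x)" for x by (simp add: clamped_ula_def S.R_def)
  note Wpos = lyapunov_nonneg[OF d(1,2) B kap]
  have admW: "S.adm (lyapunov \<delta> kap B)" by (rule S.W_integral(1)[OF order_refl B])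
  have admV: "S.adm (\<lambda>x. 1 + x\<^sup>2)"
    using S.adm_linear[OF S.test_adm[OF S.test_one] S.test_adm[OF S.test_sq], of 1 1] by simp
  show ?thesis
  proof
    show "clamped_ula lam \<beta> \<delta> \<mu> \<phi> h \<in> halfline \<rightarrow>\<^sub>M prob_algebra halfline"
      unfolding K[abs_def] by (rule measurable_compose[OF \<phi>(1) S.R_measurable])
    show "0 \<in> space halfline" by simp
    show "{0} \<in> sets halfline" by (simp add: sets_halfline)
    show "(\<lambda>x. 1 + x\<^sup>2) \<in> borel_measurable halfline" using admV by (simp add: S.adm_def)
    show "lyapunov \<delta> kap B \<in> borel_measurable halfline" using admW by (simp add: S.adm_def)
    show "1 \<le> 1 + x\<^sup>2" for x :: real by simp
    show "0 \<le> lyapunov \<delta> kap B x" if "x \<in> space halfline" for x using Wpos that by simp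
    show "lyapunov \<delta> kap B 0 = 0" by (simp add: lyapunov_def)
    show VW: "1 + x\<^sup>2 \<le> lyapunov \<delta> kap B x" if "x \<in> space halfline" "x \<noteq> 0" for x
      using lyapunov_ge[OF d(1,2) B kap, of x] that by simp
    show "1 + x\<^sup>2 + (1 + y\<^sup>2) \<le> 2 * max (lyapunov \<delta> kap B x) (lyapunov \<delta> kap B y)"
      if "x \<in> space halfline" "y \<in> space halfline" "x \<noteq> y" for x y
    proof -
      have "1 + x\<^sup>2 \<le> max (lyapunov \<delta> kap B x) (lyapunov \<delta> kap B y)"
      proof (cases "x = 0")
        case True
        then have "1 + x\<^sup>2 \<le> 1 + y\<^sup>2" by simp
        also have "\<dots> \<le> lyapunov \<delta> kap B y" using VW[of y] that True by simp
        finally show ?thesis by simp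
      qed (use VW[of x] that in simp)
      moreover have "1 + y\<^sup>2 \<le> max (lyapunov \<delta> kap B x) (lyapunov \<delta> kap B y)"
      proof (cases "y = 0")
        case True
        then have "1 + y\<^sup>2 \<le> 1 + x\<^sup>2" by simp
        also have "\<dots> \<le> lyapunov \<delta> kap B x" using VW[of x] that True by simp
        finally show ?thesis by simp
      qed (use VW[of y] that in simp)
      ultimately show ?thesis by linarith
    qed
    show "lyapunov \<delta> kap B x \<le> (1 + kap / (2 - \<delta>)) * (1 + x\<^sup>2)" if "x \<in> space halfline" for x
      using lyapunov_le[OF d(1,2) B kap, of x] that by simp
    show "0 < c * h" "c * h < 1" using c d by auto
    show "0 < lam / 2 * h" using d by simp
    show "lam / 2 * h < 1" using d(6) by simp
    have "0 \<le> 2 * M\<^sup>2 / lam" "0 \<le> M\<^sup>2" "0 \<le> 2 * \<delta> / \<beta>" using d by auto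
    then have "0 \<le> lam / 2 + (2 * M\<^sup>2 / lam + M\<^sup>2 + 2 * \<delta> / \<beta>)" using d(3) by linarith
    then show "0 \<le> h * (lam / 2 + (2 * M\<^sup>2 / lam + M\<^sup>2 + 2 * \<delta> / \<beta>))" using d(5) by simp
    show "integrable (clamped_ula lam \<beta> \<delta> \<mu> \<phi> h x) (\<lambda>x. 1 + x\<^sup>2)" if "x \<in> space halfline" for x
      unfolding clamped_ula_def by (rule resolvent_V_bound(1)[OF st]) (use \<phi>(2) that in simp)
    show "(\<integral>y. 1 + y\<^sup>2 \<partial>clamped_ula lam \<beta> \<delta> \<mu> \<phi> h x) \<le> (1 - lam / 2 * h) * (1 + x\<^sup>2)
        + h * (lam / 2 + (2 * M\<^sup>2 / lam + M\<^sup>2 + 2 * \<delta> / \<beta>))" if "x \<in> space halfline" for x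
    proof -
      have x: "0 \<le> x" using that by simp
      have "(\<integral>y. 1 + y\<^sup>2 \<partial>clamped_ula lam \<beta> \<delta> \<mu> \<phi> h x) \<le> 1 + (1 - lam * h) * ((\<phi> x)\<^sup>2 + h * (2 * \<delta> / \<beta>))"
        unfolding clamped_ula_def by (rule resolvent_V_bound(2)[OF st \<phi>(2)[OF x]])
      also have "(1 - lam * h) * ((\<phi> x)\<^sup>2 + h * (2 * \<delta> / \<beta>)) \<le> x\<^sup>2 - lam / 2 * h * x\<^sup>2 + h * (2 * M\<^sup>2 / lam + M\<^sup>2 + 2 * \<delta> / \<beta>)"
      proof (rule shifted_square_bound[OF d(3) M d(5) h1 _ _ x \<phi>(2)[OF x] \<phi>(3)[OF x]])
        have "0 \<le> lam * h" using d by simp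
        then show "lam * h \<le> 1" using d(6) by simp
      qed (use d in simp)
      finally have "(\<integral>y. 1 + y\<^sup>2 \<partial>clamped_ula lam \<beta> \<delta> \<mu> \<phi> h x)
        \<le> 1 + (x\<^sup>2 - lam / 2 * h * x\<^sup>2 + h * (2 * M\<^sup>2 / lam + M\<^sup>2 + 2 * \<delta> / \<beta>))" by simp
      moreover have "1 + (x\<^sup>2 - lam / 2 * h * x\<^sup>2 + h * v) = (1 - lam / 2 * h) * (1 + x\<^sup>2) + h * (lam / 2 + v)" for v
        by (simp add: field_simps)
      ultimately show ?thesis by simp
    qed
    show "(\<integral>y. lyapunov \<delta> kap B y \<partial>clamped_ula lam \<beta> \<delta> \<mu> \<phi> h x) \<le> (1 - c * h) * lyapunov \<delta> kap B x"
      if "x \<in> space halfline" "x \<noteq> 0" for x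
      unfolding clamped_ula_def by (rule drift) (use \<phi>(2)[of x] \<phi>(3)[of x] that in auto)
  next
    fix f :: "real \<Rightarrow> real" and C k x y :: real
    assume f: "f \<in> borel_measurable halfline" "\<And>x. x \<in> space halfline \<Longrightarrow> \<bar>f x\<bar> \<le> C * (1 + x\<^sup>2)" and k: "0 \<le> k"
      and osc: "\<And>x y. x \<in> space halfline \<Longrightarrow> y \<in> space halfline \<Longrightarrow> \<bar>f x - f y\<bar> \<le> k * max (lyapunov \<delta> kap B x) (lyapunov \<delta> kap B y)"
      and xy: "x \<in> space halfline" "y \<in> space halfline"
    have "S.adm f"
      unfolding S.adm_def
    proof (intro conjI f(1))
      have fm: "(\<lambda>y. indicator {0..} y * f y) \<in> borel_measurable borel"
        using f(1) by (simp only: borel_measurable_halfline_iff)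
      have mm: "S.m \<in> borel_measurable borel" unfolding S.m_def cir_speed_def[abs_def] by measurable
      show "set_integrable lborel {0..} (\<lambda>y. S.m y * f y)"
      proof (rule set_integrable_bound[of _ _ "\<lambda>y. C * (S.m y * (1 + y\<^sup>2))"])
        show "set_integrable lborel {0..} (\<lambda>y. C * (S.m y * (1 + y\<^sup>2)))"
          by (rule set_integrable_mult_right) (use admV in \<open>simp add: S.adm_def\<close>)
        have "(\<lambda>y. S.m y * (indicator {0..} y * f y)) \<in> borel_measurable lborel" using fm mm by simp
        then show "set_borel_measurable lborel {0..} (\<lambda>y. S.m y * f y)"
          by (simp add: set_borel_measurable_def mult_ac)
        have "norm (S.m y * f y) \<le> norm (C * (S.m y * (1 + y\<^sup>2)))" if "y \<in> {0..}" for y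
        proof -
          have "S.m y * \<bar>f y\<bar> \<le> S.m y * (C * (1 + y\<^sup>2))" using f(2)[of y] that S.m_nonneg[of y] by (intro mult_left_mono) auto
          also have "\<dots> = C * (S.m y * (1 + y\<^sup>2))" by (simp only: mult_ac)
          also have "\<dots> \<le> norm (C * (S.m y * (1 + y\<^sup>2)))" unfolding real_norm_def by (rule abs_ge_self)
          finally show ?thesis using S.m_nonneg[of y] by (simp add: abs_mult)
        qed
        then show "AE y in lborel. y \<in> {0..} \<longrightarrow> norm (S.m y * f y) \<le> norm (C * (S.m y * (1 + y\<^sup>2)))" by simp
      qed
    qed
    note admf = this
    have admkW: "S.adm (\<lambda>y. k * lyapunov \<delta> kap B y)" using S.adm_linear[OF admW admW, of k 0] by simp
    have osc': "\<bar>f v - f u\<bar> \<le> k * lyapunov \<delta> kap B v" if "0 \<le> u" "u < v" for u v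
    proof -
      have "max (lyapunov \<delta> kap B v) (lyapunov \<delta> kap B u) = lyapunov \<delta> kap B v"
        using lyapunov_mono[OF d(1,2) B kap, of u v] that by simp
      then show ?thesis using osc[of v u] that by simp
    qed
    \<comment> \<open>Here v is the point with the larger image, which need not be the larger point
      because \<phi> may fail to be monotone. The drift is applied at v, and the maximum is
      symmetric.\<close>
    have main: "\<bar>(\<integral>u. f u \<partial>S.R (\<phi> v)) - (\<integral>u. f u \<partial>S.R (\<phi> w))\<bar> \<le> (1 - c * h) * k * max (lyapunov \<delta> kap B v) (lyapunov \<delta> kap B w)"
      if vw: "0 \<le> v" "0 \<le> w" "\<phi> w \<le> \<phi> v" for v w
    proof (cases "v = 0")
      \<comment> \<open>At v = 0 no drift is available, but \<phi> 0 = 0 forces \<phi> w = 0, so the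
        two laws coincide.\<close>
      case True
      then have "\<phi> w = \<phi> v" using vw \<phi>(2)[OF vw(2)] \<phi>(4) by simp
      then show ?thesis using Wpos[OF vw(1)] k c(2) by (simp add: max_def mult_nonneg_nonneg Wpos[OF vw(2)])
    next
      case False
      then have v: "0 < v" using vw by simp
      have "\<bar>(\<integral>u. f u \<partial>S.R (\<phi> v)) - (\<integral>u. f u \<partial>S.R (\<phi> w))\<bar> \<le> (\<integral>u. k * lyapunov \<delta> kap B u \<partial>S.R (\<phi> v))"
        by (rule S.R_abs_diff_le[OF \<phi>(2)[OF vw(2)] vw(3) admf admkW _ osc']) (use k Wpos in auto)
      also have "\<dots> = k * (\<integral>u. lyapunov \<delta> kap B u \<partial>S.R (\<phi> v))" by simp
      also have "\<dots> \<le> k * ((1 - c * h) * lyapunov \<delta> kap B v)"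
        using drift[OF v \<phi>(2)[OF vw(1)] \<phi>(3)[OF vw(1)]] k unfolding S.R_def by (rule mult_left_mono)
      also have "\<dots> = (1 - c * h) * k * lyapunov \<delta> kap B v" by simp
      also have "\<dots> \<le> (1 - c * h) * k * max (lyapunov \<delta> kap B v) (lyapunov \<delta> kap B w)"
        using k c(2) by (intro mult_left_mono) auto
      finally show ?thesis .
    qed
    have x0: "0 \<le> x" "0 \<le> y" using xy by auto
    show "\<bar>(\<integral>u. f u \<partial>clamped_ula lam \<beta> \<delta> \<mu> \<phi> h x) - (\<integral>u. f u \<partial>clamped_ula lam \<beta> \<delta> \<mu> \<phi> h y)\<bar>
       \<le> (1 - c * h) * k * max (lyapunov \<delta> kap B x) (lyapunov \<delta> kap B y)"
      unfolding K
    proof (cases "\<phi> y \<le> \<phi> x")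
      case True
      show "\<bar>(\<integral>u. f u \<partial>S.R (\<phi> x)) - (\<integral>u. f u \<partial>S.R (\<phi> y))\<bar> \<le> (1 - c * h) * k * max (lyapunov \<delta> kap B x) (lyapunov \<delta> kap B y)"
        by (rule main[OF x0 True])
    next
      case False
      then have "\<phi> x \<le> \<phi> y" by simp
      from main[OF x0(2,1) this]
      show "\<bar>(\<integral>u. f u \<partial>S.R (\<phi> x)) - (\<integral>u. f u \<partial>S.R (\<phi> y))\<bar> \<le> (1 - c * h) * k * max (lyapunov \<delta> kap B x) (lyapunov \<delta> kap B y)"
        by (subst abs_minus_commute, subst max.commute)
    qed
  qed
qed

theorem propositionA4:
  fixes lam \<beta> \<delta> \<mu> h1 :: real
    and G G' G'' :: "real \<Rightarrow> real"
    and \<eta> :: "real \<Rightarrow> real \<Rightarrow> real"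
    and V :: "real \<Rightarrow> real"
    and K :: "real \<Rightarrow> real \<Rightarrow> real measure"
  assumes "0 < lam" and "0 < \<beta>" and "0 < \<mu>" and "1 < \<delta>" and "\<delta> < 2"
    and "\<And>x. 0 \<le> x \<Longrightarrow> (G has_real_derivative G' x) (at x within {0..})"
    and "\<And>x. 0 \<le> x \<Longrightarrow> (G' has_real_derivative G'' x) (at x within {0..})"
    and "continuous_on {0..} G''"
    and "bounded (G' ` {0..})"
    and "0 < h1"
    and "\<And>h. 0 < h \<Longrightarrow> h \<le> h1 \<Longrightarrow> clamp_cutoff (h * sup_norm G') (\<eta> h)"
    and "\<And>h. 0 < h \<Longrightarrow> h \<le> h1 \<Longrightarrow> clamped_euler_map G' h (cutoff_euler (\<eta> h) G' h)"
  defines "V \<equiv> (\<lambda>x. 1 + x\<^sup>2)"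
    and "K \<equiv> (\<lambda>h. clamped_ula lam \<beta> \<delta> \<mu> (cutoff_euler (\<eta> h) G' h) h)"
  shows "\<exists>c C h0. 0 < c \<and> 0 < h0 \<and>
    (\<forall>h. 0 < h \<and> h \<le> h0 \<longrightarrow>
      (\<exists>\<pi>. stationary_distribution halfline (K h) \<pi> \<and>
           (\<forall>\<pi>'. stationary_distribution halfline (K h) \<pi>' \<longrightarrow> \<pi>' = \<pi>) \<and>
           (\<forall>x\<ge>0. \<forall>n. V_norm_diff V (kernel_pow halfline (K h) n x) \<pi>
                        \<le> ennreal (C * V x * (1 - c * h) ^ n))))"
proof -
  define M where "M = sup_norm G'"
  have M: "0 \<le> M"
    unfolding M_def by (rule cutoff_euler_properties(5)[OF assms(7,9) assms(11,12)[of h1]]) (use assms(10) in auto)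
  obtain B kap c h2 where B: "0 \<le> B" "0 \<le> kap" "0 < c" "0 < h2"
    and H: "\<forall>h x s. 0 < h \<longrightarrow> h \<le> h2 \<longrightarrow> 2 * lam * h \<le> 1 \<and> h \<le> 1 \<and> c * h < 1 \<and>
      (0 < x \<longrightarrow> 0 \<le> s \<longrightarrow> s \<le> x + h * M \<longrightarrow>
      (\<integral>y. lyapunov \<delta> kap B y \<partial>sticky_resolvent lam \<beta> \<delta> \<mu> h s) \<le> (1 - c * h) * lyapunov \<delta> kap B x)"
    using lyapunov_drift[OF assms(1-5) M] by blast
  define b where "b = lam / 2 + (2 * M\<^sup>2 / lam + M\<^sup>2 + 2 * \<delta> / \<beta>)"
  define D where "D = 1 + kap / (2 - \<delta>)"
  have "\<exists>\<pi>. stationary_distribution halfline (K h) \<pi> \<and> (\<forall>\<pi>'. stationary_distribution halfline (K h) \<pi>' \<longrightarrow> \<pi>' = \<pi>) \<and>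
     (\<forall>x\<ge>0. \<forall>n. V_norm_diff V (kernel_pow halfline (K h) n x) \<pi> \<le> ennreal (2 * D * (1 + b / (lam / 2)) * V x * (1 - c * h) ^ n))"
    if h: "0 < h" "h \<le> min h1 h2" for h
  proof -
    have h1: "h \<le> h1" and h2: "h \<le> h2" using h by auto
    have Hh: "2 * lam * h \<le> 1" "h \<le> 1" "c * h < 1" using H h(1) h2 by blast+
    have drift: "(\<integral>y. lyapunov \<delta> kap B y \<partial>sticky_resolvent lam \<beta> \<delta> \<mu> h s) \<le> (1 - c * h) * lyapunov \<delta> kap B x"
      if "0 < x" "0 \<le> s" "s \<le> x + h * M" for x s using H h(1) h2 that by blast
    have st: "sticky lam \<beta> \<delta> \<mu> h" by unfold_locales (use assms(1-5) h Hh in auto)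
    note P = cutoff_euler_properties[OF assms(7,9) assms(11)[OF h(1) h1] assms(12)[OF h(1) h1] h(1), folded M_def]
    interpret contracting_kernel halfline "K h" 0 V "lyapunov \<delta> kap B" "c * h" "lam / 2 * h" "h * b" D
      unfolding K_def V_def b_def D_def
      by (rule clamped_ula_contracting[OF st B(1-3) Hh(3) M Hh(2) drift P(1-4)])
    \<comment> \<open>Both constants of the V-drift are proportional to h, so the factor in front of
      the rate does not depend on h.\<close>
    have "h * b / (lam / 2 * h) = b / (lam / 2)" using h(1) by simp
    then show ?thesis using geometric_ergodicity by (simp add: atLeast_iff Ball_def)
  qed
  then show ?thesis using B(3,4) assms(10)
    by (intro exI[of _ c] exI[of _ "2 * D * (1 + b / (lam / 2))"] exI[of _ "min h1 h2"]) auto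
qed

end
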